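(* Let $(X,\mu)$ be a standard atomless probability space and let $G=\mathrm{Aut}(X,\mu)$. Let $\Gamma$ be a countable abelian group and let $\Delta$ be a finitely generated subgroup of $\Gamma$. Then the restriction map $\mathrm{Res}\colon \mathrm{Hom}(\Gamma,G)\to\mathrm{Hom}(\Delta,G)$, $\pi\mapsto\pi|_{\Delta}$, is category-preserving.
   Context: A standard atomless probability space is a probability space isomorphic to $[0,1]$ with Lebesgue measure. $G=\mathrm{Aut}(X,\mu)$ is the group of measure-preserving automorphisms of $(X,\mu)$, two automorphisms being identified if they agree on a set of full measure, with its usual Polish group topology: $g_n\to g$ iff $\mu(g_nA\,\triangle\, gA)\to 0$ for every measurable $A\subseteq X$. For a countable group $\Lambda$, $\mathrm{Hom}(\Lambda,G)$ is the set of homomorphisms $\Lambda\to G$, a closed subset of $G^{\Lambda}$ with the product topology, hence a Polish space. A continuous map $f\colon Y\to Z$ between Polish spaces is category-preserving if it satisfies one of the following equivalent conditions: (i) for any comeager $A\subseteq Z$, $f^{-1}(A)$ is comeager in $Y$; (ii) for any nonempty open $U\subseteq Y$, $f(U)$ is not meager in $Z$; (iii) for any nonempty open $U\subseteq Y$, $f(U)$ is somewhere dense in $Z$ (its closure has nonempty interior). *)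

theory Defs
  imports "HOL-Probability.Probability" "HOL-Algebra.Generated_Groups"
begin

subsection \<open>Standard atomless probability spaces and their automorphisms\<close>

text \<open>
  Isomorphisms of measure spaces are taken modulo null sets, and measurability is understood with
  respect to the completed measures, so that the unit interval with its Borel sets and with its
  Lebesgue sets are the same space. The maps are total functions whose values on a null set are
  irrelevant.
\<close>

definition mp_map :: "'a measure \<Rightarrow> 'b measure \<Rightarrow> ('a \<Rightarrow> 'b) \<Rightarrow> bool" where
  "mp_map M N f \<longleftrightarrow>
     f \<in> measurable (completion M) (completion N) \<and>
     (\<forall>B\<in>sets (completion N).
        emeasure (completion M) (f -` B \<inter> space M) = emeasure (completion N) B)"

definition mp_iso :: "'a measure \<Rightarrow> 'b measure \<Rightarrow> ('a \<Rightarrow> 'b) \<Rightarrow> bool" where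
  "mp_iso M N f \<longleftrightarrow> mp_map M N f \<and>
     (\<exists>g. mp_map N M g \<and> (AE x in M. g (f x) = x) \<and> (AE y in N. f (g y) = y))"

definition standard_atomless_prob_space :: "'a measure \<Rightarrow> bool" where
  "standard_atomless_prob_space M \<longleftrightarrow>
     prob_space M \<and> (\<exists>f. mp_iso M (lebesgue_on {0..1::real}) f)"

definition ae_eq_rel :: "'a measure \<Rightarrow> (('a \<Rightarrow> 'a) \<times> ('a \<Rightarrow> 'a)) set" where
  "ae_eq_rel M = {(f, g). mp_iso M M f \<and> mp_iso M M g \<and> (AE x in M. f x = g x)}"

definition Aut :: "'a measure \<Rightarrow> ('a \<Rightarrow> 'a) set monoid" where
  "Aut M = \<lparr>
     carrier = {f. mp_iso M M f} // ae_eq_rel M,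
     mult = (\<lambda>a b. {h. mp_iso M M h \<and> (\<exists>f\<in>a. \<exists>g\<in>b. AE x in M. h x = f (g x))}),
     one = ae_eq_rel M `` {\<lambda>x. x}\<rparr>"

text \<open>
  The image \<open>gA\<close> is only defined up to a null set. It is computed as the preimage of \<open>A\<close> under a
  representative of the inverse of \<open>g\<close>, because a representative of \<open>g\<close> itself may map a null set
  onto a set that is not null, or not measurable.
\<close>

definition aut_image :: "'a measure \<Rightarrow> ('a \<Rightarrow> 'a) set \<Rightarrow> 'a set \<Rightarrow> 'a set" where
  "aut_image M g A = (SOME f. f \<in> inv\<^bsub>Aut M\<^esub> g) -` A \<inter> space M"

text \<open>
  The topology of the family of pseudometrics \<open>\<mu>(gA \<triangle> hA)\<close>, generated by the open balls.
\<close>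

definition Aut_topology :: "'a measure \<Rightarrow> ('a \<Rightarrow> 'a) set topology" where
  "Aut_topology M = topology_generated_by
     {{h \<in> carrier (Aut M).
         measure (completion M) (sym_diff (aut_image M h A) (aut_image M g A)) < e} | g A e.
       g \<in> carrier (Aut M) \<and> A \<in> sets M \<and> e > 0}"


subsection \<open>Spaces of homomorphisms\<close>

text \<open>
  The product topology lives on extensional functions, so the points of this space are the
  homomorphisms that are undefined outside the carrier of the acting group.
\<close>

definition Hom_topology ::
    "('g, 'm) monoid_scheme \<Rightarrow> 'a measure \<Rightarrow> ('g \<Rightarrow> ('a \<Rightarrow> 'a) set) topology" where
  "Hom_topology L M =
     subtopology (product_topology (\<lambda>_. Aut_topology M) (carrier L)) (hom L (Aut M))"


subsection \<open>Category-preserving maps\<close>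

definition nowhere_dense_in :: "'a topology \<Rightarrow> 'a set \<Rightarrow> bool" where
  "nowhere_dense_in X S \<longleftrightarrow> S \<subseteq> topspace X \<and> X interior_of (X closure_of S) = {}"

definition meager_in :: "'a topology \<Rightarrow> 'a set \<Rightarrow> bool" where
  "meager_in X S \<longleftrightarrow> (\<exists>F. countable F \<and> (\<forall>T\<in>F. nowhere_dense_in X T) \<and> S = \<Union>F)"

definition comeager_in :: "'a topology \<Rightarrow> 'a set \<Rightarrow> bool" where
  "comeager_in X S \<longleftrightarrow> S \<subseteq> topspace X \<and> meager_in X (topspace X - S)"

definition category_preserving_map :: "'a topology \<Rightarrow> 'b topology \<Rightarrow> ('a \<Rightarrow> 'b) \<Rightarrow> bool" where
  "category_preserving_map X Y f \<longleftrightarrow> continuous_map X Y f \<and>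
     (\<forall>A. comeager_in Y A \<longrightarrow> comeager_in X {x \<in> topspace X. f x \<in> A})"

end

theory Submission
  imports Defs "HOL-Number_Theory.Cong" "HOL-Computational_Algebra.Primes"
begin

text \<open>
  By the definition of the topologies it is enough to find, for each \<open>\<pi>\<close> and each neighbourhood \<open>U\<close>
  of \<open>\<pi>\<close>, some \<open>\<pi>1 \<in> Hom(\<Delta>, G)\<close> such that every \<open>\<sigma>\<close> close to \<open>\<pi>1\<close> is a limit of restrictions of
  elements of \<open>U\<close>: then \<open>Res(U)\<close> is somewhere dense. The space \<open>X\<close> absorbs an infinite torus \<open>T\<close>:
  there are isomorphisms \<open>X \<times> T \<cong> X\<close> as close as desired to the first projection. Hence it
  suffices to construct the elements of \<open>U\<close> as actions on \<open>X \<times> T\<close>. Let \<open>\<Gamma>\<close> act on \<open>T\<close> by the rotations by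
  characters \<open>X x\<close>, and take the skew product with the cocycle \<open>f(k + X x) \<rho>(x) f(k)\<inverse>\<close>, where
  \<open>f\<close> is built from a map \<open>c : T \<rightarrow> \<Gamma>\<close> that is equivariant up to small sets (a Rokhlin tower).
  If \<open>\<Delta>\<close> is finite, then \<open>\<pi>1 = \<pi>|\<Delta>\<close>, \<open>\<rho> = \<pi>\<close> and \<open>f = \<sigma>(c) \<pi>(c)\<inverse>\<close> work. If \<open>z \<in> \<Delta>\<close> has infinite order,
  then \<open>\<rho> = 1\<close>; the map \<open>\<pi>1\<close> comes from \<open>f = \<pi> \<circ> c0\<close> over rotations in which the multiples of \<open>z\<close> are
  dense, and \<open>f = \<sigma> \<circ> r \<circ> c\<close>, where \<open>r\<close> moves points of \<open>\<Gamma>\<close> into \<open>\<Delta>\<close> by \<open>\<Delta>\<close>-translations of finitely many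
  coset representatives, each replaced by a multiple of \<open>z\<close> with nearly the same rotation.
\<close>

subsection \<open>Measure-preserving maps and automorphism classes\<close>

text \<open>The obstacle is the order of the choices. The finite test set and the radius around
  \<pi>1 are fixed before \<sigma>, and before the finite part of \<Delta> and the precision at
  which \<sigma> is to be approximated. If \<Delta> is finite, all of it can be tested, so every
  \<sigma>(d) \<pi>(d)\<inverse> hardly moves the sets that matter. If \<Delta> is infinite,
  closeness to \<pi> must be read off from \<sigma> on finitely many elements: every l in the finite
  set F is imitated by finitely many d \<in> \<Delta>, and \<pi>1 is built so that \<pi>1(d) is near
  \<pi>(l) for each of them. When \<sigma> is near \<pi>1, then \<sigma>(d) is near \<pi>(l); over
  most of the torus the new action of l moves the fibre by such a \<sigma>(d), while an l \<in>
  \<Delta> moves it by \<sigma>(l). Hence \<pi>1 need not be \<pi>|\<Delta>, and the finite set E of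
  coset representatives must be known before \<sigma>. The powers of z provide elements of \<Delta>
  whose rotations approximate those of the representatives; this is what makes each imitating d
  rotate almost like l.\<close>

lemma mp_mapI:
  assumes f: "f \<in> measurable (completion M) N"
    and e: "\<And>B. B \<in> sets N \<Longrightarrow> emeasure (completion M) (f -` B \<inter> space M) = emeasure N B"
  shows "mp_map M N f"
proof -
  have d: "distr (completion M) N f = N"
    by (rule measure_eqI) (use f e in \<open>auto simp: emeasure_distr\<close>)
  \<comment> \<open>The image of the measure is \<open>N\<close> itself, so preimages of null sets
    are null; this lifts measurability from \<open>N\<close> to its completion.\<close>
  have n: "null_sets N \<subseteq> null_sets (distr (completion M) N f)"
    using d by simp
  have m: "f \<in> measurable (completion M) (completion N)"
    by (rule completion.measurable_completion2[OF f n])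
  have "distr (completion M) (completion N) f = completion N"
    using completion.completion_distr_eq[OF f] d by simp
  then have "emeasure (completion M) (f -` B \<inter> space M) = emeasure (completion N) B"
    if "B \<in> sets (completion N)" for B
    using that m emeasure_distr[of f "completion M" "completion N" B] by simp
  with m show ?thesis unfolding mp_map_def by blast
qed

lemma mp_map_measurable: "mp_map M N f \<Longrightarrow> f \<in> measurable (completion M) (completion N)"
  by (simp add: mp_map_def)

lemma mp_map_measurable': "mp_map M N f \<Longrightarrow> f \<in> measurable (completion M) N"
  unfolding mp_map_def measurable_def by auto

lemma mp_map_space: "mp_map M N f \<Longrightarrow> x \<in> space M \<Longrightarrow> f x \<in> space N"
  using measurable_space[OF mp_map_measurable'[of M N f], of x] by simp

lemma mp_map_vimage:
  "mp_map M N f \<Longrightarrow> B \<in> sets (completion N) \<Longrightarrow> f -` B \<inter> space M \<in> sets (completion M)"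
  using measurable_sets[of f "completion M" "completion N" B] by (simp add: mp_map_def)

lemma mp_map_emeasure:
  "mp_map M N f \<Longrightarrow> B \<in> sets (completion N) \<Longrightarrow>
    emeasure (completion M) (f -` B \<inter> space M) = emeasure (completion N) B"
  by (simp add: mp_map_def)

lemma mp_map_measure:
  "mp_map M N f \<Longrightarrow> B \<in> sets (completion N) \<Longrightarrow>
    measure (completion M) (f -` B \<inter> space M) = measure (completion N) B"
  by (simp add: mp_map_emeasure measure_def)

lemma mp_map_measurable_imp:
  assumes "f \<in> measurable M N" "distr M N f = N"
  shows "mp_map M N f"
proof (rule mp_mapI)
  show "f \<in> measurable (completion M) N" by (rule measurable_completion[OF assms(1)])
  show "emeasure (completion M) (f -` B \<inter> space M) = emeasure N B" if "B \<in> sets N" for B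
    using that assms emeasure_distr[of f M N B] by simp
qed

lemma mp_map_AE:
  assumes f: "mp_map M N f" and P: "AE y in N. P y"
  shows "AE x in M. P (f x)"
proof -
  obtain Z where Z: "Z \<in> null_sets N" "{y \<in> space N. \<not> P y} \<subseteq> Z"
    using P by (auto simp: eventually_ae_filter)
  then have "f -` Z \<inter> space M \<in> null_sets (completion M)"
    using mp_map_vimage[OF f, of Z] mp_map_emeasure[OF f, of Z] by (auto simp: null_sets_def)
  then have "AE x in completion M. x \<notin> f -` Z \<inter> space M"
    by (rule AE_not_in)
  then have "AE x in completion M. P (f x)"
    using AE_space by eventually_elim (use Z(2) mp_map_space[OF f] in auto)
  then show ?thesis by (simp add: AE_completion_iff)
qed

lemma mp_map_compose:
  assumes f: "mp_map M N f" and g: "mp_map N K g"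
  shows "mp_map M K (\<lambda>x. g (f x))"
proof -
  have eq: "(\<lambda>x. g (f x)) -` B \<inter> space M = f -` (g -` B \<inter> space N) \<inter> space M" for B
    using mp_map_space[OF f] by auto
  have m: "(\<lambda>x. g (f x)) \<in> measurable (completion M) (completion K)"
    by (rule measurable_compose[OF mp_map_measurable[OF f] mp_map_measurable[OF g]])
  show ?thesis
    unfolding mp_map_def eq
    using m mp_map_emeasure[OF f mp_map_vimage[OF g]] mp_map_emeasure[OF g] by metis
qed

lemma mp_map_id: "mp_map M M (\<lambda>x. x)"
proof -
  have "(\<lambda>x. x) -` B \<inter> space M = B" if "B \<in> sets (completion M)" for B
    using sets.sets_into_space[OF that] by auto
  then show ?thesis unfolding mp_map_def by simp
qed

lemma mp_isoI:
  assumes "mp_map M N f" "mp_map N M g" "AE x in M. g (f x) = x" "AE y in N. f (g y) = y"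
  shows "mp_iso M N f"
  using assms unfolding mp_iso_def by blast

lemma mp_iso_id: "mp_iso M M (\<lambda>x. x)"
  by (rule mp_isoI[OF mp_map_id mp_map_id]) auto

lemma mp_iso_map: "mp_iso M N f \<Longrightarrow> mp_map M N f"
  by (simp add: mp_iso_def)

lemma mp_iso_inverse:
  assumes "mp_iso M N f"
  obtains g where "mp_iso N M g" "AE x in M. g (f x) = x" "AE y in N. f (g y) = y"
  using assms unfolding mp_iso_def by blast

lemma mp_iso_compose:
  assumes f: "mp_iso M N f" and g: "mp_iso N K g"
  shows "mp_iso M K (\<lambda>x. g (f x))"
proof -
  obtain f' where f': "mp_iso N M f'" "AE x in M. f' (f x) = x" "AE y in N. f (f' y) = y"
    using mp_iso_inverse[OF f] .
  obtain g' where g': "mp_iso K N g'" "AE x in N. g' (g x) = x" "AE y in K. g (g' y) = y"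
    using mp_iso_inverse[OF g] .
  note m = mp_iso_map[OF f] mp_iso_map[OF g] mp_iso_map[OF f'(1)] mp_iso_map[OF g'(1)]
  show ?thesis
  proof (rule mp_isoI)
    show "mp_map M K (\<lambda>x. g (f x))" "mp_map K M (\<lambda>x. f' (g' x))"
      by (rule mp_map_compose[OF m(1,2)], rule mp_map_compose[OF m(4,3)])
    show "AE x in M. f' (g' (g (f x))) = x"
      using mp_map_AE[OF m(1) g'(2)] f'(2) by eventually_elim auto
    show "AE y in K. g (f (f' (g' y))) = y"
      using mp_map_AE[OF m(4) f'(3)] g'(3) by eventually_elim auto
  qed
qed

section \<open>The group of automorphism classes\<close>

definition aut_class :: "'a measure \<Rightarrow> ('a \<Rightarrow> 'a) \<Rightarrow> ('a \<Rightarrow> 'a) set" where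
  "aut_class M f = ae_eq_rel M `` {f}"

text \<open>The same choice of a representative as in \<open>aut_image\<close>, so that images of
  sets can be computed with it.\<close>

definition aut_rep :: "('a \<Rightarrow> 'a) set \<Rightarrow> 'a \<Rightarrow> 'a" where
  "aut_rep g = (SOME f. f \<in> g)"

lemma equiv_ae_eq_rel: "equiv {f. mp_iso M M f} (ae_eq_rel M)"
proof (rule equivI)
  show "ae_eq_rel M \<subseteq> {f. mp_iso M M f} \<times> {f. mp_iso M M f}"
    by (auto simp: ae_eq_rel_def)
  show "refl_on {f. mp_iso M M f} (ae_eq_rel M)"
    by (auto simp: ae_eq_rel_def intro!: refl_onI)
  show "sym (ae_eq_rel M)"
  proof (rule symI)
    fix f g assume "(f, g) \<in> ae_eq_rel M"
    then have *: "mp_iso M M f" "mp_iso M M g" "AE x in M. f x = g x"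
      by (simp_all add: ae_eq_rel_def)
    have "AE x in M. g x = f x" using *(3) by eventually_elim simp
    with * show "(g, f) \<in> ae_eq_rel M" by (simp add: ae_eq_rel_def)
  qed
  show "trans (ae_eq_rel M)"
  proof (rule transI)
    fix f g h assume "(f, g) \<in> ae_eq_rel M" "(g, h) \<in> ae_eq_rel M"
    then have *: "mp_iso M M f" "mp_iso M M h" "AE x in M. f x = g x" "AE x in M. g x = h x"
      by (auto simp: ae_eq_rel_def)
    have "AE x in M. f x = h x" using *(3,4) by eventually_elim simp
    with * show "(f, h) \<in> ae_eq_rel M" by (simp add: ae_eq_rel_def)
  qed
qed

lemma carrier_Aut: "carrier (Aut M) = aut_class M ` {f. mp_iso M M f}"
  unfolding Aut_def aut_class_def quotient_def by auto

lemma aut_class_carrier: "mp_iso M M f \<Longrightarrow> aut_class M f \<in> carrier (Aut M)"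
  by (simp add: carrier_Aut)

lemma mem_aut_class: "h \<in> aut_class M f \<longleftrightarrow> mp_iso M M f \<and> mp_iso M M h \<and> (AE x in M. f x = h x)"
  by (auto simp: aut_class_def ae_eq_rel_def)

lemma aut_class_eqI:
  "mp_iso M M f \<Longrightarrow> mp_iso M M h \<Longrightarrow> AE x in M. f x = h x \<Longrightarrow> aut_class M f = aut_class M h"
  unfolding aut_class_def
  by (rule equiv_class_eq[OF equiv_ae_eq_rel]) (simp add: ae_eq_rel_def)

lemma aut_class_eqD:
  assumes "aut_class M f = aut_class M h" "mp_iso M M f" "mp_iso M M h"
  shows "AE x in M. f x = h x"
proof -
  have "h \<in> aut_class M f" using assms by (simp add: mem_aut_class)
  then show ?thesis by (simp add: mem_aut_class)
qed

lemma aut_rep: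
  assumes "g \<in> carrier (Aut M)"
  shows "mp_iso M M (aut_rep g)" "aut_class M (aut_rep g) = g"
proof -
  obtain f where f: "mp_iso M M f" "aut_class M f = g" using assms by (auto simp: carrier_Aut)
  have "f \<in> g" using f(1) by (simp add: mem_aut_class flip: f(2))
  then have "aut_rep g \<in> g" unfolding aut_rep_def by (rule someI[of "\<lambda>f. f \<in> g"])
  then have "aut_rep g \<in> aut_class M f" by (simp only: f(2))
  then have *: "mp_iso M M (aut_rep g)" "AE x in M. f x = aut_rep g x"
    by (simp_all add: mem_aut_class)
  show "mp_iso M M (aut_rep g)" by (rule *)
  show "aut_class M (aut_rep g) = g"
    using aut_class_eqI[OF f(1) *] by (simp only: f(2))
qed

lemma Aut_cases:
  assumes "x \<in> carrier (Aut M)"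
  obtains f where "mp_iso M M f" "x = aut_class M f"
  using assms that unfolding carrier_Aut by (elim imageE) simp

lemma mem_Aut_mult:
  "h \<in> a \<otimes>\<^bsub>Aut M\<^esub> b \<longleftrightarrow> mp_iso M M h \<and> (\<exists>f\<in>a. \<exists>g\<in>b. AE x in M. h x = f (g x))"
  by (simp add: Aut_def)

text \<open>Independence of the representatives: the null set where \<open>f\<close> and
  \<open>f'\<close> differ is pulled back along \<open>g\<close>, and a measure-preserving map pulls
  null sets back to null sets.\<close>

lemma aut_mult:
  assumes f: "mp_iso M M f" and g: "mp_iso M M g"
  shows "aut_class M f \<otimes>\<^bsub>Aut M\<^esub> aut_class M g = aut_class M (\<lambda>x. f (g x))"
proof (rule Set.set_eqI)
  fix h
  have fg: "mp_iso M M (\<lambda>x. f (g x))" by (rule mp_iso_compose[OF g f])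
  show "h \<in> aut_class M f \<otimes>\<^bsub>Aut M\<^esub> aut_class M g \<longleftrightarrow> h \<in> aut_class M (\<lambda>x. f (g x))"
  proof
    assume "h \<in> aut_class M f \<otimes>\<^bsub>Aut M\<^esub> aut_class M g"
    then have "mp_iso M M h \<and> (\<exists>f'\<in>aut_class M f. \<exists>g'\<in>aut_class M g. AE x in M. h x = f' (g' x))"
      by (simp only: mem_Aut_mult)
    then obtain f' g' where h: "mp_iso M M h" "f' \<in> aut_class M f" "g' \<in> aut_class M g"
      "AE x in M. h x = f' (g' x)" by (elim conjE bexE)
    have f': "AE x in M. f x = f' x" and g': "AE x in M. g x = g' x"
      using h(2,3) by (simp_all add: mem_aut_class)
    have "AE x in M. f (g x) = h x"
      using mp_map_AE[OF mp_iso_map[OF g] f'] g' h(4) by eventually_elim auto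
    with fg h(1) show "h \<in> aut_class M (\<lambda>x. f (g x))" by (simp add: mem_aut_class)
  next
    assume "h \<in> aut_class M (\<lambda>x. f (g x))"
    then have h: "mp_iso M M h" "AE x in M. f (g x) = h x" by (simp_all add: mem_aut_class)
    have "AE x in M. h x = f (g x)" using h(2) by eventually_elim simp
    moreover have "f \<in> aut_class M f" "g \<in> aut_class M g" using f g by (simp_all add: mem_aut_class)
    ultimately show "h \<in> aut_class M f \<otimes>\<^bsub>Aut M\<^esub> aut_class M g"
      unfolding mem_Aut_mult by (intro conjI h(1) bexI[of _ f] bexI[of _ g])
  qed
qed

lemma aut_one: "\<one>\<^bsub>Aut M\<^esub> = aut_class M (\<lambda>x. x)"
  by (simp add: Aut_def aut_class_def)

lemma group_Aut: "group (Aut M)"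
proof (rule groupI)
  show "x \<otimes>\<^bsub>Aut M\<^esub> y \<in> carrier (Aut M)" if xyz: "x \<in> carrier (Aut M)" "y \<in> carrier (Aut M)" for x y
  proof -
    obtain f where f: "mp_iso M M f" "x = aut_class M f" using xyz(1) by (rule Aut_cases)
    obtain g where g: "mp_iso M M g" "y = aut_class M g" using xyz(2) by (rule Aut_cases)
    from f g show ?thesis using aut_class_carrier[OF mp_iso_compose[of M M g M f]] by (simp add: aut_mult)
  qed
  show "\<one>\<^bsub>Aut M\<^esub> \<in> carrier (Aut M)" by (simp add: aut_one aut_class_carrier mp_iso_id)
  show "x \<otimes>\<^bsub>Aut M\<^esub> y \<otimes>\<^bsub>Aut M\<^esub> z = x \<otimes>\<^bsub>Aut M\<^esub> (y \<otimes>\<^bsub>Aut M\<^esub> z)"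
    if xyz: "x \<in> carrier (Aut M)" "y \<in> carrier (Aut M)" "z \<in> carrier (Aut M)" for x y z
  proof -
    obtain f where f: "mp_iso M M f" "x = aut_class M f" using xyz(1) by (rule Aut_cases)
    obtain g where g: "mp_iso M M g" "y = aut_class M g" using xyz(2) by (rule Aut_cases)
    obtain h where h: "mp_iso M M h" "z = aut_class M h" using xyz(3) by (rule Aut_cases)
    from f g h show ?thesis
      using mp_iso_compose[of M M g M f] mp_iso_compose[of M M h M g] by (simp add: aut_mult)
  qed
  show "\<one>\<^bsub>Aut M\<^esub> \<otimes>\<^bsub>Aut M\<^esub> x = x" if xyz: "x \<in> carrier (Aut M)" for x
    using xyz aut_mult[OF mp_iso_id] by (metis Aut_cases aut_one)
  show "\<exists>y\<in>carrier (Aut M). y \<otimes>\<^bsub>Aut M\<^esub> x = \<one>\<^bsub>Aut M\<^esub>" if xyz: "x \<in> carrier (Aut M)" for x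
  proof -
    obtain f where f: "mp_iso M M f" "x = aut_class M f" using xyz by (rule Aut_cases)
    obtain g where g: "mp_iso M M g" "AE x in M. g (f x) = x" using mp_iso_inverse[OF f(1)] by blast
    have "aut_class M g \<otimes>\<^bsub>Aut M\<^esub> x = \<one>\<^bsub>Aut M\<^esub>"
      unfolding f(2) aut_one aut_mult[OF g(1) f(1)]
      by (rule aut_class_eqI[OF mp_iso_compose[OF f(1) g(1)] mp_iso_id g(2)])
    with g show ?thesis using aut_class_carrier by blast
  qed
qed

lemma aut_rep_mult:
  assumes "g \<in> carrier (Aut M)" "h \<in> carrier (Aut M)"
  shows "AE x in M. aut_rep (g \<otimes>\<^bsub>Aut M\<^esub> h) x = aut_rep g (aut_rep h x)"
proof (rule aut_class_eqD)
  interpret G: group "Aut M" by (rule group_Aut)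
  show "mp_iso M M (aut_rep (g \<otimes>\<^bsub>Aut M\<^esub> h))" using assms by (simp add: aut_rep)
  show "mp_iso M M (\<lambda>x. aut_rep g (aut_rep h x))"
    using assms by (intro mp_iso_compose[of M M "aut_rep h" M "aut_rep g"] aut_rep(1))
  show "aut_class M (aut_rep (g \<otimes>\<^bsub>Aut M\<^esub> h)) = aut_class M (\<lambda>x. aut_rep g (aut_rep h x))"
    using aut_mult[OF aut_rep(1)[OF assms(1)] aut_rep(1)[OF assms(2)]]
      aut_rep(2)[OF G.m_closed[OF assms]] by (simp only: aut_rep(2)[OF assms(1)] aut_rep(2)[OF assms(2)])
qed

lemma aut_rep_one: "AE x in M. aut_rep (\<one>\<^bsub>Aut M\<^esub>) x = x"
proof (rule aut_class_eqD)
  interpret G: group "Aut M" by (rule group_Aut)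
  show "mp_iso M M (aut_rep \<one>\<^bsub>Aut M\<^esub>)" by (simp add: aut_rep)
  show "mp_iso M M (\<lambda>x. x)" by (rule mp_iso_id)
  show "aut_class M (aut_rep \<one>\<^bsub>Aut M\<^esub>) = aut_class M (\<lambda>x. x)"
    using aut_rep(2)[OF G.one_closed] by (simp add: aut_one)
qed

section \<open>The action on sets and the pseudometric of the measure algebra\<close>

lemma aut_image_eq: "aut_image M g A = aut_rep (inv\<^bsub>Aut M\<^esub> g) -` A \<inter> space M"
  by (simp add: aut_image_def aut_rep_def)

lemma aut_image_sets:
  assumes "g \<in> carrier (Aut M)" "A \<in> sets (completion M)"
  shows "aut_image M g A \<in> sets (completion M)"
proof -
  interpret G: group "Aut M" by (rule group_Aut)
  show ?thesis unfolding aut_image_eq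
    using assms by (intro mp_map_vimage[OF mp_iso_map]) (auto simp: aut_rep)
qed

lemma prob_space_completion: "prob_space M \<Longrightarrow> prob_space (completion M)"
  by (rule prob_spaceI) (simp add: prob_space.emeasure_space_1)

text \<open>The distance of the measure algebra. Distance 0 stands for equality up to a null set, so
  that such equalities can be links in chains of triangle inequalities.\<close>

definition sd :: "'a measure \<Rightarrow> 'a set \<Rightarrow> 'a set \<Rightarrow> real" where
  "sd M A B = measure (completion M) (sym_diff A B)"

lemma sd_nonneg: "0 \<le> sd M A B" and sd_self[simp]: "sd M A A = 0" and sd_commute: "sd M A B = sd M B A"
  by (auto simp: sd_def Un_commute)

lemma sd_triangle:
  assumes "prob_space M" "A \<in> sets (completion M)" "B \<in> sets (completion M)" "C \<in> sets (completion M)"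
  shows "sd M A C \<le> sd M A B + sd M B C"
proof -
  interpret prob_space "completion M" using assms(1) by (rule prob_space_completion)
  have "sd M A C \<le> measure (completion M) (sym_diff A B \<union> sym_diff B C)"
    unfolding sd_def using assms by (intro finite_measure_mono) auto
  also have "\<dots> \<le> sd M A B + sd M B C"
    unfolding sd_def using assms by (intro measure_Un_le) auto
  finally show ?thesis .
qed

lemma sd_AE_cong:
  assumes "AE x in M. (x \<in> A \<longleftrightarrow> x \<in> A') \<and> (x \<in> B \<longleftrightarrow> x \<in> B')"
    "A \<in> sets (completion M)" "B \<in> sets (completion M)" "A' \<in> sets (completion M)" "B' \<in> sets (completion M)"
  shows "sd M A B = sd M A' B'"
  unfolding sd_def using assms by (intro measure_eq_AE) (auto simp: AE_completion_iff)

lemma sd_AE_zero: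
  assumes "AE x in M. x \<in> A \<longleftrightarrow> x \<in> B" "A \<in> sets (completion M)" "B \<in> sets (completion M)"
  shows "sd M A B = 0"
proof -
  have "sd M A B = sd M B B"
    by (rule sd_AE_cong[OF _ assms(2,3,3,3)]) (use assms(1) in eventually_elim, simp)
  then show ?thesis by simp
qed

lemma sd_vimage:
  assumes "mp_map M N f" "A \<in> sets (completion N)" "B \<in> sets (completion N)"
  shows "sd M (f -` A \<inter> space M) (f -` B \<inter> space M) = sd N A B"
proof -
  have "sym_diff (f -` A \<inter> space M) (f -` B \<inter> space M) = f -` (sym_diff A B) \<inter> space M" by auto
  moreover have "sym_diff A B \<in> sets (completion N)" using assms by auto
  ultimately show ?thesis unfolding sd_def by (simp only: mp_map_measure[OF assms(1)])
qed

lemma sd_aut_image: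
  assumes "g \<in> carrier (Aut M)" "A \<in> sets (completion M)" "B \<in> sets (completion M)"
  shows "sd M (aut_image M g A) (aut_image M g B) = sd M A B"
proof -
  interpret G: group "Aut M" by (rule group_Aut)
  show ?thesis unfolding aut_image_eq
    using assms by (intro sd_vimage mp_iso_map) (auto simp: aut_rep)
qed

text \<open>The action law holds only modulo a null set, because each \<open>aut_image\<close> uses
  its own choice of a representative.\<close>

lemma aut_image_mult:
  assumes "g \<in> carrier (Aut M)" "h \<in> carrier (Aut M)" "A \<in> sets (completion M)"
  shows "sd M (aut_image M (g \<otimes>\<^bsub>Aut M\<^esub> h) A) (aut_image M g (aut_image M h A)) = 0"
proof (rule sd_AE_zero)
  interpret G: group "Aut M" by (rule group_Aut)
  have i: "inv\<^bsub>Aut M\<^esub> (g \<otimes>\<^bsub>Aut M\<^esub> h) = inv\<^bsub>Aut M\<^esub> h \<otimes>\<^bsub>Aut M\<^esub> inv\<^bsub>Aut M\<^esub> g"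
    using assms by (simp add: G.inv_mult_group)
  have m: "mp_map M M (aut_rep (inv\<^bsub>Aut M\<^esub> g))" using assms by (simp add: aut_rep mp_iso_map)
  show "AE x in M. (x \<in> aut_image M (g \<otimes>\<^bsub>Aut M\<^esub> h) A) = (x \<in> aut_image M g (aut_image M h A))"
    using aut_rep_mult[OF G.inv_closed[OF assms(2)] G.inv_closed[OF assms(1)]] AE_space
    unfolding aut_image_eq i by eventually_elim (auto dest: mp_map_space[OF m])
  show "aut_image M (g \<otimes>\<^bsub>Aut M\<^esub> h) A \<in> sets (completion M)"
    "aut_image M g (aut_image M h A) \<in> sets (completion M)"
    using assms by (auto intro!: aut_image_sets)
qed

lemma aut_image_one:
  assumes "A \<in> sets (completion M)"
  shows "sd M (aut_image M \<one>\<^bsub>Aut M\<^esub> A) A = 0"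
proof (rule sd_AE_zero)
  interpret G: group "Aut M" by (rule group_Aut)
  show "AE x in M. (x \<in> aut_image M \<one>\<^bsub>Aut M\<^esub> A) = (x \<in> A)"
    using aut_rep_one[of M] AE_space unfolding aut_image_eq G.inv_one by eventually_elim auto
  show "aut_image M \<one>\<^bsub>Aut M\<^esub> A \<in> sets (completion M)"
    using assms by (auto intro!: aut_image_sets)
qed (use assms in auto)

text \<open>Passes from the chosen representative of the inverse class to an explicitly known
  inverse \<open>g\<close>, with which images can be computed.\<close>

lemma aut_image_class:
  assumes f: "mp_iso M M f" and g: "mp_iso M M g" "AE x in M. f (g x) = x"
    and A: "A \<in> sets (completion M)"
  shows "sd M (aut_image M (aut_class M f) A) (g -` A \<inter> space M) = 0"
proof (rule sd_AE_zero)
  interpret G: group "Aut M" by (rule group_Aut)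
  have "aut_class M f \<otimes>\<^bsub>Aut M\<^esub> aut_class M g = \<one>\<^bsub>Aut M\<^esub>"
    unfolding aut_one aut_mult[OF f g(1)]
    by (rule aut_class_eqI[OF mp_iso_compose[OF g(1) f] mp_iso_id g(2)])
  then have "aut_class M g \<otimes>\<^bsub>Aut M\<^esub> aut_class M f = \<one>\<^bsub>Aut M\<^esub>"
    by (rule G.inv_comm[OF _ aut_class_carrier[OF f] aut_class_carrier[OF g(1)]])
  then have i: "inv\<^bsub>Aut M\<^esub> (aut_class M f) = aut_class M g"
    using f g(1) by (simp add: G.inv_equality aut_class_carrier)
  have "AE x in M. aut_rep (aut_class M g) x = g x"
    by (rule aut_class_eqD[OF aut_rep(2)[OF aut_class_carrier[OF g(1)]]
          aut_rep(1)[OF aut_class_carrier[OF g(1)]] g(1)])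
  then show "AE x in M. (x \<in> aut_image M (aut_class M f) A) = (x \<in> g -` A \<inter> space M)"
    unfolding aut_image_eq i by eventually_elim auto
  show "aut_image M (aut_class M f) A \<in> sets (completion M)"
    using assms by (auto intro!: aut_image_sets aut_class_carrier)
  show "g -` A \<inter> space M \<in> sets (completion M)"
    using g A by (auto intro!: mp_map_vimage mp_iso_map)
qed

subsection \<open>Spaces of homomorphisms\<close>

text \<open>Preimages of nowhere dense sets are nowhere dense: an open set inside the closure of the
  preimage of \<open>S\<close> is mapped into the closure of \<open>S\<close>, and if it were
  nonempty, the closure of its image would place a nonempty open set there. Meager sets follow by
  countable unions.\<close>

lemma category_preserving_mapI:
  assumes cont: "continuous_map X Y f"
    and step: "\<And>U. openin X U \<Longrightarrow> U \<noteq> {} \<Longrightarrow>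
      \<exists>V. openin Y V \<and> V \<noteq> {} \<and> V \<subseteq> Y closure_of (f ` U)"
  shows "category_preserving_map X Y f"
proof -
  have nd: "nowhere_dense_in X {x \<in> topspace X. f x \<in> S}" if S: "nowhere_dense_in Y S" for S
  proof -
    let ?P = "{x \<in> topspace X. f x \<in> S}"
    have sub: "X closure_of ?P \<subseteq> {x \<in> topspace X. f x \<in> Y closure_of S}"
    proof (rule closure_of_minimal)
      show "?P \<subseteq> {x \<in> topspace X. f x \<in> Y closure_of S}"
        using S closure_of_subset[of S Y] unfolding nowhere_dense_in_def by auto
      show "closedin X {x \<in> topspace X. f x \<in> Y closure_of S}"
        by (rule closedin_continuous_map_preimage[OF cont]) simp
    qed
    have "X interior_of (X closure_of ?P) = {}"
    proof (rule ccontr)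
      let ?U = "X interior_of (X closure_of ?P)"
      assume "?U \<noteq> {}"
      then obtain V where V: "openin Y V" "V \<noteq> {}" "V \<subseteq> Y closure_of (f ` ?U)"
        using step[of ?U] by auto
      have "f ` ?U \<subseteq> Y closure_of S"
        using sub interior_of_subset[of X "X closure_of ?P"] by blast
      then have "Y closure_of (f ` ?U) \<subseteq> Y closure_of S"
        by (simp add: closure_of_minimal)
      with V have "V \<subseteq> Y interior_of (Y closure_of S)"
        by (meson interior_of_maximal order_trans)
      with V S show False unfolding nowhere_dense_in_def by auto
    qed
    then show ?thesis unfolding nowhere_dense_in_def by auto
  qed
  have "comeager_in X {x \<in> topspace X. f x \<in> A}" if A: "comeager_in Y A" for A
  proof -
    obtain F where F: "countable F" "\<forall>T\<in>F. nowhere_dense_in Y T" "topspace Y - A = \<Union>F"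
      using A unfolding comeager_in_def meager_in_def by auto
    have img: "f x \<in> topspace Y" if "x \<in> topspace X" for x
      using cont that by (auto simp: continuous_map_def)
    have "topspace X - {x \<in> topspace X. f x \<in> A} = {x \<in> topspace X. f x \<in> topspace Y - A}"
      using img by auto
    also have "\<dots> = \<Union>((\<lambda>T. {x \<in> topspace X. f x \<in> T}) ` F)"
      unfolding F(3) by auto
    finally have eq: "topspace X - {x \<in> topspace X. f x \<in> A} = \<dots>" .
    have "meager_in X (\<Union>((\<lambda>T. {x \<in> topspace X. f x \<in> T}) ` F))"
      unfolding meager_in_def
    proof (intro exI conjI)
      show "countable ((\<lambda>T. {x \<in> topspace X. f x \<in> T}) ` F)" using F(1) by simp
      show "\<forall>T\<in>(\<lambda>T. {x \<in> topspace X. f x \<in> T}) ` F. nowhere_dense_in X T" using F(2) nd by auto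
    qed simp
    then show ?thesis unfolding comeager_in_def eq by auto
  qed
  with cont show ?thesis unfolding category_preserving_map_def by blast
qed

section \<open>Neighbourhoods in the automorphism group and in spaces of homomorphisms\<close>

lemma openin_Aut_ball:
  assumes "g \<in> carrier (Aut M)" "A \<in> sets M" "e > 0"
  shows "openin (Aut_topology M) {h \<in> carrier (Aut M). sd M (aut_image M h A) (aut_image M g A) < e}"
  unfolding Aut_topology_def sd_def
  by (rule topology_generated_by_Basis, rule CollectI) (intro exI[of _ g] exI[of _ A] exI[of _ e] conjI refl assms)

lemma topspace_Aut_topology: "topspace (Aut_topology M) = carrier (Aut M)"
proof
  show "topspace (Aut_topology M) \<subseteq> carrier (Aut M)"
    unfolding Aut_topology_def topology_generated_by_topspace by (rule Union_least) auto
  show "carrier (Aut M) \<subseteq> topspace (Aut_topology M)"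
  proof
    fix x assume x: "x \<in> carrier (Aut M)"
    have "x \<in> {h \<in> carrier (Aut M). sd M (aut_image M h {}) (aut_image M x {}) < 1}"
      using x by simp
    then show "x \<in> topspace (Aut_topology M)"
      using openin_subset[OF openin_Aut_ball[OF x sets.empty_sets zero_less_one]] by (rule subsetD[rotated])
  qed
qed

text \<open>The generating balls are only a subbase and have arbitrary centres. Along the generation
  of \<open>U\<close>, finitely many of them are intersected, and each is recentred at
  \<open>g\<close> by the triangle inequality.\<close>

lemma Aut_topology_nbhd:
  assumes M: "prob_space M" and U: "openin (Aut_topology M) U" and g: "g \<in> U"
  shows "\<exists>F e. finite F \<and> F \<subseteq> sets M \<and> e > 0 \<and>
    (\<forall>h\<in>carrier (Aut M). (\<forall>A\<in>F. sd M (aut_image M h A) (aut_image M g A) < e) \<longrightarrow> h \<in> U)"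
  (is "?P U g")
proof -
  have gen: "generate_topology_on {{h \<in> carrier (Aut M).
         measure (completion M) (sym_diff (aut_image M h A) (aut_image M g A)) < e} | g A e.
       g \<in> carrier (Aut M) \<and> A \<in> sets M \<and> e > 0} U"
    using U unfolding Aut_topology_def by (rule openin_topology_generated_by)
  from gen g show "?P U g"
  proof (induction arbitrary: g)
    case Empty then show ?case by simp
  next
    case (Int a b)
    then have g: "g \<in> a" "g \<in> b" by auto
    obtain F e where 1: "finite F" "F \<subseteq> sets M" "e > 0"
      "\<forall>h\<in>carrier (Aut M). (\<forall>A\<in>F. sd M (aut_image M h A) (aut_image M g A) < e) \<longrightarrow> h \<in> a"
      using Int.IH(1)[OF g(1)] by auto
    obtain F' e' where 2: "finite F'" "F' \<subseteq> sets M" "e' > 0"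
      "\<forall>h\<in>carrier (Aut M). (\<forall>A\<in>F'. sd M (aut_image M h A) (aut_image M g A) < e') \<longrightarrow> h \<in> b"
      using Int.IH(2)[OF g(2)] by auto
    show ?case
    proof (intro exI conjI ballI impI)
      show "finite (F \<union> F')" "F \<union> F' \<subseteq> sets M" "min e e' > 0" using 1 2 by auto
      show "h \<in> a \<inter> b" if "h \<in> carrier (Aut M)"
        "\<forall>A\<in>F \<union> F'. sd M (aut_image M h A) (aut_image M g A) < min e e'" for h
        using 1(4) 2(4) that by simp
    qed
  next
    case (UN K)
    then obtain k where k: "k \<in> K" "g \<in> k" by auto
    obtain F e where "finite F" "F \<subseteq> sets M" "e > 0"
      "\<forall>h\<in>carrier (Aut M). (\<forall>A\<in>F. sd M (aut_image M h A) (aut_image M g A) < e) \<longrightarrow> h \<in> k"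
      using UN.IH[OF k] by auto
    then show ?case using k(1) by (intro exI[of _ F] exI[of _ e]) auto
  next
    case (Basis s)
    then obtain g0 A e where s: "s = {h \<in> carrier (Aut M). sd M (aut_image M h A) (aut_image M g0 A) < e}"
      and *: "g0 \<in> carrier (Aut M)" "A \<in> sets M" "e > 0" unfolding sd_def by auto
    have g: "g \<in> carrier (Aut M)" "sd M (aut_image M g A) (aut_image M g0 A) < e"
      using Basis s by auto
    show ?case
    proof (intro exI conjI ballI impI)
      show "finite {A}" "{A} \<subseteq> sets M" "e - sd M (aut_image M g A) (aut_image M g0 A) > 0"
        using * g by auto
      fix h assume h: "h \<in> carrier (Aut M)"
        "\<forall>B\<in>{A}. sd M (aut_image M h B) (aut_image M g B) < e - sd M (aut_image M g A) (aut_image M g0 A)"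
      have "sd M (aut_image M h A) (aut_image M g0 A) \<le>
          sd M (aut_image M h A) (aut_image M g A) + sd M (aut_image M g A) (aut_image M g0 A)"
        by (intro sd_triangle M aut_image_sets g h * sets_completionI_sets)
      with h s show "h \<in> s" by auto
    qed
  qed
qed

lemma topspace_Hom_topology:
  "topspace (Hom_topology L M) = extensional (carrier L) \<inter> hom L (Aut M)"
  by (auto simp: Hom_topology_def topspace_Aut_topology PiE_def hom_def)

lemma continuous_map_Hom_eval:
  assumes "l \<in> carrier L"
  shows "continuous_map (Hom_topology L M) (Aut_topology M) (\<lambda>p. p l)"
  unfolding Hom_topology_def
  by (rule continuous_map_from_subtopology[OF continuous_map_product_projection[OF assms]])

lemma openin_Hom_nbhd:
  assumes F: "finite F" "F \<subseteq> carrier L" and As: "finite As" "As \<subseteq> sets M" and "e > 0"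
    and g: "\<And>l. l \<in> F \<Longrightarrow> g l \<in> carrier (Aut M)"
  shows "openin (Hom_topology L M) {p \<in> topspace (Hom_topology L M).
    \<forall>l\<in>F. \<forall>A\<in>As. sd M (aut_image M (p l) A) (aut_image M (g l) A) < e}"
proof -
  let ?X = "Hom_topology L M"
  have fin: "openin ?X {p \<in> topspace ?X. \<forall>i\<in>I. Q i p}"
    if "finite I" "\<And>i. i \<in> I \<Longrightarrow> openin ?X {p \<in> topspace ?X. Q i p}"
    for I :: "('a \<times> 'c set) set" and Q
    using that
  proof (induction I)
    case empty then show ?case by simp
  next
    case (insert x I)
    have "openin ?X ({p \<in> topspace ?X. Q x p} \<inter> {p \<in> topspace ?X. \<forall>i\<in>I. Q i p})"
      by (intro openin_Int insert.IH insert.prems) auto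
    also have "\<dots> = {p \<in> topspace ?X. \<forall>i\<in>insert x I. Q i p}" by auto
    finally show ?case .
  qed
  have "openin ?X {p \<in> topspace ?X.
    \<forall>i\<in>F \<times> As. sd M (aut_image M (p (fst i)) (snd i)) (aut_image M (g (fst i)) (snd i)) < e}"
  proof (rule fin)
    show "finite (F \<times> As)" using F As by auto
    fix i assume i: "i \<in> F \<times> As"
    have "openin ?X {p \<in> topspace ?X. p (fst i) \<in>
      {h \<in> carrier (Aut M). sd M (aut_image M h (snd i)) (aut_image M (g (fst i)) (snd i)) < e}}"
      by (rule openin_continuous_map_preimage[OF continuous_map_Hom_eval openin_Aut_ball])
        (use i F As g assms in auto)
    also have "\<dots> = {p \<in> topspace ?X. sd M (aut_image M (p (fst i)) (snd i)) (aut_image M (g (fst i)) (snd i)) < e}"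
      using i F by (auto simp: topspace_Hom_topology hom_def)
    finally show "openin ?X \<dots>" .
  qed
  also have "{p \<in> topspace ?X.
      \<forall>i\<in>F \<times> As. sd M (aut_image M (p (fst i)) (snd i)) (aut_image M (g (fst i)) (snd i)) < e} =
    {p \<in> topspace ?X. \<forall>l\<in>F. \<forall>A\<in>As. sd M (aut_image M (p l) A) (aut_image M (g l) A) < e}"
    by auto
  finally show ?thesis .
qed

lemma Hom_topology_nbhd:
  assumes M: "prob_space M" and U: "openin (Hom_topology L M) U" and p: "p \<in> U"
  obtains F As e where "finite F" "F \<subseteq> carrier L" "finite As" "As \<subseteq> sets M" "e > 0"
    "\<forall>q\<in>topspace (Hom_topology L M).
      (\<forall>l\<in>F. \<forall>A\<in>As. sd M (aut_image M (q l) A) (aut_image M (p l) A) < e) \<longrightarrow> q \<in> U"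
proof -
  obtain W where W: "openin (product_topology (\<lambda>_. Aut_topology M) (carrier L)) W"
    "U = W \<inter> hom L (Aut M)"
    using U unfolding Hom_topology_def openin_subtopology by (elim exE conjE)
  obtain X where X: "p \<in> PiE (carrier L) X" "\<And>i. openin (Aut_topology M) (X i)"
    "finite {i. X i \<noteq> carrier (Aut M)}" "PiE (carrier L) X \<subseteq> W"
  proof -
    have "p \<in> W" using p W(2) by simp
    from product_topology_open_contains_basis[OF W(1) this] show ?thesis
      unfolding topspace_Aut_topology using that by (elim exE conjE) simp
  qed
  define F where "F = {i. X i \<noteq> carrier (Aut M)} \<inter> carrier L"
  have "\<forall>l\<in>F. \<exists>As e. finite As \<and> As \<subseteq> sets M \<and> e > 0 \<and>
    (\<forall>h\<in>carrier (Aut M). (\<forall>A\<in>As. sd M (aut_image M h A) (aut_image M (p l) A) < e) \<longrightarrow> h \<in> X l)"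
  proof
    fix l assume "l \<in> F"
    then have "p l \<in> X l" using X(1) by (auto simp: F_def)
    from Aut_topology_nbhd[OF M X(2) this]
    show "\<exists>As e. finite As \<and> As \<subseteq> sets M \<and> e > 0 \<and>
      (\<forall>h\<in>carrier (Aut M). (\<forall>A\<in>As. sd M (aut_image M h A) (aut_image M (p l) A) < e) \<longrightarrow> h \<in> X l)" .
  qed
  from bchoice[OF this] obtain As where "\<forall>l\<in>F. \<exists>e. finite (As l) \<and> As l \<subseteq> sets M \<and> e > 0 \<and>
    (\<forall>h\<in>carrier (Aut M). (\<forall>A\<in>As l. sd M (aut_image M h A) (aut_image M (p l) A) < e) \<longrightarrow> h \<in> X l)"
    by (elim exE)
  from bchoice[OF this] obtain e where Ae: "\<forall>l\<in>F. finite (As l) \<and> As l \<subseteq> sets M \<and> e l > 0 \<and>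
    (\<forall>h\<in>carrier (Aut M). (\<forall>A\<in>As l. sd M (aut_image M h A) (aut_image M (p l) A) < e l) \<longrightarrow> h \<in> X l)"
    by (elim exE)
  have fF: "finite F" using X(3) by (simp add: F_def)
  \<comment> \<open>The element 1 keeps the minimum meaningful when \<open>F\<close> is
    empty.\<close>
  define e0 where "e0 = Min (insert 1 (e ` F))"
  have e0: "e0 > 0" "\<And>l. l \<in> F \<Longrightarrow> e0 \<le> e l" using Ae fF by (simp_all add: e0_def)
  show ?thesis
  proof (rule that[of F "\<Union>(As ` F)" e0])
    show "finite F" "F \<subseteq> carrier L" "finite (\<Union>(As ` F))" "\<Union>(As ` F) \<subseteq> sets M" "e0 > 0"
      using fF Ae e0 by (auto simp: F_def)
    show "\<forall>q\<in>topspace (Hom_topology L M).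
      (\<forall>l\<in>F. \<forall>A\<in>\<Union>(As ` F). sd M (aut_image M (q l) A) (aut_image M (p l) A) < e0) \<longrightarrow> q \<in> U"
    proof (intro ballI impI)
    fix q assume q: "q \<in> topspace (Hom_topology L M)"
      "\<forall>l\<in>F. \<forall>A\<in>\<Union>(As ` F). sd M (aut_image M (q l) A) (aut_image M (p l) A) < e0"
    have qc: "q l \<in> carrier (Aut M)" if "l \<in> carrier L" for l
      using q(1) that by (auto simp: topspace_Hom_topology hom_def)
    have "q l \<in> X l" if l: "l \<in> carrier L" for l
    proof (cases "l \<in> F")
      case True
      have "\<forall>A\<in>As l. sd M (aut_image M (q l) A) (aut_image M (p l) A) < e l"
        using q(2) e0(2)[OF True] True by fastforce
      then show ?thesis using Ae True qc[OF l] by simp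
    next
      case False
      then show ?thesis using l qc by (auto simp: F_def)
    qed
    then have "q \<in> PiE (carrier L) X"
      using q(1) by (auto simp: topspace_Hom_topology PiE_def)
    then show "q \<in> U" using X(4) W(2) q(1) by (auto simp: topspace_Hom_topology)
    qed
  qed
qed

lemma restrict_hom:
  assumes "p \<in> hom L G" "D \<subseteq> carrier L" "\<And>x y. x \<in> D \<Longrightarrow> y \<in> D \<Longrightarrow> x \<otimes>\<^bsub>L\<^esub> y \<in> D"
  shows "restrict p D \<in> hom (L\<lparr>carrier := D\<rparr>) G"
  using assms unfolding hom_def by (simp add: Pi_iff subset_iff)

lemma continuous_map_restrict:
  assumes "subgroup D L"
  shows "continuous_map (Hom_topology L M) (Hom_topology (L\<lparr>carrier := D\<rparr>) M) (\<lambda>p. restrict p D)"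
proof -
  have D: "D \<subseteq> carrier L" "\<And>x y. x \<in> D \<Longrightarrow> y \<in> D \<Longrightarrow> x \<otimes>\<^bsub>L\<^esub> y \<in> D"
    using assms by (auto simp: subgroup_def)
  have "continuous_map (Hom_topology L M) (Aut_topology M) (\<lambda>p. restrict p D l)" if "l \<in> D" for l
    using continuous_map_Hom_eval[of l L M] that D by auto
  then have "continuous_map (Hom_topology L M) (product_topology (\<lambda>_. Aut_topology M) D) (\<lambda>p. restrict p D)"
    by (subst continuous_map_componentwise) auto
  moreover have "restrict p D \<in> hom (L\<lparr>carrier := D\<rparr>) (Aut M)" if "p \<in> hom L (Aut M)" for p
    by (rule restrict_hom[OF that D])
  ultimately show ?thesis
    unfolding Hom_topology_def[of "L\<lparr>carrier := D\<rparr>"]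
    by (auto simp: continuous_map_in_subtopology topspace_Hom_topology)
qed

text \<open>The remaining task \<open>step\<close> is free of topology: \<open>p1\<close>,
  \<open>D'\<close>, \<open>As'\<close> and \<open>d\<close> describe an open set, and
  \<open>S\<close>, \<open>Bs\<close> and \<open>e'\<close> a neighbourhood of one of its points
  \<open>s\<close>. The homomorphisms in \<open>step\<close> need not be extensional; restriction to
  the acting group is inserted here.\<close>

lemma category_preserving_restrictI:
  fixes L :: "('g, 'm) monoid_scheme" and M :: "'a measure"
  assumes M: "prob_space M" and L: "group L" and D: "subgroup D L"
    and step: "\<And>p F As e. p \<in> hom L (Aut M) \<Longrightarrow> finite F \<Longrightarrow> F \<subseteq> carrier L \<Longrightarrow>
      finite As \<Longrightarrow> As \<subseteq> sets M \<Longrightarrow> e > (0::real) \<Longrightarrow>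
      \<exists>p1 D' As' d. p1 \<in> hom (L\<lparr>carrier := D\<rparr>) (Aut M) \<and> finite D' \<and> D' \<subseteq> D \<and>
        finite As' \<and> As' \<subseteq> sets M \<and> d > (0::real) \<and>
        (\<forall>s S Bs e'. s \<in> hom (L\<lparr>carrier := D\<rparr>) (Aut M) \<longrightarrow>
          (\<forall>l\<in>D'. \<forall>A\<in>As'. sd M (aut_image M (s l) A) (aut_image M (p1 l) A) < d) \<longrightarrow>
          finite S \<longrightarrow> S \<subseteq> D \<longrightarrow> finite Bs \<longrightarrow> Bs \<subseteq> sets M \<longrightarrow> e' > (0::real) \<longrightarrow>
          (\<exists>p'\<in>hom L (Aut M).
            (\<forall>l\<in>F. \<forall>A\<in>As. sd M (aut_image M (p' l) A) (aut_image M (p l) A) < e) \<and>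
            (\<forall>l\<in>S. \<forall>B\<in>Bs. sd M (aut_image M (p' l) B) (aut_image M (s l) B) < e')))"
  shows "category_preserving_map (Hom_topology L M) (Hom_topology (L\<lparr>carrier := D\<rparr>) M) (\<lambda>p. restrict p D)"
proof (rule category_preserving_mapI[OF continuous_map_restrict[OF D]])
  let ?X = "Hom_topology L M" and ?Y = "Hom_topology (L\<lparr>carrier := D\<rparr>) M"
  have DL: "D \<subseteq> carrier L" using D by (rule subgroup.subset)
  have Dm: "x \<otimes>\<^bsub>L\<^esub> y \<in> D" if "x \<in> D" "y \<in> D" for x y using subgroup.m_closed[OF D that] .
  have Lm: "x \<otimes>\<^bsub>L\<^esub> y \<in> carrier L" if "x \<in> carrier L" "y \<in> carrier L" for x y
    using L that by (simp add: group.is_monoid monoid.m_closed)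
  have restr: "restrict q D \<in> topspace ?Y" if "q \<in> topspace ?X" for q
    using continuous_map_restrict[OF D, of M] that by (auto simp: continuous_map_def)
  fix U assume U: "openin ?X U" "U \<noteq> {}"
  then obtain p where p: "p \<in> U" by auto
  have pX: "p \<in> topspace ?X" using U(1) p openin_subset by blast
  obtain F As e where FA: "finite F" "F \<subseteq> carrier L" "finite As" "As \<subseteq> sets M" "e > 0"
    "\<forall>q\<in>topspace ?X.
      (\<forall>l\<in>F. \<forall>A\<in>As. sd M (aut_image M (q l) A) (aut_image M (p l) A) < e) \<longrightarrow> q \<in> U"
    by (rule Hom_topology_nbhd[OF M U(1) p])
  have "p \<in> hom L (Aut M)" using pX by (simp add: topspace_Hom_topology)
  from step[OF this FA(1-5)]
  obtain p1 D' As' d where p1: "p1 \<in> hom (L\<lparr>carrier := D\<rparr>) (Aut M)" "finite D'" "D' \<subseteq> D"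
        "finite As'" "As' \<subseteq> sets M" "d > (0::real)"
    and ap: "\<forall>s S Bs e'. s \<in> hom (L\<lparr>carrier := D\<rparr>) (Aut M) \<longrightarrow>
          (\<forall>l\<in>D'. \<forall>A\<in>As'. sd M (aut_image M (s l) A) (aut_image M (p1 l) A) < d) \<longrightarrow>
          finite S \<longrightarrow> S \<subseteq> D \<longrightarrow> finite Bs \<longrightarrow> Bs \<subseteq> sets M \<longrightarrow> e' > (0::real) \<longrightarrow>
          (\<exists>p'\<in>hom L (Aut M).
            (\<forall>l\<in>F. \<forall>A\<in>As. sd M (aut_image M (p' l) A) (aut_image M (p l) A) < e) \<and>
            (\<forall>l\<in>S. \<forall>B\<in>Bs. sd M (aut_image M (p' l) B) (aut_image M (s l) B) < e'))"
    by (elim exE conjE)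
  define V where "V = {s \<in> topspace ?Y. \<forall>l\<in>D'. \<forall>A\<in>As'. sd M (aut_image M (s l) A) (aut_image M (p1 l) A) < d}"
  have p1c: "p1 l \<in> carrier (Aut M)" if "l \<in> D" for l
    using p1(1) that by (auto simp: hom_def)
  have oV: "openin ?Y V"
    unfolding V_def by (rule openin_Hom_nbhd) (use p1 p1c in auto)
  have "restrict p1 D \<in> V"
    unfolding V_def using p1 Dm by (simp add: topspace_Hom_topology hom_def Pi_iff subset_iff)
  moreover have "V \<subseteq> ?Y closure_of ((\<lambda>p. restrict p D) ` U)"
  proof
    fix s assume s: "s \<in> V"
    have sY: "s \<in> topspace ?Y" using s by (simp add: V_def)
    show "s \<in> ?Y closure_of ((\<lambda>p. restrict p D) ` U)"
      unfolding in_closure_of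
    proof (intro conjI allI impI sY)
      fix W assume W: "s \<in> W \<and> openin ?Y W"
      then have W': "openin ?Y W" "s \<in> W" by auto
      obtain S Bs e' where SB: "finite S" "S \<subseteq> carrier (L\<lparr>carrier := D\<rparr>)" "finite Bs" "Bs \<subseteq> sets M" "e' > 0"
        "\<forall>q\<in>topspace ?Y.
          (\<forall>l\<in>S. \<forall>A\<in>Bs. sd M (aut_image M (q l) A) (aut_image M (s l) A) < e') \<longrightarrow> q \<in> W"
        by (rule Hom_topology_nbhd[OF M W'])
      have SD: "S \<subseteq> D" using SB(2) by simp
      have "s \<in> hom (L\<lparr>carrier := D\<rparr>) (Aut M)"
        using sY by (simp add: topspace_Hom_topology)
      moreover have "\<forall>l\<in>D'. \<forall>A\<in>As'. sd M (aut_image M (s l) A) (aut_image M (p1 l) A) < d"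
        using s by (simp add: V_def)
      ultimately have "\<exists>p'\<in>hom L (Aut M).
            (\<forall>l\<in>F. \<forall>A\<in>As. sd M (aut_image M (p' l) A) (aut_image M (p l) A) < e) \<and>
            (\<forall>l\<in>S. \<forall>B\<in>Bs. sd M (aut_image M (p' l) B) (aut_image M (s l) B) < e')"
        by (rule ap[THEN spec, THEN spec, THEN spec, THEN spec, THEN mp, THEN mp, THEN mp, THEN mp,
            THEN mp, THEN mp, THEN mp, OF _ _ SB(1) SD SB(3-5)])
      then obtain p' where p': "p' \<in> hom L (Aut M)"
        "\<forall>l\<in>F. \<forall>A\<in>As. sd M (aut_image M (p' l) A) (aut_image M (p l) A) < e"
        "\<forall>l\<in>S. \<forall>B\<in>Bs. sd M (aut_image M (p' l) B) (aut_image M (s l) B) < e'"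
        by (elim bexE conjE)
      define q where "q = restrict p' (carrier L)"
      have qX: "q \<in> topspace ?X"
        using p'(1) Lm by (simp add: q_def topspace_Hom_topology hom_def Pi_iff)
      have "q \<in> U" using FA(2) p'(2) by (intro FA(6)[rule_format, OF qX]) (auto simp: q_def)
      moreover have "restrict q D \<in> W"
        using SD DL p'(3) by (intro SB(6)[rule_format] restr qX) (auto simp: q_def subset_eq)
      ultimately show "\<exists>y. y \<in> (\<lambda>p. restrict p D) ` U \<and> y \<in> W" by blast
    qed
  qed
  ultimately show "\<exists>V. openin ?Y V \<and> V \<noteq> {} \<and> V \<subseteq> ?Y closure_of ((\<lambda>p. restrict p D) ` U)"
    using oV by (intro exI[of _ V]) auto
qed

subsection \<open>Products and skew products\<close>

lemma mp_map_fst: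
  assumes "prob_space M" "prob_space N"
  shows "mp_map (M \<Otimes>\<^sub>M N) M fst"
proof (rule mp_map_measurable_imp)
  interpret M: prob_space M by fact
  interpret N: prob_space N by fact
  show "distr (M \<Otimes>\<^sub>M N) M fst = M"
  proof (rule measure_eqI)
    fix A assume "A \<in> sets (distr (M \<Otimes>\<^sub>M N) M fst)"
    then have A: "A \<in> sets M" by simp
    then have "fst -` A \<inter> space (M \<Otimes>\<^sub>M N) = A \<times> space N"
      by (auto simp: space_pair_measure dest: sets.sets_into_space)
    then show "emeasure (distr (M \<Otimes>\<^sub>M N) M fst) A = emeasure M A"
      using A by (simp add: emeasure_distr N.emeasure_pair_measure_Times N.emeasure_space_1)
  qed simp
qed simp

lemma mp_map_snd:
  assumes "prob_space M" "prob_space N"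
  shows "mp_map (M \<Otimes>\<^sub>M N) N snd"
proof (rule mp_map_measurable_imp)
  interpret M: prob_space M by fact
  interpret N: prob_space N by fact
  show "distr (M \<Otimes>\<^sub>M N) N snd = N"
  proof (rule measure_eqI)
    fix A assume "A \<in> sets (distr (M \<Otimes>\<^sub>M N) N snd)"
    then have A: "A \<in> sets N" by simp
    then have "snd -` A \<inter> space (M \<Otimes>\<^sub>M N) = space M \<times> A"
      by (auto simp: space_pair_measure dest: sets.sets_into_space)
    then show "emeasure (distr (M \<Otimes>\<^sub>M N) N snd) A = emeasure N A"
      using A by (simp add: emeasure_distr N.emeasure_pair_measure_Times M.emeasure_space_1)
  qed simp
qed simp

text \<open>The factors belong to completed sigma-algebras, while the product is formed before
  completing. \<open>main_part\<close> replaces each factor by an almost equal set of the original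
  sigma-algebra.\<close>

lemma completion_Times:
  assumes M: "prob_space M" and N: "prob_space N"
    and A: "A \<in> sets (completion M)" and B: "B \<in> sets (completion N)"
  shows "A \<times> B \<in> sets (completion (M \<Otimes>\<^sub>M N))"
    "emeasure (completion (M \<Otimes>\<^sub>M N)) (A \<times> B) = emeasure (completion M) A * emeasure (completion N) B"
proof -
  interpret N: prob_space N by fact
  have "A \<times> B = (fst -` A \<inter> space (M \<Otimes>\<^sub>M N)) \<inter> (snd -` B \<inter> space (M \<Otimes>\<^sub>M N))"
    using sets.sets_into_space[OF A] sets.sets_into_space[OF B] by (auto simp: space_pair_measure)
  then show S: "A \<times> B \<in> sets (completion (M \<Otimes>\<^sub>M N))"
    using mp_map_vimage[OF mp_map_fst[OF M N] A] mp_map_vimage[OF mp_map_snd[OF M N] B] by simp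
  let ?A = "main_part M A" and ?B = "main_part N B"
  have m: "?A \<in> sets M" "?B \<in> sets N" using A B by simp_all
  have "AE x in M. x \<in> A \<longleftrightarrow> x \<in> ?A" "AE x in N. x \<in> B \<longleftrightarrow> x \<in> ?B"
    using AE_in_main_part[OF A] AE_in_main_part[OF B] by (auto elim!: eventually_mono)
  from mp_map_AE[OF mp_map_fst[OF M N] this(1)] mp_map_AE[OF mp_map_snd[OF M N] this(2)]
  have "AE p in M \<Otimes>\<^sub>M N. p \<in> A \<times> B \<longleftrightarrow> p \<in> ?A \<times> ?B"
    by eventually_elim (auto simp: mem_Times_iff)
  then have "emeasure (completion (M \<Otimes>\<^sub>M N)) (A \<times> B) = emeasure (completion (M \<Otimes>\<^sub>M N)) (?A \<times> ?B)"
    using S m by (intro emeasure_eq_AE) (auto simp: AE_completion_iff)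
  also have "\<dots> = emeasure M ?A * emeasure N ?B"
    using m by (simp add: N.emeasure_pair_measure_Times)
  finally show "emeasure (completion (M \<Otimes>\<^sub>M N)) (A \<times> B) = emeasure (completion M) A * emeasure (completion N) B"
    using A B by simp
qed

lemma measure_completion_Times:
  assumes "prob_space M" "prob_space N" "A \<in> sets (completion M)" "B \<in> sets (completion N)"
  shows "measure (completion (M \<Otimes>\<^sub>M N)) (A \<times> B) = measure (completion M) A * measure (completion N) B"
  unfolding measure_def completion_Times(2)[OF assms] by (simp add: enn2real_mult)

text \<open>Since only finitely many fibre maps occur, the preimage of a rectangle is a finite
  disjoint union of rectangles, whose measures add up to that of the rectangle. Rectangles determine
  the product measure.\<close>

lemma mp_map_skew:
  assumes M: "prob_space M" and N: "prob_space N" and Q: "prob_space Q" and Q': "prob_space Q'"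
    and j: "finite I" "\<And>k. k \<in> space Q \<Longrightarrow> j k \<in> I" "\<And>i. i \<in> I \<Longrightarrow> {k \<in> space Q. j k = i} \<in> sets (completion Q)"
    and R: "\<And>i. i \<in> I \<Longrightarrow> mp_map M N (R i)" and t: "mp_map Q Q' t"
  shows "mp_map (M \<Otimes>\<^sub>M Q) (N \<Otimes>\<^sub>M Q') (\<lambda>p. (R (j (snd p)) (fst p), t (snd p)))"
proof -
  let ?P = "M \<Otimes>\<^sub>M Q" and ?f = "\<lambda>p. (R (j (snd p)) (fst p), t (snd p))"
  interpret N: prob_space N by fact
  interpret Q: prob_space Q by fact
  interpret Q': prob_space Q' by fact
  interpret CQ: prob_space "completion Q" by (rule prob_space_completion[OF Q])
  let ?J = "\<lambda>i. {k \<in> space Q. j k = i}"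
  have pre: "(\<lambda>p. (R (j (snd p)) (fst p), t (snd p))) -` (A \<times> B) \<inter> space ?P =
      (\<Union>i\<in>I. (R i -` A \<inter> space M) \<times> (?J i \<inter> (t -` B \<inter> space Q)))" for A B
    using j(2) by (auto simp: space_pair_measure)
  have RA: "R i -` A \<inter> space M \<in> sets (completion M)" if "i \<in> I" "A \<in> sets N" for i A
    using mp_map_vimage[OF R[OF that(1)], of A] that(2) by simp
  have tB: "?J i \<inter> (t -` B \<inter> space Q) \<in> sets (completion Q)" if "i \<in> I" "B \<in> sets Q'" for i B
    using mp_map_vimage[OF t, of B] that(2) j(3)[OF that(1)] by simp
  have rect: "?f -` (A \<times> B) \<inter> space ?P \<in> sets (completion ?P)" if "A \<in> sets N" "B \<in> sets Q'" for A B
    unfolding pre using RA tB that j(1) by (intro sets.finite_UN completion_Times(1)[OF M Q]) auto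
  have fm: "?f \<in> measurable (completion ?P) (N \<Otimes>\<^sub>M Q')"
  proof (rule measurable_pair_measureI)
    show "?f \<in> space (completion ?P) \<rightarrow> space N \<times> space Q'"
      using j(2) mp_map_space[OF R] mp_map_space[OF t] by (auto simp: space_pair_measure)
    show "?f -` (A \<times> B) \<inter> space (completion ?P) \<in> sets (completion ?P)" if "A \<in> sets N" "B \<in> sets Q'" for A B
      using rect[OF that] by simp
  qed
  have "N \<Otimes>\<^sub>M Q' = distr (completion ?P) (N \<Otimes>\<^sub>M Q') ?f"
  proof (rule pair_measure_eqI)
    show "sigma_finite_measure N" "sigma_finite_measure Q'" by unfold_locales
    fix A B assume A: "A \<in> sets N" and B: "B \<in> sets Q'"
    have "emeasure (distr (completion ?P) (N \<Otimes>\<^sub>M Q') ?f) (A \<times> B) =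
      emeasure (completion ?P) (\<Union>i\<in>I. (R i -` A \<inter> space M) \<times> (?J i \<inter> (t -` B \<inter> space Q)))"
      using fm A B pre[of A B] by (subst emeasure_distr) (auto simp: pair_measureI)
    also have "\<dots> = (\<Sum>i\<in>I. emeasure (completion ?P) ((R i -` A \<inter> space M) \<times> (?J i \<inter> (t -` B \<inter> space Q))))"
      using RA[OF _ A] tB[OF _ B] j(1)
      by (intro sum_emeasure[symmetric]) (auto simp: disjoint_family_on_def intro!: completion_Times(1)[OF M Q])
    also have "\<dots> = (\<Sum>i\<in>I. emeasure N A * emeasure (completion Q) (?J i \<inter> (t -` B \<inter> space Q)))"
    proof (rule sum.cong[OF refl])
      fix i assume i: "i \<in> I"
      have "emeasure (completion M) (R i -` A \<inter> space M) = emeasure (completion N) A"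
        by (rule mp_map_emeasure[OF R[OF i]]) (use A in simp)
      then show "emeasure (completion ?P) ((R i -` A \<inter> space M) \<times> (?J i \<inter> (t -` B \<inter> space Q))) =
        emeasure N A * emeasure (completion Q) (?J i \<inter> (t -` B \<inter> space Q))"
        using A by (subst completion_Times(2)[OF M Q RA[OF i A] tB[OF i B]]) (simp del: emeasure_completion add: emeasure_completion[of A N])
    qed
    also have "\<dots> = emeasure N A * (\<Sum>i\<in>I. emeasure (completion Q) (?J i \<inter> (t -` B \<inter> space Q)))"
      by (simp add: sum_distrib_left)
    also have "(\<Sum>i\<in>I. emeasure (completion Q) (?J i \<inter> (t -` B \<inter> space Q))) =
        emeasure (completion Q) (\<Union>i\<in>I. ?J i \<inter> (t -` B \<inter> space Q))"
      using tB[OF _ B] j(1) by (intro sum_emeasure) (auto simp: disjoint_family_on_def)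
    also have "(\<Union>i\<in>I. ?J i \<inter> (t -` B \<inter> space Q)) = t -` B \<inter> space Q" using j(2) by auto
    also have "emeasure (completion Q) (t -` B \<inter> space Q) = emeasure (completion Q') B"
      by (rule mp_map_emeasure[OF t]) (use B in simp)
    also have "emeasure (completion Q') B = emeasure Q' B" using B by simp
    finally show "emeasure N A * emeasure Q' B = emeasure (distr (completion ?P) (N \<Otimes>\<^sub>M Q') ?f) (A \<times> B)" by simp
  qed simp
  then have "emeasure (completion ?P) (?f -` B \<inter> space ?P) = emeasure (N \<Otimes>\<^sub>M Q') B" if "B \<in> sets (N \<Otimes>\<^sub>M Q')" for B
    using emeasure_distr[OF fm that] by simp
  then show ?thesis by (rule mp_mapI[OF fm])
qed

lemma mp_iso_Times:
  assumes M: "prob_space M" and N: "prob_space N" and Q: "prob_space Q" and f: "mp_iso M N f"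
  shows "mp_iso (M \<Otimes>\<^sub>M Q) (N \<Otimes>\<^sub>M Q) (\<lambda>p. (f (fst p), snd p))"
proof -
  obtain g where g: "mp_iso N M g" "AE x in M. g (f x) = x" "AE y in N. f (g y) = y"
    using mp_iso_inverse[OF f] .
  show ?thesis
  proof (rule mp_isoI)
    show "mp_map (M \<Otimes>\<^sub>M Q) (N \<Otimes>\<^sub>M Q) (\<lambda>p. (f (fst p), snd p))"
      using mp_map_skew[OF M N Q Q, of "{()}" "\<lambda>_. ()" "\<lambda>_. f" "\<lambda>x. x"] mp_iso_map[OF f] mp_map_id[of Q]
      by simp
    show "mp_map (N \<Otimes>\<^sub>M Q) (M \<Otimes>\<^sub>M Q) (\<lambda>p. (g (fst p), snd p))"
      using mp_map_skew[OF N M Q Q, of "{()}" "\<lambda>_. ()" "\<lambda>_. g" "\<lambda>x. x"] mp_iso_map[OF g(1)] mp_map_id[of Q]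
      by simp
    show "AE p in M \<Otimes>\<^sub>M Q. (g (fst (f (fst p), snd p)), snd (f (fst p), snd p)) = p"
      using mp_map_AE[OF mp_map_fst[OF M Q] g(2)] by eventually_elim simp
    show "AE p in N \<Otimes>\<^sub>M Q. (f (fst (g (fst p), snd p)), snd (g (fst p), snd p)) = p"
      using mp_map_AE[OF mp_map_fst[OF N Q] g(3)] by eventually_elim simp
  qed
qed

subsection \<open>Rotations of the infinite torus\<close>

text \<open>The circle, carried by the whole real line so that the space is \<open>UNIV\<close>; all
  mass sits on [0,1).\<close>

definition unif :: "real measure" where
  "unif = uniform_measure lborel {0..<1}"

definition torus :: "(nat \<Rightarrow> real) measure" where
  "torus = PiM UNIV (\<lambda>_. unif)"

text \<open>Both \<open>t\<close> and \<open>k\<close> are arbitrary real vectors and only the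
  result is reduced to [0,1). Hence the rotation by 0 is the identity only almost
  everywhere.\<close>

definition rot :: "(nat \<Rightarrow> real) \<Rightarrow> (nat \<Rightarrow> real) \<Rightarrow> nat \<Rightarrow> real" where
  "rot t k = (\<lambda>i. frac (k i + t i))"

lemma space_unif [simp]: "space unif = UNIV" and sets_unif [simp, measurable_cong]: "sets unif = sets borel"
  by (simp_all add: unif_def)

lemma prob_space_unif: "prob_space unif"
  unfolding unif_def by (rule prob_space_uniform_measure) auto

lemma emeasure_unif: "A \<in> sets borel \<Longrightarrow> emeasure unif A = emeasure lborel ({0..<1} \<inter> A)"
  by (simp add: unif_def divide_ennreal_def)

lemma space_torus [simp]: "space torus = UNIV"
  by (simp add: torus_def space_PiM)

lemma prob_space_torus: "prob_space torus"
  unfolding torus_def by (rule prob_space_PiM) (rule prob_space_unif)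

lemma measurable_torus_component [measurable]: "(\<lambda>k. k i) \<in> borel_measurable torus"
proof -
  have "(\<lambda>k. k i) \<in> measurable torus unif"
    unfolding torus_def by (rule measurable_component_singleton) simp
  then show ?thesis by (simp cong: measurable_cong_sets)
qed

lemma AE_unif: "AE x in unif. 0 \<le> x \<and> x < 1"
  unfolding unif_def by (rule AE_uniform_measureI) auto

lemma emeasure_torus_component:
  assumes "A \<in> sets borel"
  shows "emeasure torus {k. k i \<in> A} = emeasure unif A"
proof -
  have "distr torus unif (\<lambda>k. k i) = unif"
    unfolding torus_def by (rule distr_PiM_component) (simp_all add: prob_space_unif)
  then have "emeasure unif A = emeasure (distr torus unif (\<lambda>k. k i)) A" by simp
  also have "\<dots> = emeasure torus {k. k i \<in> A}"
  proof -
    have "(\<lambda>k. k i) \<in> measurable torus unif"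
      unfolding torus_def by (rule measurable_component_singleton) simp
    then show ?thesis using assms by (subst emeasure_distr) (auto simp: vimage_def)
  qed
  finally show ?thesis by simp
qed

lemma AE_torus_component:
  assumes "AE x in unif. P x"
  shows "AE k in torus. P (k i)"
  unfolding torus_def by (rule AE_PiM_component) (use assms in \<open>auto simp: prob_space_unif\<close>)

lemma measurable_frac [measurable]: "(frac :: real \<Rightarrow> real) \<in> borel_measurable borel"
  unfolding frac_def by measurable

lemma emeasure_lborel_shift:
  assumes "A \<in> sets borel"
  shows "emeasure lborel {x::real. x + c \<in> A} = emeasure lborel A"
proof -
  have "emeasure lborel A = emeasure (distr lborel borel ((+) c)) A" by (simp add: lborel_distr_plus)
  also have "\<dots> = emeasure lborel ((+) c -` A \<inter> space lborel)"
    using assms by (intro emeasure_distr) auto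
  also have "(+) c -` A \<inter> space lborel = {x. x + c \<in> A}" by (auto simp: add.commute)
  finally show ?thesis by simp
qed

text \<open>With \<open>s = frac t\<close>, the rotation translates [0,1-s) by s onto [s,1) and
  [1-s,1) by s-1 onto [0,s), so it is an exchange of two intervals.\<close>

lemma distr_unif_rotation: "distr unif unif (\<lambda>x. frac (x + t)) = unif"
proof (rule measure_eqI)
  fix A assume "A \<in> sets (distr unif unif (\<lambda>x. frac (x + t)))"
  then have A[measurable]: "A \<in> sets borel" by simp
  define s where "s = frac t"
  have s: "0 \<le> s" "s < 1" by (simp_all add: s_def frac_lt_1)
  have fr: "frac (x + t) = frac (x + s)" for x :: real
  proof -
    have "x + t = (x + s) + of_int \<lfloor>t\<rfloor>" by (simp add: s_def frac_def)
    then show ?thesis by (simp only: frac_add_of_int_right)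
  qed
  have f1: "frac (x + s) = x + s" if "0 \<le> x" "x + s < 1" for x
    using that s by (simp add: frac_eq)
  have f2: "frac (x + s) = x + (s - 1)" if "x < 1" "x + s \<ge> 1" for x
  proof -
    have "\<lfloor>x + s\<rfloor> = 1" using that s by linarith
    then show ?thesis by (simp add: frac_def)
  qed
  have eq: "{0..<1} \<inter> {x. frac (x + t) \<in> A} =
    {x. x + s \<in> {s..<1} \<inter> A} \<union> {x. x + (s - 1) \<in> {0..<s} \<inter> A}"
    (is "?L = ?R")
  proof (rule Set.set_eqI)
    fix x show "x \<in> ?L \<longleftrightarrow> x \<in> ?R"
      using f1[of x] f2[of x] s by (cases "x + s < 1") (auto simp: fr)
  qed
  have "emeasure (distr unif unif (\<lambda>x. frac (x + t))) A = emeasure unif {x. frac (x + t) \<in> A}"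
    by (subst emeasure_distr) (auto simp: vimage_def)
  also have "\<dots> = emeasure lborel ({0..<1} \<inter> {x. frac (x + t) \<in> A})"
    by (rule emeasure_unif) measurable
  also have "\<dots> = emeasure lborel {x. x + s \<in> {s..<1} \<inter> A} + emeasure lborel {x. x + (s - 1) \<in> {0..<s} \<inter> A}"
    unfolding eq by (rule plus_emeasure[symmetric]) (auto, measurable)
  also have "\<dots> = emeasure lborel ({s..<1} \<inter> A) + emeasure lborel ({0..<s} \<inter> A)"
    by (intro arg_cong2[where f="(+)"] emeasure_lborel_shift) auto
  also have "\<dots> = emeasure lborel (({s..<1} \<inter> A) \<union> ({0..<s} \<inter> A))"
    by (rule plus_emeasure) auto
  also have "({s..<1} \<inter> A) \<union> ({0..<s} \<inter> A) = {0..<1} \<inter> A" using s by auto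
  also have "emeasure lborel ({0..<1} \<inter> A) = emeasure unif A" by (simp add: emeasure_unif)
  finally show "emeasure (distr unif unif (\<lambda>x. frac (x + t))) A = emeasure unif A" .
qed simp

lemma measurable_rot [measurable]: "rot t \<in> measurable torus torus"
  unfolding rot_def torus_def
  by (rule measurable_PiM_single') (auto simp: measurable_cong_sets[OF refl sets_unif] simp flip: torus_def)

lemma distr_rot: "distr torus torus (rot t) = torus"
proof -
  interpret product_prob_space "\<lambda>_::nat. unif" UNIV
    by (rule product_prob_spaceI) (rule prob_space_unif)
  have "distr torus torus (rot t) = PiM UNIV (\<lambda>_. unif)"
  proof (rule PiM_eq)
    show "sets (distr torus torus (rot t)) = sets (PiM UNIV (\<lambda>_. unif))" by (simp add: torus_def)
    fix J :: "nat set" and A assume J: "finite J" "J \<subseteq> UNIV" "\<And>i. i \<in> J \<Longrightarrow> A i \<in> sets unif"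
    let ?B = "\<lambda>i. {x. frac (x + t i) \<in> A i}"
    have B: "?B i \<in> sets unif" if "i \<in> J" for i
      using J(3)[OF that] by simp
    have e: "emeasure unif (?B i) = emeasure unif (A i)" if "i \<in> J" for i
    proof -
      have "emeasure unif (A i) = emeasure (distr unif unif (\<lambda>x. frac (x + t i))) (A i)"
        by (simp add: distr_unif_rotation)
      also have "\<dots> = emeasure unif (?B i)"
        using J(3)[OF that] by (subst emeasure_distr) (auto simp: vimage_def)
      finally show ?thesis by simp
    qed
    have m: "prod_emb UNIV (\<lambda>_. unif) J (Pi\<^sub>E J A) \<in> sets torus"
      unfolding torus_def using J by (intro sets_PiM_I) auto
    have "emeasure (distr torus torus (rot t)) (prod_emb UNIV (\<lambda>_. unif) J (Pi\<^sub>E J A)) =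
      emeasure torus (rot t -` prod_emb UNIV (\<lambda>_. unif) J (Pi\<^sub>E J A) \<inter> space torus)"
      by (rule emeasure_distr[OF measurable_rot m])
    also have "rot t -` prod_emb UNIV (\<lambda>_. unif) J (Pi\<^sub>E J A) \<inter> space torus =
      prod_emb UNIV (\<lambda>_. unif) J (Pi\<^sub>E J ?B)"
      by (auto simp: prod_emb_def rot_def PiE_iff)
    also have "emeasure torus \<dots> = (\<Prod>i\<in>J. emeasure unif (?B i))"
      unfolding torus_def using J B by (intro Infinite_Product_Measure.emeasure_PiM_emb) (auto simp: prob_space_unif)
    also have "\<dots> = (\<Prod>i\<in>J. emeasure unif (A i))" by (rule prod.cong) (simp_all add: e)
    finally show "emeasure (distr torus torus (rot t)) (prod_emb UNIV (\<lambda>_. unif) J (Pi\<^sub>E J A)) =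
      (\<Prod>i\<in>J. emeasure unif (A i))" .
  qed
  then show ?thesis by (simp add: torus_def)
qed

lemma measure_rot:
  assumes "A \<in> sets torus"
  shows "{k. rot t k \<in> A} \<in> sets torus" "measure torus {k. rot t k \<in> A} = measure torus A"
proof -
  have *: "{k. rot t k \<in> A} = rot t -` A \<inter> space torus" by (auto simp: vimage_def)
  show "{k. rot t k \<in> A} \<in> sets torus" unfolding * using assms by measurable
  have "measure torus A = measure (distr torus torus (rot t)) A" by (simp add: distr_rot)
  also have "\<dots> = measure torus {k. rot t k \<in> A}"
    unfolding * by (rule measure_distr[OF measurable_rot assms])
  finally show "measure torus {k. rot t k \<in> A} = measure torus A" by simp
qed

lemma frac_add_Ints: "a - b \<in> \<int> \<Longrightarrow> frac (a::real) = frac b"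
proof -
  assume "a - b \<in> \<int>"
  then obtain j where "a = b + of_int j" by (metis Ints_cases add_diff_cancel_left' diff_add_cancel add.commute)
  then show "frac a = frac b" by simp
qed

lemma frac_diff_Ints: "x - frac (x::real) \<in> \<int>"
  by (simp add: frac_def)

text \<open>The congruence modulo integers is the form in which characters appear below: as
  real-valued lifts that are additive only modulo \<int>.\<close>

lemma rot_rot:
  assumes "\<And>i. s i + t i - u i \<in> \<int>"
  shows "rot s (rot t k) = rot u k"
proof
  fix i
  have "(frac (k i + t i) + s i) - (k i + u i) = (s i + t i - u i) - ((k i + t i) - frac (k i + t i))"
    by simp
  also have "\<dots> \<in> \<int>" by (intro Ints_diff assms frac_diff_Ints)
  finally show "rot s (rot t k) i = rot u k i"
    unfolding rot_def by (rule frac_add_Ints)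
qed

subsection \<open>Extension of real-valued homomorphisms\<close>

text \<open>Lifts of homomorphisms into the quotient of the reals by \<open>N\<close>. The case
  \<open>N = \<int>\<close> gives characters, the case \<open>N = {0}\<close> real-valued
  homomorphisms; both quotients are divisible, which is why extensions exist.\<close>

definition hom_mod :: "real set \<Rightarrow> ('g, 'm) monoid_scheme \<Rightarrow> 'g set \<Rightarrow> ('g \<Rightarrow> real) \<Rightarrow> bool" where
  "hom_mod N G H f \<longleftrightarrow> (\<forall>x\<in>H. \<forall>y\<in>H. f (x \<otimes>\<^bsub>G\<^esub> y) - f x - f y \<in> N)"

definition add_subgroup :: "real set \<Rightarrow> bool" where
  "add_subgroup N \<longleftrightarrow> 0 \<in> N \<and> (\<forall>a\<in>N. \<forall>b\<in>N. a - b \<in> N)"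

lemma add_subgroupD:
  assumes "add_subgroup N"
  shows "0 \<in> N" "a \<in> N \<Longrightarrow> b \<in> N \<Longrightarrow> a - b \<in> N" "a \<in> N \<Longrightarrow> b \<in> N \<Longrightarrow> a + b \<in> N"
proof -
  show 0: "0 \<in> N" using assms by (simp add: add_subgroup_def)
  have d: "a - b \<in> N" if "a \<in> N" "b \<in> N" for a b
    using assms that by (simp add: add_subgroup_def)
  then show "a - b \<in> N" if "a \<in> N" "b \<in> N" using that by simp
  show "a + b \<in> N" if "a \<in> N" "b \<in> N"
    using d[OF that(1) d[OF 0 that(2)]] that by simp
qed

definition adjoin :: "('g, 'm) monoid_scheme \<Rightarrow> 'g set \<Rightarrow> 'g \<Rightarrow> 'g set" where
  "adjoin G H g = {h \<otimes>\<^bsub>G\<^esub> g [^]\<^bsub>G\<^esub> (k::int) | h k. h \<in> H}"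

context comm_group
begin

lemma subgroup_adjoin:
  assumes H: "subgroup H G" and g: "g \<in> carrier G"
  shows "subgroup (adjoin G H g) G" "H \<subseteq> adjoin G H g" "g \<in> adjoin G H g"
proof -
  have Hc: "h \<in> carrier G" if "h \<in> H" for h using subgroup.mem_carrier[OF H that] .
  show "subgroup (adjoin G H g) G"
  proof (rule subgroupI)
    show "adjoin G H g \<subseteq> carrier G" using Hc g by (auto simp: adjoin_def)
    show "adjoin G H g \<noteq> {}" using subgroup.one_closed[OF H] by (auto simp: adjoin_def)
    fix a assume "a \<in> adjoin G H g"
    then obtain h k where a: "a = h \<otimes> g [^] (k::int)" "h \<in> H" by (auto simp: adjoin_def)
    have "inv a = inv h \<otimes> g [^] (- k)" using a Hc g by (simp add: inv_mult int_pow_neg)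
    then show "inv a \<in> adjoin G H g" using subgroup.m_inv_closed[OF H a(2)] by (auto simp: adjoin_def)
    fix b assume "b \<in> adjoin G H g"
    then obtain h' k' where b: "b = h' \<otimes> g [^] (k'::int)" "h' \<in> H" by (auto simp: adjoin_def)
    have "a \<otimes> b = (h \<otimes> h') \<otimes> g [^] (k + k')"
      using a b Hc g by (simp add: int_pow_mult m_ac)
    then show "a \<otimes> b \<in> adjoin G H g" using subgroup.m_closed[OF H a(2) b(2)] by (auto simp: adjoin_def)
  qed
  show "H \<subseteq> adjoin G H g"
  proof
    fix h assume h: "h \<in> H"
    then have "h = h \<otimes> g [^] (0::int)" using Hc by simp
    with h show "h \<in> adjoin G H g" unfolding adjoin_def by blast
  qed
  have "g = \<one> \<otimes> g [^] (1::int)" using g by (simp add: int_pow_1)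
  then show "g \<in> adjoin G H g" using subgroup.one_closed[OF H] unfolding adjoin_def by blast
qed

text \<open>The extension takes h g^k to f h + v k. If two such products are equal, the difference
  of the exponents is a power of \<open>g\<close> in \<open>H\<close>, and there the condition on
  \<open>v\<close> makes both values agree modulo \<open>N\<close>.\<close>

lemma hom_mod_extend_adjoin:
  assumes N: "add_subgroup N"
    and H: "subgroup H G" and f: "hom_mod N G H f" and g: "g \<in> carrier G"
    and v: "\<And>k::int. g [^] k \<in> H \<Longrightarrow> v * of_int k - f (g [^] k) \<in> N"
  obtains f' where "hom_mod N G (adjoin G H g) f'" "\<And>h. h \<in> H \<Longrightarrow> f' h = f h" "f' g - v \<in> N"
proof -
  note Na = add_subgroupD(3)[OF N] and Nd = add_subgroupD(2)[OF N] and N0 = add_subgroupD(1)[OF N]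
  have Hc: "h \<in> carrier G" if "h \<in> H" for h using subgroup.mem_carrier[OF H that] .
  have Hm: "h \<otimes> h' \<in> H" "inv h \<in> H" if "h \<in> H" "h' \<in> H" for h h'
    using H that by (simp_all add: subgroup.m_closed subgroup.m_inv_closed)
  have fD: "f (x \<otimes> y) - f x - f y \<in> N" if "x \<in> H" "y \<in> H" for x y
    using f that by (simp add: hom_mod_def)
  define rep where "rep = (\<lambda>x. SOME p. fst p \<in> H \<and> x = fst p \<otimes> g [^] (snd p :: int))"
  \<comment> \<open>On \<open>H\<close> the old values are kept exactly and not only modulo
    \<open>N\<close>, so that extensions along a chain of subgroups fit together.\<close>
  define f' where "f' = (\<lambda>x. if x \<in> H then f x else f (fst (rep x)) + v * of_int (snd (rep x)))"
  have ambig: "(f h + v * of_int k) - (f h' + v * of_int k') \<in> N"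
    if h: "h \<in> H" "h' \<in> H" and e: "h \<otimes> g [^] k = h' \<otimes> g [^] k'" for h h' and k k' :: int
  proof -
    have d: "g [^] (k - k') = inv h \<otimes> h'"
    proof -
      have "inv h \<otimes> (h \<otimes> g [^] k) \<otimes> inv (g [^] k') = inv h \<otimes> (h' \<otimes> g [^] k') \<otimes> inv (g [^] k')"
        using e by simp
      then show ?thesis using h Hc g by (simp add: int_pow_diff m_assoc[symmetric]) (simp add: m_assoc)
    qed
    then have "g [^] (k - k') \<in> H" using h Hm by simp
    then have 1: "v * of_int (k - k') - f (inv h \<otimes> h') \<in> N" using v[of "k - k'"] d by simp
    have "h \<otimes> (inv h \<otimes> h') = h'" using h Hc by (simp add: m_assoc[symmetric])
    then have 2: "f h' - f h - f (inv h \<otimes> h') \<in> N" using fD[of h "inv h \<otimes> h'"] h Hm by simp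
    have "(f h + v * of_int k) - (f h' + v * of_int k') = (v * of_int (k - k') - f (inv h \<otimes> h')) - (f h' - f h - f (inv h \<otimes> h'))"
      by (simp add: algebra_simps)
    then show ?thesis using Nd[OF 1 2] by (simp only:)
  qed
  have f'_rep: "f' (h \<otimes> g [^] k) - (f h + v * of_int k) \<in> N" if h: "h \<in> H" for h and k :: int
  proof (cases "h \<otimes> g [^] k \<in> H")
    case True
    have "h \<otimes> g [^] k = (h \<otimes> g [^] k) \<otimes> g [^] (0::int)" using h Hc g by simp
    from ambig[OF True h this[symmetric]] show ?thesis using True by (simp add: f'_def)
  next
    case False
    have "\<exists>p. fst p \<in> H \<and> h \<otimes> g [^] k = fst p \<otimes> g [^] (snd p :: int)"
      by (rule exI[of _ "(h, k)"]) (simp add: h)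
    then have "fst (rep (h \<otimes> g [^] k)) \<in> H \<and>
        h \<otimes> g [^] k = fst (rep (h \<otimes> g [^] k)) \<otimes> g [^] (snd (rep (h \<otimes> g [^] k)))"
      unfolding rep_def by (rule someI_ex)
    then show ?thesis using ambig[OF _ h, of "fst (rep (h \<otimes> g [^] k))" "snd (rep (h \<otimes> g [^] k))" k] False
      by (simp add: f'_def)
  qed
  show ?thesis
  proof (rule that)
    show "hom_mod N G (adjoin G H g) f'"
      unfolding hom_mod_def
    proof (intro ballI)
      fix x y assume "x \<in> adjoin G H g" "y \<in> adjoin G H g"
      then obtain h k h' k' where x: "x = h \<otimes> g [^] (k::int)" "h \<in> H" and y: "y = h' \<otimes> g [^] (k'::int)" "h' \<in> H"
        by (auto simp: adjoin_def)
      have xy: "x \<otimes> y = (h \<otimes> h') \<otimes> g [^] (k + k')" using x y Hc g by (simp add: int_pow_mult m_ac)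
      have "f' (x \<otimes> y) - (f (h \<otimes> h') + v * of_int (k + k')) \<in> N" "f' x - (f h + v * of_int k) \<in> N" "f' y - (f h' + v * of_int k') \<in> N"
        unfolding xy using f'_rep[of "h \<otimes> h'" "k + k'"] f'_rep[OF x(2), of k] f'_rep[OF y(2), of k'] x y Hm by auto
      from Na[OF Nd[OF Nd[OF this(1,2)] this(3)] fD[OF x(2) y(2)]]
      show "f' (x \<otimes> y) - f' x - f' y \<in> N" by (simp add: algebra_simps)
    qed
    show "f' h = f h" if "h \<in> H" for h using that by (simp add: f'_def)
    have "f' (\<one> \<otimes> g [^] (1::int)) - (f \<one> + v * of_int 1) \<in> N"
      by (rule f'_rep[OF subgroup.one_closed[OF H]])
    \<comment> \<open>Additivity modulo \<open>N\<close> only forces \<open>f \<one>\<close> into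
      \<open>N\<close>; it need not vanish.\<close>
    moreover have "f \<one> \<in> N"
    proof -
      have "f (\<one> \<otimes> \<one>) - f \<one> - f \<one> \<in> N" using fD subgroup.one_closed[OF H] by blast
      then have "- f \<one> \<in> N" by simp
      from Nd[OF N0 this] show ?thesis by simp
    qed
    ultimately have "(f' (\<one> \<otimes> g [^] (1::int)) - (f \<one> + v * of_int 1)) + f \<one> \<in> N" by (rule Na)
    then show "f' g - v \<in> N" using g by (simp add: int_pow_1)
  qed
qed

text \<open>The exponents \<open>k\<close> with g^k in \<open>H\<close> form a subgroup of the
  integers, which is trivial or generated by its least positive element.\<close>

lemma pow_subgroup_cases:
  assumes H: "subgroup H G" and g: "g \<in> carrier G"
  shows "(\<forall>k::int. g [^] k \<in> H \<longrightarrow> k = 0) \<or> (\<exists>n>0. \<forall>k::int. g [^] k \<in> H \<longleftrightarrow> int n dvd k)"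
proof (cases "\<exists>n::nat. n > 0 \<and> g [^] int n \<in> H")
  case False
  have "k = 0" if k: "g [^] k \<in> H" for k :: int
  proof (rule ccontr)
    assume "k \<noteq> 0"
    moreover have "g [^] (\<bar>k\<bar>) \<in> H"
      using k subgroup.m_inv_closed[OF H k] g by (auto simp: abs_if int_pow_neg)
    ultimately show False using False by (metis nat_0_le abs_ge_zero zero_less_abs_iff zero_less_nat_eq)
  qed
  then show ?thesis by blast
next
  case True
  define n where "n = (LEAST n::nat. n > 0 \<and> g [^] int n \<in> H)"
  have n: "n > 0" "g [^] int n \<in> H" using LeastI_ex[OF True] by (auto simp: n_def)
  have min: "\<not> (j > 0 \<and> g [^] int j \<in> H)" if "j < n" for j
    using not_less_Least[of j "\<lambda>n. n > 0 \<and> g [^] int n \<in> H"] that unfolding n_def by blast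
  have mult: "g [^] (int n * j) \<in> H" for j :: int
  proof -
    have "g [^] (int n * j) = (g [^] int n) [^] j" using g by (simp add: int_pow_pow)
    moreover have "(g [^] int n) [^] j \<in> H" using n(2) H by (simp add: subgroup_int_pow_closed)
    ultimately show ?thesis by simp
  qed
  have "g [^] k \<in> H \<longleftrightarrow> int n dvd k" for k :: int
  proof
    assume k: "g [^] k \<in> H"
    have "g [^] (k mod int n) = g [^] k \<otimes> inv (g [^] (int n * (k div int n)))"
      using g by (simp add: int_pow_diff[symmetric] minus_mult_div_eq_mod)
    then have "g [^] (k mod int n) \<in> H"
      using k mult[of "k div int n"] H by (simp add: subgroup.m_closed subgroup.m_inv_closed)
    then have "g [^] int (nat (k mod int n)) \<in> H" using n(1) by simp
    moreover have "nat (k mod int n) < n" using n(1) by (simp add: nat_less_iff)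
    ultimately have "\<not> 0 < nat (k mod int n)" using min[of "nat (k mod int n)"] by simp
    then have "k mod int n \<le> 0" by simp
    then have "k mod int n = 0" using n(1) by (simp add: order.antisym)
    then show "int n dvd k" by (rule dvd_eq_mod_eq_0[THEN iffD2])
  next
    assume "int n dvd k"
    then obtain j where "k = int n * j" by (rule dvdE)
    then show "g [^] k \<in> H" using mult[of j] by simp
  qed
  then show ?thesis using n(1) by blast
qed

lemma hom_mod_int_pow:
  assumes N: "add_subgroup N"
    and H: "subgroup H G" and f: "hom_mod N G H f" and x: "x \<in> H"
  shows "f (x [^] (k::int)) - of_int k * f x \<in> N"
proof -
  note Na = add_subgroupD(3)[OF N] and Nd = add_subgroupD(2)[OF N] and N0 = add_subgroupD(1)[OF N]
  have fD: "f (x \<otimes> y) - f x - f y \<in> N" if "x \<in> H" "y \<in> H" for x y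
    using f that by (simp add: hom_mod_def)
  have xc: "x \<in> carrier G" using subgroup.mem_carrier[OF H x] .
  have xp: "x [^] (k::int) \<in> H" for k using H x by (simp add: subgroup_int_pow_closed)
  show ?thesis
  proof (induction k rule: int_induct[where k=0])
    case base
    have "f (\<one> \<otimes> \<one>) - f \<one> - f \<one> \<in> N" using fD subgroup.one_closed[OF H] by blast
    then have "- f \<one> \<in> N" by simp
    from Nd[OF N0 this] show ?case by simp
  next
    case (step1 i)
    have "x [^] (i + 1) = x [^] i \<otimes> x" using xc by (simp add: int_pow_mult int_pow_1)
    then have "f (x [^] (i + 1)) - f (x [^] i) - f x \<in> N" using fD[OF xp x] by simp
    from Na[OF this step1(2)] show ?case by (simp add: algebra_simps)
  next
    case (step2 i)
    have "x [^] (i - 1) \<otimes> x = x [^] i" using int_pow_mult[OF xc, of "i - 1" 1] xc by (simp add: int_pow_1)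
    then have "f (x [^] i) - f (x [^] (i - 1)) - f x \<in> N" using fD[OF xp[of "i - 1"] x] by simp
    from Nd[OF step2(2) this] show ?case by (simp add: algebra_simps)
  qed
qed

text \<open>Divisibility of the reals: if \<open>g\<close> has order n modulo \<open>H\<close>, the
  value f(g^n) / n is compatible; if the order is infinite, every value is, and 0 is taken.\<close>

lemma hom_mod_extend_one:
  assumes N: "add_subgroup N"
    and H: "subgroup H G" and f: "hom_mod N G H f" and g: "g \<in> carrier G"
  obtains f' where "hom_mod N G (adjoin G H g) f'" "\<And>h. h \<in> H \<Longrightarrow> f' h = f h"
proof -
  note Nd = add_subgroupD(2)[OF N] and N0 = add_subgroupD(1)[OF N]
  have "\<exists>v. \<forall>k::int. g [^] k \<in> H \<longrightarrow> v * of_int k - f (g [^] k) \<in> N"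
    using pow_subgroup_cases[OF H g]
  proof (elim disjE exE conjE)
    assume infinite: "\<forall>k::int. g [^] k \<in> H \<longrightarrow> k = 0"
    have "f \<one> \<in> N" using hom_mod_int_pow[OF N H f subgroup.one_closed[OF H], of 0] by simp
    then have "0 - f \<one> \<in> N" by (rule Nd[OF N0])
    then have "0 * of_int k - f (g [^] k) \<in> N" if "g [^] k \<in> H" for k :: int
      using infinite[rule_format, OF that] by simp
    then show ?thesis by (intro exI[of _ "0::real"]) blast
  next
    fix n :: nat assume finite: "n > 0" "\<forall>k::int. g [^] k \<in> H \<longleftrightarrow> int n dvd k"
    have "f (g [^] int n) / real n * of_int k - f (g [^] k) \<in> N" if k: "g [^] k \<in> H" for k :: int
    proof -
      obtain j where j: "k = int n * j" using finite(2) k by (auto elim: dvdE)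
      have gn: "g [^] int n \<in> H" using finite(2) by simp
      have "f ((g [^] int n) [^] j) - of_int j * f (g [^] int n) \<in> N"
        by (rule hom_mod_int_pow[OF N H f gn])
      from Nd[OF N0 this] have "0 - (f (g [^] k) - of_int j * f (g [^] int n)) \<in> N"
        using g by (simp add: j int_pow_pow)
      then show ?thesis using finite(1) by (simp add: j mult.commute)
    qed
    then show ?thesis by (intro exI[of _ "f (g [^] int n) / real n"]) blast
  qed
  then obtain v where v: "\<And>k::int. g [^] k \<in> H \<Longrightarrow> v * of_int k - f (g [^] k) \<in> N" by blast
  obtain f' where "hom_mod N G (adjoin G H g) f'" "\<And>h. h \<in> H \<Longrightarrow> f' h = f h"
    by (rule hom_mod_extend_adjoin[OF N H f g v]) auto
  then show ?thesis by (rule that)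
qed

text \<open>Countability lets the elements be adjoined one after another along an enumeration; the
  subgroups obtained exhaust the group.\<close>

lemma hom_mod_extend:
  assumes N: "add_subgroup N"
    and H: "subgroup H G" and f: "hom_mod N G H f" and count: "countable (carrier G)"
  obtains f' where "hom_mod N G (carrier G) f'" "\<And>h. h \<in> H \<Longrightarrow> f' h = f h"
proof -
  define e where "e = from_nat_into (carrier G)"
  have e: "e n \<in> carrier G" for n unfolding e_def by (rule from_nat_into) auto
  let ?P = "\<lambda>p. subgroup (fst p) G \<and> hom_mod N G (fst p) (snd p)"
  let ?Q = "\<lambda>n p p'. fst p \<subseteq> fst p' \<and> e n \<in> fst p' \<and> (\<forall>h\<in>fst p. snd p' h = snd p h)"
  have ex: "\<exists>p'. ?P p' \<and> ?Q n p p'" if P: "?P p" for n p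
  proof -
    obtain f' where "hom_mod N G (adjoin G (fst p) (e n)) f'" "\<And>h. h \<in> fst p \<Longrightarrow> f' h = snd p h"
      by (rule hom_mod_extend_one[OF N conjunct1[OF P] conjunct2[OF P] e[of n]]) auto
    then show ?thesis using subgroup_adjoin[OF conjunct1[OF P] e, of n]
      by (intro exI[of _ "(adjoin G (fst p) (e n), f')"]) simp
  qed
  define nxt where "nxt n p = (SOME p'. ?P p' \<and> ?Q n p p')" for n p
  have nxt: "?P (nxt n p) \<and> ?Q n p (nxt n p)" if "?P p" for n p
    unfolding nxt_def by (rule someI_ex[OF ex[OF that]])
  define s where "s = rec_nat (H, f) nxt"
  have s0: "s 0 = (H, f)" and sS: "s (Suc n) = nxt n (s n)" for n by (simp_all add: s_def)
  have sP: "?P (s n)" for n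
    by (induction n) (use H f nxt in \<open>simp_all add: s0 sS\<close>)
  have sQ: "?Q n (s n) (s (Suc n))" for n
    using nxt[OF sP[of n], of n] unfolding sS by (elim conjE, intro conjI)
  have mono: "fst (s m) \<subseteq> fst (s n) \<and> (\<forall>h\<in>fst (s m). snd (s n) h = snd (s m) h)" if "m \<le> n" for m n
    using that by (induction rule: dec_induct) (use sQ in \<open>auto simp: subset_iff\<close>)
  have cover: "\<exists>n. x \<in> fst (s n)" if x: "x \<in> carrier G" for x
  proof -
    obtain n where "x = e n" using from_nat_into_surj[OF count x] by (auto simp: e_def)
    then show ?thesis using sQ[of n] by blast
  qed
  \<comment> \<open>Evaluation at the first stage that contains \<open>x\<close>; by
    \<open>mono\<close> every later stage gives the same value.\<close>
  define F where "F x = snd (s (LEAST n. x \<in> fst (s n))) x" for x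
  have F: "F x = snd (s n) x" if "x \<in> fst (s n)" for x n
  proof -
    have "x \<in> fst (s (LEAST n. x \<in> fst (s n)))" by (rule LeastI) (rule that)
    moreover have "(LEAST n. x \<in> fst (s n)) \<le> n" by (rule Least_le) (rule that)
    ultimately show ?thesis using mono[of "LEAST n. x \<in> fst (s n)" n] unfolding F_def by simp
  qed
  show ?thesis
  proof (rule that)
    show "hom_mod N G (carrier G) F"
      unfolding hom_mod_def
    proof (intro ballI)
      fix x y assume "x \<in> carrier G" "y \<in> carrier G"
      then obtain a b where ab: "x \<in> fst (s a)" "y \<in> fst (s b)" using cover by blast
      define n where "n = max a b"
      have n: "x \<in> fst (s n)" "y \<in> fst (s n)" using ab mono[of a n] mono[of b n] by (auto simp: n_def)
      then have "x \<otimes> y \<in> fst (s n)" using sP[of n] by (auto intro: subgroup.m_closed)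
      then show "F (x \<otimes> y) - F x - F y \<in> N"
        using n F sP[of n] by (simp add: hom_mod_def)
    qed
    show "F h = f h" if "h \<in> H" for h using F[of h 0] that by (simp add: s0)
  qed
qed

lemma hom_mod_extend_value:
  assumes N: "add_subgroup N"
    and H: "subgroup H G" and f: "hom_mod N G H f" and count: "countable (carrier G)"
    and g: "g \<in> carrier G" and v: "\<And>k::int. g [^] k \<in> H \<Longrightarrow> v * of_int k - f (g [^] k) \<in> N"
  obtains f' where "hom_mod N G (carrier G) f'" "\<And>h. h \<in> H \<Longrightarrow> f' h = f h" "f' g - v \<in> N"
proof -
  obtain f1 where f1: "hom_mod N G (adjoin G H g) f1" "\<And>h. h \<in> H \<Longrightarrow> f1 h = f h" "f1 g - v \<in> N"
    by (rule hom_mod_extend_adjoin[OF N H f g v]) auto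
  obtain f2 where f2: "hom_mod N G (carrier G) f2" "\<And>h. h \<in> adjoin G H g \<Longrightarrow> f2 h = f1 h"
    by (rule hom_mod_extend[OF N subgroup_adjoin(1)[OF H g] f1(1) count]) auto
  show ?thesis
    by (rule that[of f2]) (use f1 f2 subgroup_adjoin[OF H g] in auto)
qed

end

subsection \<open>Towers\<close>

lemma add_subgroup_Ints: "add_subgroup \<int>"
  by (simp add: add_subgroup_def)

definition shift :: "(nat \<Rightarrow> 'g \<Rightarrow> real) \<Rightarrow> 'g \<Rightarrow> (nat \<Rightarrow> real) \<Rightarrow> nat \<Rightarrow> real" where
  "shift X x = rot (\<lambda>i. X i x)"

lemma rot_commute: "rot s (rot t k) = rot t (rot s k)"
proof -
  have "rot s (rot t k) = rot (\<lambda>i. s i + t i) k" "rot t (rot s k) = rot (\<lambda>i. s i + t i) k"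
    by (rule rot_rot; simp)+
  then show ?thesis by simp
qed

lemma shift_rot_commute: "shift X x (rot t k) = rot t (shift X x k)"
  unfolding shift_def by (rule rot_commute)

lemma finite_range_sets:
  assumes "finite A" "\<And>k. f k \<in> A" "\<And>a. {k. f k = a} \<in> sets N"
  shows "{k. P (f k)} \<in> sets N"
proof -
  have "{k. P (f k)} = (\<Union>a\<in>{a\<in>A. P a}. {k. f k = a})" using assms(2) by auto
  also have "\<dots> \<in> sets N" using assms by (intro sets.finite_UN) auto
  finally show ?thesis .
qed

lemma measure_UN_rot:
  fixes n :: nat
  assumes B: "B \<in> sets torus" and sub: "A \<subseteq> (\<Union>j<n. {k. rot (s j) k \<in> B})"
  shows "measure torus A \<le> n * measure torus B"
proof -
  interpret T: prob_space torus by (rule prob_space_torus)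
  have "measure torus A \<le> measure torus (\<Union>j<n. {k. rot (s j) k \<in> B})"
    using sub measure_rot(1)[OF B] by (intro T.finite_measure_mono sets.finite_UN) auto
  also have "\<dots> \<le> (\<Sum>j<n. measure torus {k. rot (s j) k \<in> B})"
    using measure_rot(1)[OF B] by (intro T.finite_measure_subadditive_finite) auto
  also have "\<dots> = n * measure torus B" by (simp add: measure_rot(2)[OF B])
  finally show ?thesis .
qed

text \<open>
  Here \<open>c\<close> depends on the first \<open>m\<close> coordinates only, and small rotations of these change it on
  small sets. A tower is useful for \<open>x\<close> when \<open>defect G X c x\<close> is small; the rotations \<open>X x\<close> are lifted to
  real vectors.
\<close>

definition tower :: "('g, 'm) monoid_scheme \<Rightarrow> nat \<Rightarrow> (nat \<Rightarrow> 'g \<Rightarrow> real) \<Rightarrow> ((nat \<Rightarrow> real) \<Rightarrow> 'g) \<Rightarrow> bool" where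
  "tower G m X c \<longleftrightarrow>
    (\<forall>i. hom_mod \<int> G (carrier G) (X i)) \<and> (\<forall>k. c k \<in> carrier G) \<and> finite (range c) \<and>
    (\<forall>x. {k. c k = x} \<in> sets torus) \<and>
    (\<forall>k k'. (\<forall>i<m. frac (k i) = frac (k' i)) \<longrightarrow> c k = c k') \<and>
    (\<forall>e>0. \<exists>d>0. \<forall>t. (\<forall>i<m. \<exists>j::int. \<bar>t i - of_int j\<bar> < d) \<longrightarrow> measure torus {k. c (rot t k) \<noteq> c k} < e)"

definition defect :: "('g, 'm) monoid_scheme \<Rightarrow> (nat \<Rightarrow> 'g \<Rightarrow> real) \<Rightarrow> ((nat \<Rightarrow> real) \<Rightarrow> 'g) \<Rightarrow> 'g \<Rightarrow> (nat \<Rightarrow> real) set" where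
  "defect G X c x = {k. c (shift X x k) \<noteq> c k \<otimes>\<^bsub>G\<^esub> x}"

lemma tower_rot_sets:
  assumes "tower G m X c"
  shows "{k. P (c (rot s k)) (c k)} \<in> sets torus"
proof -
  have c: "finite (range c)" "\<And>x. {k. c k = x} \<in> sets torus" using assms by (auto simp: tower_def)
  have "{k. (\<lambda>p. P (fst p) (snd p)) ((\<lambda>k. (c (rot s k), c k)) k)} \<in> sets torus"
  proof (rule finite_range_sets[where f = "\<lambda>k. (c (rot s k), c k)" and P = "\<lambda>p. P (fst p) (snd p)"])
    show "finite (range c \<times> range c)" using c by simp
    fix a
    have "{k. (c (rot s k), c k) = a} = {k. rot s k \<in> {k. c k = fst a}} \<inter> {k. c k = snd a}" by auto
    also have "\<dots> \<in> sets torus" by (intro sets.Int measure_rot c)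
    finally show "{k. (c (rot s k), c k) = a} \<in> sets torus" .
  qed auto
  then show ?thesis by simp
qed

lemma defect_sets: "tower G m X c \<Longrightarrow> defect G X c x \<in> sets torus"
  unfolding defect_def shift_def by (rule tower_rot_sets)

section \<open>The defect under products, inverses and powers\<close>

context comm_group
begin

lemma shift_shift:
  assumes "\<And>i. hom_mod \<int> G (carrier G) (X i)" "x \<in> carrier G" "y \<in> carrier G"
  shows "shift X x (shift X y k) = shift X (x \<otimes> y) k"
  unfolding shift_def
proof (rule rot_rot)
  fix i
  have "X i (x \<otimes> y) - X i x - X i y \<in> \<int>" using assms by (simp add: hom_mod_def)
  then have "- (X i (x \<otimes> y) - X i x - X i y) \<in> \<int>" by (rule Ints_minus)
  then show "X i x + X i y - X i (x \<otimes> y) \<in> \<int>" by (simp add: algebra_simps)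
qed

lemma frac_shift_one:
  assumes "\<And>i. hom_mod \<int> G (carrier G) (X i)"
  shows "frac (shift X \<one> k i) = frac (k i)"
proof -
  have "X i (\<one> \<otimes> \<one>) - X i \<one> - X i \<one> \<in> \<int>" using assms one_closed unfolding hom_mod_def by blast
  then have "X i \<one> \<in> \<int>" by (simp add: minus_in_Ints_iff)
  then show ?thesis unfolding shift_def rot_def frac_frac by (rule frac_add_int_right)
qed

text \<open>The shift by \<open>\<one>\<close> may change a point by integers, but a tower sees
  fractional parts only. Hence the identity holds everywhere, not just almost everywhere.\<close>

lemma tower_shift_one:
  assumes "tower G m X c"
  shows "c (shift X \<one> k) = c k"
proof -
  have "\<And>i. hom_mod \<int> G (carrier G) (X i)" and *: "\<And>k k'. (\<forall>i<m. frac (k i) = frac (k' i)) \<longrightarrow> c k = c k'"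
    using assms unfolding tower_def by blast+
  then show ?thesis using frac_shift_one[of X k] by simp
qed

text \<open>If \<open>k\<close> is good for \<open>y\<close> and the shifted point is good for
  \<open>x\<close>, then \<open>k\<close> is good for the product. The defect of \<open>x\<close>
  enters through a rotated copy, which has the same measure.\<close>

lemma measure_defect_mult:
  assumes t: "tower G m X c" and x: "x \<in> carrier G" and y: "y \<in> carrier G"
  shows "measure torus (defect G X c (x \<otimes> y)) \<le> measure torus (defect G X c x) + measure torus (defect G X c y)"
proof -
  interpret T: prob_space torus by (rule prob_space_torus)
  have X: "\<And>i. hom_mod \<int> G (carrier G) (X i)" and c: "\<And>k. c k \<in> carrier G"
    using t unfolding tower_def by blast+
  let ?A = "{k. shift X y k \<in> defect G X c x}"
  have A: "?A \<in> sets torus" "measure torus ?A = measure torus (defect G X c x)"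
    unfolding shift_def using measure_rot[OF defect_sets[OF t]] by auto
  have "defect G X c (x \<otimes> y) \<subseteq> ?A \<union> defect G X c y"
  proof
    fix k assume k: "k \<in> defect G X c (x \<otimes> y)"
    show "k \<in> ?A \<union> defect G X c y"
    proof (rule ccontr)
      assume "k \<notin> ?A \<union> defect G X c y"
      then have 1: "c (shift X x (shift X y k)) = c (shift X y k) \<otimes> x" "c (shift X y k) = c k \<otimes> y"
        by (auto simp: defect_def)
      have "c (shift X (x \<otimes> y) k) = c k \<otimes> (x \<otimes> y)"
        using 1 x y c[of k] by (simp add: shift_shift[OF X x y] m_ac)
      with k show False by (simp add: defect_def)
    qed
  qed
  then have "measure torus (defect G X c (x \<otimes> y)) \<le> measure torus (?A \<union> defect G X c y)"
    using A defect_sets[OF t] by (intro T.finite_measure_mono) auto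
  also have "\<dots> \<le> measure torus ?A + measure torus (defect G X c y)"
    using A defect_sets[OF t] by (intro measure_Un_le) auto
  finally show ?thesis using A by simp
qed

lemma measure_defect_inv:
  assumes t: "tower G m X c" and x: "x \<in> carrier G"
  shows "measure torus (defect G X c (inv x)) \<le> measure torus (defect G X c x)"
proof -
  interpret T: prob_space torus by (rule prob_space_torus)
  have X: "\<And>i. hom_mod \<int> G (carrier G) (X i)" and c: "\<And>k. c k \<in> carrier G"
    using t unfolding tower_def by blast+
  let ?A = "{k. shift X (inv x) k \<in> defect G X c x}"
  have A: "?A \<in> sets torus" "measure torus ?A = measure torus (defect G X c x)"
    unfolding shift_def using measure_rot[OF defect_sets[OF t]] by auto
  have "defect G X c (inv x) \<subseteq> ?A"
  proof (rule ccontr)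
    assume "\<not> defect G X c (inv x) \<subseteq> ?A"
    then obtain k where k: "k \<in> defect G X c (inv x)" "k \<notin> ?A" by auto
    have "c (shift X x (shift X (inv x) k)) = c k"
      using x tower_shift_one[OF t] by (simp add: shift_shift[OF X])
    then have "c k = c (shift X (inv x) k) \<otimes> x" using k(2) by (simp add: defect_def)
    then have "c (shift X (inv x) k) = c k \<otimes> inv x"
      using x c[of "shift X (inv x) k"] by (simp add: m_assoc)
    with k(1) show False by (simp add: defect_def)
  qed
  then show ?thesis using A T.finite_measure_mono[of "defect G X c (inv x)" ?A] by simp
qed

lemma measure_defect_pow:
  assumes t: "tower G m X c" and x: "x \<in> carrier G"
  shows "measure torus (defect G X c (x [^] (a::int))) \<le> \<bar>a\<bar> * measure torus (defect G X c x)"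
proof -
  have c: "\<And>k. c k \<in> carrier G" using t unfolding tower_def by blast
  have nat: "measure torus (defect G X c (x [^] int n)) \<le> n * measure torus (defect G X c x)" for n
  proof (induction n)
    case 0
    have "defect G X c \<one> = {}" using tower_shift_one[OF t] c by (simp add: defect_def)
    then show ?case by simp
  next
    case (Suc n)
    have "int (Suc n) = int n + 1" by simp
    then have "x [^] int (Suc n) = x [^] int n \<otimes> x" using x by (simp only: int_pow_mult int_pow_1)
    then show ?case
      using measure_defect_mult[OF t int_pow_closed[OF x, of "int n"] x] Suc by (simp add: algebra_simps)
  qed
  show ?thesis
  proof (cases "a \<ge> 0")
    case True
    then show ?thesis using nat[of "nat a"] by simp
  next
    case False
    have "x [^] a = inv (x [^] int (nat (- a)))" using x False by (simp add: int_pow_neg[symmetric])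
    then have "measure torus (defect G X c (x [^] a)) \<le> measure torus (defect G X c (x [^] int (nat (- a))))"
      using measure_defect_inv[OF t, of "x [^] int (nat (- a))"] x by simp
    also have "\<dots> \<le> nat (- a) * measure torus (defect G X c x)" by (rule nat)
    finally show ?thesis using False by simp
  qed
qed

end

lemma measure_torus_frac_near:
  assumes "d \<ge> 0"
  shows "{k. \<bar>frac (k i) - y\<bar> \<le> d} \<in> sets torus" "measure torus {k. \<bar>frac (k i) - y\<bar> \<le> d} \<le> 2 * d"
proof -
  let ?A = "{x. \<bar>frac x - y\<bar> \<le> (d::real)}"
  have A: "?A \<in> sets borel" by measurable
  have "{k \<in> space torus. \<bar>frac (k i) - y\<bar> \<le> d} \<in> sets torus" by measurable
  then show "{k. \<bar>frac (k i) - y\<bar> \<le> d} \<in> sets torus" by simp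
  have "emeasure torus {k. k i \<in> ?A} = emeasure lborel ({0..<1} \<inter> ?A)"
    using emeasure_torus_component[OF A, of i] emeasure_unif[OF A] by simp
  also have "\<dots> \<le> emeasure lborel {y - d..y + d}"
    by (rule emeasure_mono) (auto simp: abs_le_iff)
  also have "\<dots> = ennreal (2 * d)" using assms by simp
  finally have "emeasure torus {k. \<bar>frac (k i) - y\<bar> \<le> d} \<le> ennreal (2 * d)" by simp
  then show "measure torus {k. \<bar>frac (k i) - y\<bar> \<le> d} \<le> 2 * d"
    unfolding measure_def using assms by (intro enn2real_leI) auto
qed

lemma measure_torus_interval:
  assumes "0 \<le> a" "a \<le> b" "b \<le> 1"
  shows "{k. a \<le> frac (k i) \<and> frac (k i) < b} \<in> sets torus"
    "measure torus {k. a \<le> frac (k i) \<and> frac (k i) < b} = b - a"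
proof -
  let ?A = "{x. a \<le> frac x \<and> frac x < (b::real)}"
  have A: "?A \<in> sets borel" by measurable
  have "{k \<in> space torus. a \<le> frac (k i) \<and> frac (k i) < b} \<in> sets torus" by measurable
  then show "{k. a \<le> frac (k i) \<and> frac (k i) < b} \<in> sets torus" by simp
  have "emeasure torus {k. k i \<in> ?A} = emeasure lborel ({0..<1} \<inter> ?A)"
    using emeasure_torus_component[OF A, of i] emeasure_unif[OF A] by simp
  also have "{0..<1} \<inter> ?A = {a..<b}" using assms by auto
  also have "emeasure lborel {a..<b} = ennreal (b - a)" using assms by simp
  finally show "measure torus {k. a \<le> frac (k i) \<and> frac (k i) < b} = b - a"
    using assms by (simp add: measure_def)
qed

lemma frac_eq_Ints:
  assumes "frac a = frac (b::real)"
  shows "a - b \<in> \<int>"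
proof -
  have "a - b = (a - frac a) - (b - frac b)" using assms by simp
  also have "\<dots> \<in> \<int>" by (intro Ints_diff frac_diff_Ints)
  finally show ?thesis .
qed

context comm_group
begin

text \<open>
  The tower of the larger group is built over a further circle: the new generator advances
  one of \<open>n\<close> arcs, and \<open>c'\<close> counts the arcs while rewinding the old tower accordingly.
\<close>

lemma tower_step:
  assumes t: "tower G m X c" and g: "g \<in> carrier G" and n: "n > 0"
    and th: "hom_mod \<int> G (carrier G) th" "th g - 1 / real n \<in> \<int>"
  obtains c' where "tower G (Suc m) (X(m := th)) c'"
    "\<And>k. \<exists>u j. j < n \<and> c' k = c u \<otimes> g [^] (int j)"
    "\<And>h. h \<in> carrier G \<Longrightarrow> th h = 0 \<Longrightarrow>
      measure torus (defect G (X(m := th)) c' h) \<le> n * measure torus (defect G X c h)"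
    "measure torus (defect G (X(m := th)) c' g) \<le> 1 / n"
    "measure torus (defect G (X(m := th)) c' g) \<le> measure torus (defect G X c (g [^] int n))"
proof -
  interpret T: prob_space torus by (rule prob_space_torus)
  have X: "\<And>i. hom_mod \<int> G (carrier G) (X i)" and c: "\<And>k. c k \<in> carrier G" and cfin: "finite (range c)"
    and cdep: "\<And>k k'. (\<forall>i<m. frac (k i) = frac (k' i)) \<Longrightarrow> c k = c k'"
    and ccont: "\<And>e. e > 0 \<Longrightarrow> \<exists>d>0. \<forall>t. (\<forall>i<m. \<exists>j::int. \<bar>t i - of_int j\<bar> < d) \<longrightarrow> measure torus {k. c (rot t k) \<noteq> c k} < e"
    using t unfolding tower_def by blast+
  define X' where "X' = X(m := th)"
  have X': "\<And>i. hom_mod \<int> G (carrier G) (X' i)" using X th by (simp add: X'_def)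
  \<comment> \<open>The index of the arc [j/n,(j+1)/n) that contains the new coordinate.\<close>
  define a where "a k = nat \<lfloor>n * frac (k m)\<rfloor>" for k :: "nat \<Rightarrow> real"
  have afl: "int (a k) = \<lfloor>n * frac (k m)\<rfloor>" for k by (simp add: a_def)
  have a_iff: "a k = j \<longleftrightarrow> real j / n \<le> frac (k m) \<and> frac (k m) < (real j + 1) / n" for j k
  proof -
    have "a k = j \<longleftrightarrow> \<lfloor>n * frac (k m)\<rfloor> = int j" using afl[of k] by linarith
    also have "\<dots> \<longleftrightarrow> real j \<le> n * frac (k m) \<and> n * frac (k m) < real j + 1"
      by (simp add: floor_eq_iff)
    finally show ?thesis using n by (simp add: field_simps)
  qed
  have a_lt: "a k < n" for k
  proof -
    have "real n * frac (k m) < n" using n frac_lt_1[of "k m"] by simp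
    then have "\<lfloor>real n * frac (k m)\<rfloor> < int n" by (simp add: floor_less_iff)
    then show ?thesis using afl[of k] by linarith
  qed
  \<comment> \<open>Undoes \<open>j\<close> moves by \<open>g\<close>. While the arc index climbs
    under \<open>g\<close>, the rewound point stays in place and only a factor \<open>g\<close> is
    gained in \<open>c'\<close>.\<close>
  define u where "u j = shift X (inv (g [^] int j))" for j :: nat
  define c' where "c' k = c (u (a k) k) \<otimes> g [^] int (a k)" for k
  have c': "c' k \<in> carrier G" for k using c g by (simp add: c'_def)
  have shX: "c (shift X' x k) = c (shift X x k)" for x k
    by (rule cdep) (simp add: shift_def rot_def X'_def)
  have a_shift0: "a (shift X' h k) = a k" if "th h = 0" for h k
    using that by (simp add: a_def shift_def rot_def X'_def)
  have u_shift: "c (u j (shift X' h k)) = c (shift X h (u j k))" if "h \<in> carrier G" for j h k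
  proof -
    have "c (u j (shift X' h k)) = c (shift X (inv (g [^] int j)) (shift X' h k))" by (simp add: u_def)
    also have "\<dots> = c (shift X' (inv (g [^] int j)) (shift X' h k))" by (simp add: shX)
    also have "\<dots> = c (shift X' (inv (g [^] int j) \<otimes> h) k)" using g that by (simp add: shift_shift[OF X'])
    also have "\<dots> = c (shift X (inv (g [^] int j) \<otimes> h) k)" by (simp add: shX)
    also have "\<dots> = c (shift X h (u j k))"
      using g that by (simp add: u_def shift_shift[OF X] m_comm)
    finally show ?thesis .
  qed
  have tow: "tower G (Suc m) X' c'"
    unfolding tower_def
  proof (intro conjI allI impI)
    show "hom_mod \<int> G (carrier G) (X' i)" for i by (rule X')
    show "c' k \<in> carrier G" for k by (rule c')
    have "range c' \<subseteq> (\<lambda>(x, j). x \<otimes> g [^] int j) ` (range c \<times> {..<n})"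
    proof
      fix y assume "y \<in> range c'"
      then obtain k where "y = c' k" by auto
      then have "y = (\<lambda>(x, j). x \<otimes> g [^] int j) (c (u (a k) k), a k)" by (simp add: c'_def)
      then show "y \<in> (\<lambda>(x, j). x \<otimes> g [^] int j) ` (range c \<times> {..<n})"
        by (rule image_eqI) (simp add: a_lt)
    qed
    then show "finite (range c')" by (rule finite_subset) (use cfin in auto)
    show "{k. c' k = x} \<in> sets torus" for x
    proof -
      have "{k. c' k = x} = (\<Union>j<n. {k. real j / n \<le> frac (k m) \<and> frac (k m) < (real j + 1) / n} \<inter>
          {k. c (u j k) \<otimes> g [^] int j = x})"
        using a_lt by (auto simp: c'_def a_iff[symmetric])
      also have "\<dots> \<in> sets torus"
      proof (intro sets.finite_UN sets.Int)
        fix j assume "j \<in> {..<n}"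
        then have "(real j + 1) / n \<le> 1" using n by (simp add: field_simps)
        then show "{k. real j / n \<le> frac (k m) \<and> frac (k m) < (real j + 1) / n} \<in> sets torus"
          by (intro measure_torus_interval) (use n in \<open>auto simp: field_simps\<close>)
        show "{k. c (u j k) \<otimes> g [^] int j = x} \<in> sets torus"
          unfolding u_def shift_def by (rule tower_rot_sets[OF t, of "\<lambda>x' _. x' \<otimes> g [^] int j = x"])
      qed simp
      finally show ?thesis .
    qed
    show "c' k = c' k'" if "\<forall>i<Suc m. frac (k i) = frac (k' i)" for k k'
    proof -
      have "a k = a k'" using that by (simp add: a_def)
      moreover have "c (u j k) = c (u j k')" for j
      proof (rule cdep, intro allI impI)
        fix i assume "i < m"
        then have "frac (k i) = frac (k' i)" using that by simp
        then have "frac (k i + s) = frac (k' i + s)" for s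
          by (intro frac_add_Ints) (simp add: frac_eq_Ints)
        then show "frac (u j k i) = frac (u j k' i)" by (simp add: u_def shift_def rot_def)
      qed
      ultimately show ?thesis by (simp add: c'_def)
    qed
    fix e :: real assume e: "e > 0"
    obtain d1 where d1: "d1 > 0"
      "\<And>t. (\<forall>i<m. \<exists>j::int. \<bar>t i - of_int j\<bar> < d1) \<Longrightarrow> measure torus {k. c (rot t k) \<noteq> c k} < e / (2 * n)"
      using ccont[of "e / (2 * n)"] e n by auto
    \<comment> \<open>One half of \<open>e\<close> pays for the points within \<open>d\<close> of
      one of the n + 1 arc ends, in strips of measure at most 2 d each; the other half pays for the
      n rewound copies of the set where the rotation changes \<open>c\<close>.\<close>
    define d where "d = min d1 (e / (4 * (real n + 1)))"
    have d: "d > 0" "d \<le> d1" "2 * (real n + 1) * d \<le> e / 2"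
    proof -
      show "d > 0" "d \<le> d1" using d1 e by (simp_all add: d_def)
      have "d * (4 * (real n + 1)) \<le> e"
        by (subst pos_le_divide_eq[symmetric]) (simp_all add: d_def)
      then show "2 * (real n + 1) * d \<le> e / 2" by (simp add: algebra_simps)
    qed
    have "measure torus {k. c' (rot t k) \<noteq> c' k} < e"
      if tt: "\<forall>i<Suc m. \<exists>j::int. \<bar>t i - of_int j\<bar> < d" for t
    proof -
      let ?N = "\<Union>j\<le>n. {k. \<bar>frac (k m) - real j / n\<bar> \<le> d}"
      let ?B = "{k. c (rot t k) \<noteq> c k}"
      let ?U = "\<Union>j<n. {k. u j k \<in> ?B}"
      have B: "?B \<in> sets torus" by (rule tower_rot_sets[OF t])
      have Bm: "measure torus ?B < e / (2 * n)"
        using tt d by (intro d1(2)) (meson less_Suc_eq less_le_trans)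
      have N: "?N \<in> sets torus" using d by (intro sets.finite_UN measure_torus_frac_near) auto
      have U: "?U \<in> sets torus" unfolding u_def shift_def using measure_rot(1)[OF B] by (intro sets.finite_UN) auto
      have "measure torus ?N \<le> (\<Sum>j\<le>n. measure torus {k. \<bar>frac (k m) - real j / n\<bar> \<le> d})"
        using d measure_torus_frac_near(1) by (intro T.finite_measure_subadditive_finite) auto
      also have "\<dots> \<le> (\<Sum>j\<le>n. 2 * d)"
        using d by (intro sum_mono measure_torus_frac_near) auto
      also have "\<dots> = 2 * (real n + 1) * d" by simp
      also have "\<dots> \<le> e / 2" by (rule d)
      finally have Nm: "measure torus ?N \<le> e / 2" .
      have "measure torus ?U \<le> n * measure torus ?B"
        by (rule measure_UN_rot[OF B, where s = "\<lambda>j i. X i (inv (g [^] int j))"]) (simp add: u_def shift_def)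
      also have "\<dots> < n * (e / (2 * n))" using Bm n by (intro mult_strict_left_mono) auto
      also have "\<dots> = e / 2" using n by simp
      finally have Um: "measure torus ?U < e / 2" .
      have "{k. c' (rot t k) \<noteq> c' k} \<subseteq> ?N \<union> ?U"
      proof (rule ccontr)
        assume "\<not> {k. c' (rot t k) \<noteq> c' k} \<subseteq> ?N \<union> ?U"
        then obtain k where k: "c' (rot t k) \<noteq> c' k" "k \<notin> ?N" "k \<notin> ?U" by auto
        define x where "x = frac (k m)"
        obtain j0 :: int where j0: "\<bar>t m - of_int j0\<bar> < d" using tt by auto
        define j where "j = a k"
        have j: "real j / n \<le> x" "x < (real j + 1) / n" "j < n"
          using a_iff[of k j] a_lt[of k] by (simp_all add: j_def x_def)
        have far: "\<bar>x - real i / n\<bar> > d" if "i \<le> n" for i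
          using k(2) that by (auto simp: x_def not_le)
        have "\<bar>x - real j / n\<bar> > d" "\<bar>x - real (Suc j) / n\<bar> > d" using far[of j] far[of "Suc j"] j(3) by simp_all
        moreover have "\<bar>x - real j / n\<bar> = x - real j / n" using j(1) by simp
        moreover have "\<bar>x - real (Suc j) / n\<bar> = (real j + 1) / n - x" using j(2) by (simp add: add.commute)
        ultimately have x2: "x > real j / n + d" "x < (real j + 1) / n - d" by linarith+
        define y where "y = x + (t m - of_int j0)"
        have y: "real j / n < y" "y < (real j + 1) / n" using x2 j0 by (auto simp: y_def abs_less_iff)
        have y01: "0 \<le> y" "y < 1"
        proof -
          have "0 \<le> real j / n" by simp
          then show "0 \<le> y" using y by linarith
          have "(real j + 1) / n \<le> 1" using j(3) by (simp add: field_simps)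
          then show "y < 1" using y by linarith
        qed
        have "frac (rot t k m) = frac y"
          unfolding rot_def frac_frac
        proof (rule frac_add_Ints)
          have "k m + t m - y = (k m - frac (k m)) + of_int j0" by (simp add: y_def x_def)
          also have "\<dots> \<in> \<int>" by (intro Ints_add frac_diff_Ints Ints_of_int)
          finally show "k m + t m - y \<in> \<int>" .
        qed
        also have "\<dots> = y" using y01 by (simp add: frac_eq)
        finally have "a (rot t k) = j" unfolding a_iff using y by simp
        moreover have "c (u j (rot t k)) = c (u j k)"
          using k(3) j(3) by (auto simp: u_def shift_rot_commute)
        ultimately have "c' (rot t k) = c' k" by (simp add: c'_def j_def)
        with k(1) show False by simp
      qed
      then have "measure torus {k. c' (rot t k) \<noteq> c' k} \<le> measure torus (?N \<union> ?U)"
        using N U by (intro T.finite_measure_mono) auto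
      also have "\<dots> \<le> measure torus ?N + measure torus ?U" using N U by (rule measure_Un_le)
      finally show ?thesis using Nm Um by linarith
    qed
    then show "\<exists>d>0. \<forall>t. (\<forall>i<Suc m. \<exists>j::int. \<bar>t i - of_int j\<bar> < d) \<longrightarrow> measure torus {k. c' (rot t k) \<noteq> c' k} < e"
      using d(1) by blast
  qed
  \<comment> \<open>Such an \<open>h\<close> leaves the arc index unchanged, so its defect is
    covered by the n rewound copies of the old defect.\<close>
  have def_h: "measure torus (defect G X' c' h) \<le> n * measure torus (defect G X c h)"
    if h: "h \<in> carrier G" "th h = 0" for h
  proof (rule measure_UN_rot[OF defect_sets[OF t], where s = "\<lambda>j i. X i (inv (g [^] int j))"])
    have "u (a k) k \<in> defect G X c h" if "k \<in> defect G X' c' h" for k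
    proof (rule ccontr)
      assume "u (a k) k \<notin> defect G X c h"
      then have "c (shift X h (u (a k) k)) = c (u (a k) k) \<otimes> h" by (simp add: defect_def)
      then have "c' (shift X' h k) = c' k \<otimes> h"
        using h(1) g c by (simp add: c'_def a_shift0[OF h(2)] u_shift[OF h(1)] m_ac)
      with that show False by (simp add: defect_def)
    qed
    then show "defect G X' c' h \<subseteq> (\<Union>j<n. {k. rot (\<lambda>i. X i (inv (g [^] int j))) k \<in> defect G X c h})"
      using a_lt by (fastforce simp: u_def shift_def)
  qed
  \<comment> \<open>A defect for \<open>g\<close> occurs only at the wrap-around from the last arc
    to the first, and only if the old tower fails to follow g^n at the rewound point. The two
    conditions give the two bounds on the defect of \<open>g\<close>.\<close>
  have g_step: "a k = n - 1 \<and> u (n - 1) k \<in> defect G X c (g [^] int n)" if k: "k \<in> defect G X' c' g" for k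
  proof -
    have am: "frac (shift X' g k m) = frac (frac (k m) + 1 / n)"
      unfolding shift_def rot_def frac_frac
    proof (rule frac_add_Ints)
      have "k m + X' m g - (frac (k m) + 1 / n) = (k m - frac (k m)) + (th g - 1 / n)" by (simp add: X'_def)
      also have "\<dots> \<in> \<int>" by (intro Ints_add frac_diff_Ints th)
      finally show "k m + X' m g - (frac (k m) + 1 / n) \<in> \<int>" .
    qed
    have ak: "real (a k) / n \<le> frac (k m)" "frac (k m) < (real (a k) + 1) / n" using a_iff[of k "a k"] by auto
    show ?thesis
    proof (cases "a k = n - 1")
      case False
      then have lt: "a k + 1 < n" using a_lt[of k] by linarith
      then have "(real (a k) + 1) / n + 1 / n \<le> 1" using n by (simp add: field_simps)
      then have "frac (frac (k m) + 1 / n) = frac (k m) + 1 / n"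
        using ak(2) frac_ge_0[of "k m"] by (subst frac_eq) (auto intro: add_nonneg_nonneg)
      then have "a (shift X' g k) = a k + 1"
        unfolding a_iff am using ak by (simp add: add_divide_distrib)
      then have "c' (shift X' g k) = c (shift X g (u (a k + 1) k)) \<otimes> g [^] int (a k + 1)"
        using u_shift[OF g] by (simp add: c'_def)
      also have "shift X g (u (a k + 1) k) = u (a k) k"
      proof -
        have "g \<otimes> inv (g [^] int (a k + 1)) = g [^] (1 - int (a k + 1))"
          using g int_pow_diff[OF g, of 1 "int (a k + 1)"] by (simp add: int_pow_1)
        also have "\<dots> = inv (g [^] int (a k))" using int_pow_neg[OF g, of "int (a k)"] by simp
        finally show ?thesis using g by (simp add: u_def shift_shift[OF X])
      qed
      also have "g [^] int (a k + 1) = g [^] int (a k) \<otimes> g"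
      proof -
        have "int (a k + 1) = int (a k) + 1" by simp
        then show ?thesis by (simp only: int_pow_mult[OF g] int_pow_1[OF g])
      qed
      finally have "c' (shift X' g k) = c' k \<otimes> g" using c g by (simp add: c'_def m_assoc)
      with k show ?thesis by (simp add: defect_def)
    next
      case True
      then have "real (a k) = real n - 1" using n by (simp add: of_nat_diff)
      then have ge: "frac (k m) + 1 / n \<ge> 1" using ak(1) n by (simp add: field_simps)
      have lt: "frac (k m) + 1 / n < 1 + 1 / n" using frac_lt_1[of "k m"] by simp
      have "1 / real n \<le> 1" using n by simp
      then have "\<lfloor>frac (k m) + 1 / n\<rfloor> = 1" using ge lt by linarith
      then have "frac (frac (k m) + 1 / n) = frac (k m) + 1 / n - 1" by (simp add: frac_def)
      then have "a (shift X' g k) = 0"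
        unfolding a_iff am using ge lt by simp
      then have "c' (shift X' g k) = c (shift X g (u 0 k))"
        using u_shift[OF g] c by (simp add: c'_def)
      also have "shift X g (u 0 k) = shift X (g [^] int n) (u (n - 1) k)"
      proof -
        have "g [^] int n \<otimes> inv (g [^] int (n - 1)) = g [^] (int n - int (n - 1))"
          using int_pow_diff[OF g] by simp
        also have "int n - int (n - 1) = 1" using n by (simp add: of_nat_diff)
        finally have "g [^] int n \<otimes> inv (g [^] int (n - 1)) = g" using g by (simp add: int_pow_1)
        moreover have "g \<otimes> inv (g [^] int 0) = g" using g by simp
        ultimately show ?thesis using g shift_shift[OF X] by (simp only: u_def int_pow_closed inv_closed)
      qed
      finally have 1: "c' (shift X' g k) = c (shift X (g [^] int n) (u (n - 1) k))" .
      have "c' k \<otimes> g = c (u (n - 1) k) \<otimes> (g [^] int (n - 1) \<otimes> g)"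
        using True c g by (simp add: c'_def m_assoc)
      also have "g [^] int (n - 1) \<otimes> g = g [^] (int (n - 1) + 1)"
        by (simp only: int_pow_mult[OF g] int_pow_1[OF g])
      also have "int (n - 1) + 1 = int n" using n by simp
      finally have "c' k \<otimes> g = c (u (n - 1) k) \<otimes> g [^] int n" .
      with 1 k True show ?thesis by (simp add: defect_def)
    qed
  qed
  have g1: "measure torus (defect G X' c' g) \<le> 1 / n"
  proof -
    let ?A = "{k. real (n - 1) / n \<le> frac (k m) \<and> frac (k m) < 1}"
    have n1: "(real (n - 1) + 1) / n = 1" using n by (simp add: of_nat_diff)
    have "defect G X' c' g \<subseteq> ?A"
    proof
      fix k assume "k \<in> defect G X' c' g"
      then have "a k = n - 1" using g_step by blast
      then show "k \<in> ?A" unfolding a_iff n1 by simp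
    qed
    moreover have "?A \<in> sets torus" "measure torus ?A = 1 - real (n - 1) / n"
      by (rule measure_torus_interval; use n in \<open>simp add: field_simps\<close>)+
    ultimately have "measure torus (defect G X' c' g) \<le> 1 - real (n - 1) / n"
      using T.finite_measure_mono[of "defect G X' c' g" ?A] by simp
    also have "\<dots> = 1 / n" using n by (simp add: of_nat_diff field_simps)
    finally show ?thesis .
  qed
  have g2: "measure torus (defect G X' c' g) \<le> measure torus (defect G X c (g [^] int n))"
  proof -
    have "measure torus (defect G X' c' g) \<le> real 1 * measure torus (defect G X c (g [^] int n))"
      by (rule measure_UN_rot[OF defect_sets[OF t], where s = "\<lambda>j i. X i (inv (g [^] int (n - 1)))"])
        (use g_step in \<open>auto simp: u_def shift_def\<close>)
    then show ?thesis by simp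
  qed
  show ?thesis
    by (rule that[OF tow[unfolded X'_def] _ def_h[unfolded X'_def] g1[unfolded X'_def] g2[unfolded X'_def]])
      (use a_lt in \<open>auto simp: c'_def\<close>)
qed

end

text \<open>
  Towers over \<open>H\<close> with values in \<open>D E\<close>. The finite set \<open>E\<close> may depend on the precision wanted on \<open>F\<close>, but not on the precision wanted
  on the subgroup \<open>D\<close>.
\<close>

definition relative_towers :: "('g, 'm) monoid_scheme \<Rightarrow> 'g set \<Rightarrow> 'g set \<Rightarrow> bool" where
  "relative_towers G D H \<longleftrightarrow> (\<forall>F e. finite F \<and> F \<subseteq> H \<and> e > 0 \<longrightarrow>
    (\<exists>E. finite E \<and> E \<subseteq> H \<and> (\<forall>S e'. finite S \<and> S \<subseteq> D \<and> e' > 0 \<longrightarrow>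
      (\<exists>m X c. tower G m X c \<and> (\<forall>k. \<exists>d\<in>D. \<exists>x\<in>E. c k = d \<otimes>\<^bsub>G\<^esub> x) \<and>
        (\<forall>f\<in>F. measure torus (defect G X c f) < e) \<and> (\<forall>s\<in>S. measure torus (defect G X c s) < e')))))"

lemma relative_towersE:
  assumes "relative_towers G D H" "finite F" "F \<subseteq> H" "e > 0"
  obtains E where "finite E" "E \<subseteq> H" "\<And>S e'. finite S \<Longrightarrow> S \<subseteq> D \<Longrightarrow> e' > 0 \<Longrightarrow>
      \<exists>m X c. tower G m X c \<and> (\<forall>k. \<exists>d\<in>D. \<exists>x\<in>E. c k = d \<otimes>\<^bsub>G\<^esub> x) \<and>
        (\<forall>f\<in>F. measure torus (defect G X c f) < e) \<and> (\<forall>s\<in>S. measure torus (defect G X c s) < e')"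
proof -
  from assms(1)[unfolded relative_towers_def, rule_format, OF conjI[OF assms(2) conjI[OF assms(3,4)]]]
  obtain E where E: "finite E \<and> E \<subseteq> H \<and> (\<forall>S e'. finite S \<and> S \<subseteq> D \<and> e' > 0 \<longrightarrow>
      (\<exists>m X c. tower G m X c \<and> (\<forall>k. \<exists>d\<in>D. \<exists>x\<in>E. c k = d \<otimes>\<^bsub>G\<^esub> x) \<and>
        (\<forall>f\<in>F. measure torus (defect G X c f) < e) \<and> (\<forall>s\<in>S. measure torus (defect G X c s) < e')))"
    by (elim exE)
  show ?thesis
    by (rule that[of E]) (use E in \<open>simp_all\<close>)
qed

section \<open>Existence of relative towers over finitely generated subgroups\<close>

context comm_group
begin

lemma relative_towers_trivial: "relative_towers G {\<one>} {\<one>}"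
  unfolding relative_towers_def
proof (intro allI impI)
  fix F e assume F: "finite F \<and> F \<subseteq> {\<one>} \<and> (e::real) > 0"
  have t: "tower G 0 (\<lambda>_ _. 0) (\<lambda>_. \<one>)"
    unfolding tower_def
  proof (intro conjI allI impI)
    show "{k. \<one> = x} \<in> sets torus" for x by (cases "\<one> = x") (use sets.top[of torus] in auto)
  qed (auto simp: hom_mod_def intro!: exI[of _ "1::real"])
  have d: "defect G (\<lambda>_ _. 0) (\<lambda>_. \<one>) \<one> = {}" by (simp add: defect_def)
  have "\<exists>m X c. tower G m X c \<and> (\<forall>k. \<exists>d\<in>{\<one>}. \<exists>x\<in>{\<one>}. c k = d \<otimes> x) \<and>
        (\<forall>f\<in>F. measure torus (defect G X c f) < e) \<and> (\<forall>s\<in>S. measure torus (defect G X c s) < e')"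
    if S: "finite S \<and> S \<subseteq> {\<one>} \<and> e' > 0" for S e'
  proof (intro exI conjI)
    show "\<forall>f\<in>F. measure torus (defect G (\<lambda>_ _. 0) (\<lambda>_. \<one>) f) < e"
      "\<forall>s\<in>S. measure torus (defect G (\<lambda>_ _. 0) (\<lambda>_. \<one>) s) < e'"
      using F S d by (auto simp: subset_singleton_iff)
  qed (use t in simp_all)
  then show "\<exists>E. finite E \<and> E \<subseteq> {\<one>} \<and> (\<forall>S e'. finite S \<and> S \<subseteq> {\<one>} \<and> e' > 0 \<longrightarrow>
      (\<exists>m X c. tower G m X c \<and> (\<forall>k. \<exists>d\<in>{\<one>}. \<exists>x\<in>E. c k = d \<otimes> x) \<and>
        (\<forall>f\<in>F. measure torus (defect G X c f) < e) \<and> (\<forall>s\<in>S. measure torus (defect G X c s) < e')))"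
    by (intro exI[of _ "{\<one>}"]) simp
qed

text \<open>When the values may range over all of \<open>H\<close>, the set \<open>E\<close> can be
  \<open>{\<one>}\<close> for every precision. The tower itself is then chosen after
  \<open>S\<close>, with \<open>S\<close> added to \<open>F\<close>.\<close>

lemma relative_towers_refl:
  assumes H: "subgroup H G" and r: "relative_towers G {\<one>} H"
  shows "relative_towers G H H"
  unfolding relative_towers_def
proof (intro allI impI)
  fix F e assume F: "finite F \<and> F \<subseteq> H \<and> (e::real) > 0"
  have Hc: "h \<in> carrier G" if "h \<in> H" for h using subgroup.mem_carrier[OF H that] .
  have "\<exists>m X c. tower G m X c \<and> (\<forall>k. \<exists>d\<in>H. \<exists>x\<in>{\<one>}. c k = d \<otimes> x) \<and>
        (\<forall>f\<in>F. measure torus (defect G X c f) < e) \<and> (\<forall>s\<in>S. measure torus (defect G X c s) < e')"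
    if S: "finite S \<and> S \<subseteq> H \<and> e' > 0" for S e'
  proof -
    have *: "finite (F \<union> S)" "F \<union> S \<subseteq> H" "min e e' > 0" using F S by auto
    obtain E where E: "finite E" "E \<subseteq> H" "\<And>S' e''. finite S' \<Longrightarrow> S' \<subseteq> {\<one>} \<Longrightarrow> e'' > 0 \<Longrightarrow>
      \<exists>m X c. tower G m X c \<and> (\<forall>k. \<exists>d\<in>{\<one>}. \<exists>x\<in>E. c k = d \<otimes> x) \<and>
        (\<forall>f\<in>F \<union> S. measure torus (defect G X c f) < min e e') \<and> (\<forall>s\<in>S'. measure torus (defect G X c s) < e'')"
      by (rule relative_towersE[OF r *]) auto
    obtain m X c where t: "tower G m X c" and cE: "\<forall>k. \<exists>d\<in>{\<one>}. \<exists>x\<in>E. c k = d \<otimes> x"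
      and df: "\<forall>f\<in>F \<union> S. measure torus (defect G X c f) < min e e'"
      using E(3)[OF finite.emptyI empty_subsetI zero_less_one] by (elim exE conjE)
    have "\<exists>d\<in>H. \<exists>x\<in>{\<one>}. c k = d \<otimes> x" for k
    proof -
      obtain x where "x \<in> E" "c k = \<one> \<otimes> x" using cE by blast
      then have "c k \<in> H" "c k = c k \<otimes> \<one>" using E(2) Hc by auto
      then show ?thesis by blast
    qed
    with t df show ?thesis by (intro exI[of _ m] exI[of _ X] exI[of _ c]) simp
  qed
  then show "\<exists>E. finite E \<and> E \<subseteq> H \<and> (\<forall>S e'. finite S \<and> S \<subseteq> H \<and> e' > 0 \<longrightarrow>
      (\<exists>m X c. tower G m X c \<and> (\<forall>k. \<exists>d\<in>H. \<exists>x\<in>E. c k = d \<otimes> x) \<and>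
        (\<forall>f\<in>F. measure torus (defect G X c f) < e) \<and> (\<forall>s\<in>S. measure torus (defect G X c s) < e')))"
    using subgroup.one_closed[OF H] by (intro exI[of _ "{\<one>}"]) simp
qed

text \<open>The number of arcs n depends only on \<open>F\<close>, \<open>e\<close> and the order of
  \<open>g\<close> modulo \<open>H\<close>. The new representatives x g^j with x \<in> E and j < n
  are therefore fixed before \<open>S\<close> and the precision on \<open>S\<close>; that precision
  is met by asking the old tower for a better one.\<close>

lemma relative_towers_adjoin:
  assumes count: "countable (carrier G)" and D: "D \<subseteq> H" and H: "subgroup H G"
    and r: "relative_towers G D H" and g: "g \<in> carrier G"
  shows "relative_towers G D (adjoin G H g)"
  unfolding relative_towers_def
proof (intro allI impI)
  fix F e assume F: "finite F \<and> F \<subseteq> adjoin G H g \<and> (e::real) > 0"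
  have Hc: "h \<in> carrier G" if "h \<in> H" for h using subgroup.mem_carrier[OF H that] .
  have "\<forall>f\<in>F. \<exists>h. h \<in> H \<and> (\<exists>a::int. f = h \<otimes> g [^] a)"
  proof
    fix f assume "f \<in> F"
    then have "f \<in> adjoin G H g" using F by blast
    then obtain h k where "f = h \<otimes> g [^] (k::int)" "h \<in> H" by (auto simp: adjoin_def)
    then show "\<exists>h. h \<in> H \<and> (\<exists>a::int. f = h \<otimes> g [^] a)" by blast
  qed
  from bchoice[OF this] obtain h where h: "\<forall>f\<in>F. h f \<in> H \<and> (\<exists>a::int. f = h f \<otimes> g [^] a)" by (elim exE)
  then have "\<forall>f\<in>F. \<exists>a::int. f = h f \<otimes> g [^] a" by blast
  from bchoice[OF this] obtain a :: "'a \<Rightarrow> int" where a: "\<forall>f\<in>F. f = h f \<otimes> g [^] a f" by (elim exE)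
  define K where "K = (\<Sum>f\<in>F. \<bar>a f\<bar>)"
  have K0: "K \<ge> 0" by (simp add: K_def sum_nonneg)
  have K: "\<bar>a f\<bar> \<le> K" if "f \<in> F" for f
    unfolding K_def using F that by (intro member_le_sum) auto
  \<comment> \<open>An element h g^a of \<open>F\<close> has defect at most that of h plus |a| times
    that of g. With |a| \<le> K and both defects at most \<open>e1\<close>, the total is at most (K
    + 1) e1 = e / 2.\<close>
  define e1 where "e1 = e / (2 * (real_of_int K + 1))"
  have e1: "e1 > 0" using F K0 by (simp add: e1_def)
  have Ke1: "(real_of_int K + 1) * e1 = e / 2" using K0 by (simp add: e1_def field_simps)
  text \<open>If the order of \<open>g\<close> modulo \<open>H\<close> is infinite, then the wrap-around is made rare.\<close>
  have "\<exists>n F0. n > (0::nat) \<and> finite F0 \<and> F0 \<subseteq> H \<and> (\<forall>k::int. g [^] k \<in> H \<longrightarrow> int n dvd k) \<and>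
      (1 / n < e1 \<or> g [^] int n \<in> F0)"
    using pow_subgroup_cases[OF H g]
  proof (elim disjE exE conjE)
    assume inf: "\<forall>k::int. g [^] k \<in> H \<longrightarrow> k = 0"
    obtain n where "inverse (real (Suc n)) < e1" using reals_Archimedean[OF e1] by auto
    then show ?thesis using inf by (intro exI[of _ "Suc n"] exI[of _ "{}"]) (auto simp: inverse_eq_divide)
  next
    fix n :: nat assume "n > 0" "\<forall>k::int. g [^] k \<in> H \<longleftrightarrow> int n dvd k"
    then show ?thesis by (intro exI[of _ n] exI[of _ "{g [^] int n}"]) simp
  qed
  then obtain n F0 where n: "n > (0::nat)" and F0: "finite F0" "F0 \<subseteq> H"
    and ord: "\<forall>k::int. g [^] k \<in> H \<longrightarrow> int n dvd k" and wrap: "1 / n < e1 \<or> g [^] int n \<in> F0"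
    by (elim exE conjE)
  \<comment> \<open>The factor n is what elements of \<open>H\<close> lose in passing to the new
    tower.\<close>
  define e0 where "e0 = e1 / n"
  have e0: "e0 > 0" "n * e0 = e1" "e0 \<le> e1" using e1 n by (auto simp: e0_def field_simps)
  have th0: "hom_mod \<int> G H (\<lambda>_. 0)" by (simp add: hom_mod_def)
  have thv: "1 / real n * of_int k - 0 \<in> \<int>" if k: "g [^] k \<in> H" for k :: int
  proof -
    obtain j where "k = int n * j" using ord k by (auto elim: dvdE)
    then have "1 / real n * of_int k - 0 = of_int j" using n by simp
    then show ?thesis by (simp only: Ints_of_int)
  qed
  \<comment> \<open>A character trivial on \<open>H\<close> with value 1/n at \<open>g\<close>. It
    exists because n divides every exponent that sends \<open>g\<close> into
    \<open>H\<close>.\<close>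
  obtain th where th: "hom_mod \<int> G (carrier G) th" "\<And>h. h \<in> H \<Longrightarrow> th h = 0" "th g - 1 / real n \<in> \<int>"
    by (rule hom_mod_extend_value[OF add_subgroup_Ints H th0 count g thv]) auto
  have hF: "finite (h ` F \<union> F0)" "h ` F \<union> F0 \<subseteq> H" using F F0 h by auto
  obtain E where E: "finite E" "E \<subseteq> H" "\<And>S e'. finite S \<Longrightarrow> S \<subseteq> D \<Longrightarrow> e' > 0 \<Longrightarrow>
      \<exists>m X c. tower G m X c \<and> (\<forall>k. \<exists>d\<in>D. \<exists>x\<in>E. c k = d \<otimes> x) \<and>
        (\<forall>f\<in>h ` F \<union> F0. measure torus (defect G X c f) < e0) \<and> (\<forall>s\<in>S. measure torus (defect G X c s) < e')"
    by (rule relative_towersE[OF r hF e0(1)]) auto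
  define E' where "E' = (\<lambda>(x, j). x \<otimes> g [^] int j) ` (E \<times> {..<n})"
  show "\<exists>E. finite E \<and> E \<subseteq> adjoin G H g \<and> (\<forall>S e'. finite S \<and> S \<subseteq> D \<and> e' > 0 \<longrightarrow>
      (\<exists>m X c. tower G m X c \<and> (\<forall>k. \<exists>d\<in>D. \<exists>x\<in>E. c k = d \<otimes> x) \<and>
        (\<forall>f\<in>F. measure torus (defect G X c f) < e) \<and> (\<forall>s\<in>S. measure torus (defect G X c s) < e')))"
  proof (intro exI[of _ E'] conjI allI impI)
    show "finite E'" using E(1) by (simp add: E'_def)
    show "E' \<subseteq> adjoin G H g" using E(2) by (auto simp: E'_def adjoin_def)
    fix S e' assume S: "finite S \<and> S \<subseteq> D \<and> (e'::real) > 0"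
    then have S': "finite S" "S \<subseteq> D" "e' / n > 0" using n by auto
    obtain m X c where t: "tower G m X c" and cE: "\<forall>k. \<exists>d\<in>D. \<exists>x\<in>E. c k = d \<otimes> x"
      and cF: "\<forall>f\<in>h ` F \<union> F0. measure torus (defect G X c f) < e0"
      and cS: "\<forall>s\<in>S. measure torus (defect G X c s) < e' / n"
      using E(3)[OF S'] by (elim exE conjE)
    obtain c' where t': "tower G (Suc m) (X(m := th)) c'"
      and c'k: "\<And>k. \<exists>u j. j < n \<and> c' k = c u \<otimes> g [^] (int j)"
      and c'h: "\<And>h. h \<in> carrier G \<Longrightarrow> th h = 0 \<Longrightarrow>
        measure torus (defect G (X(m := th)) c' h) \<le> n * measure torus (defect G X c h)"
      and c'g: "measure torus (defect G (X(m := th)) c' g) \<le> 1 / n"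
        "measure torus (defect G (X(m := th)) c' g) \<le> measure torus (defect G X c (g [^] int n))"
      by (rule tower_step[OF t g n th(1,3)]) auto
    have dg: "measure torus (defect G (X(m := th)) c' g) \<le> e1"
      using wrap
    proof
      assume "g [^] int n \<in> F0"
      then have "measure torus (defect G X c (g [^] int n)) < e0" using cF by blast
      then show ?thesis using c'g(2) e0(3) by linarith
    qed (use c'g(1) in linarith)
    have dh: "measure torus (defect G (X(m := th)) c' x) \<le> n * measure torus (defect G X c x)" if "x \<in> H" for x
      using c'h[OF Hc[OF that] th(2)[OF that]] .
    have "measure torus (defect G (X(m := th)) c' f) < e" if f: "f \<in> F" for f
    proof -
      have hf: "h f \<in> H" and fa: "f = h f \<otimes> g [^] a f" using h a f by auto
      have "measure torus (defect G (X(m := th)) c' f) \<le>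
          measure torus (defect G (X(m := th)) c' (h f)) + measure torus (defect G (X(m := th)) c' (g [^] a f))"
        using measure_defect_mult[OF t' Hc[OF hf] int_pow_closed[OF g, of "a f"]] fa by simp
      also have "measure torus (defect G (X(m := th)) c' (h f)) \<le> n * measure torus (defect G X c (h f))"
        by (rule dh[OF hf])
      also have "\<dots> \<le> n * e0" using cF f by (intro mult_left_mono) (auto intro: less_imp_le)
      also have "measure torus (defect G (X(m := th)) c' (g [^] a f)) \<le> \<bar>real_of_int (a f)\<bar> * measure torus (defect G (X(m := th)) c' g)"
        by (rule measure_defect_pow[OF t' g])
      also have "\<dots> \<le> real_of_int K * e1"
      proof (rule mult_mono)
        show "\<bar>real_of_int (a f)\<bar> \<le> real_of_int K" using K[OF f] by linarith
      qed (use dg K0 in auto)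
      finally have "measure torus (defect G (X(m := th)) c' f) \<le> (real_of_int K + 1) * e1"
        using e0(2) by (simp add: algebra_simps)
      then show ?thesis using Ke1 F by simp
    qed
    moreover have "measure torus (defect G (X(m := th)) c' s) < e'" if s: "s \<in> S" for s
    proof -
      have "s \<in> H" using S D s by auto
      then have "measure torus (defect G (X(m := th)) c' s) \<le> n * measure torus (defect G X c s)" by (rule dh)
      also have "\<dots> < n * (e' / n)" using cS s n by (intro mult_strict_left_mono) auto
      finally show ?thesis using n by simp
    qed
    moreover have "\<exists>d\<in>D. \<exists>x\<in>E'. c' k = d \<otimes> x" for k
    proof -
      obtain u j where uj: "j < n" "c' k = c u \<otimes> g [^] (int j)" using c'k[of k] by auto
      obtain d x where dx: "d \<in> D" "x \<in> E" "c u = d \<otimes> x" using cE by blast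
      have "c' k = d \<otimes> (x \<otimes> g [^] (int j))"
        using uj dx D E(2) Hc g by (simp add: m_assoc subset_iff)
      moreover have "x \<otimes> g [^] (int j) \<in> E'" using dx uj by (auto simp: E'_def)
      ultimately show ?thesis using dx(1) by blast
    qed
    ultimately show "\<exists>m X c. tower G m X c \<and> (\<forall>k. \<exists>d\<in>D. \<exists>x\<in>E'. c k = d \<otimes> x) \<and>
        (\<forall>f\<in>F. measure torus (defect G X c f) < e) \<and> (\<forall>s\<in>S. measure torus (defect G X c s) < e')"
      using t' by (intro exI[of _ "Suc m"] exI[of _ "X(m := th)"] exI[of _ c']) simp
  qed
qed

text \<open>The upper bound by the generated subgroup allows \<open>H'\<close> to be identified with
  it when the reverse inclusion is at hand.\<close>

lemma relative_towers_extend: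
  assumes count: "countable (carrier G)" and S: "finite S" "S \<subseteq> carrier G"
    and D: "D \<subseteq> H" and H: "subgroup H G" and r: "relative_towers G D H"
  shows "\<exists>H'. subgroup H' G \<and> H \<subseteq> H' \<and> S \<subseteq> H' \<and> H' \<subseteq> generate G (H \<union> S) \<and> relative_towers G D H'"
  using S
proof (induction S)
  case empty
  show ?case using H r by (intro exI[of _ H]) (auto intro: generate.incl)
next
  case (insert g S)
  then obtain H' where H': "subgroup H' G" "H \<subseteq> H'" "S \<subseteq> H'" "H' \<subseteq> generate G (H \<union> S)" "relative_towers G D H'"
    by auto
  have g: "g \<in> carrier G" using insert by auto
  have sub: "H \<union> insert g S \<subseteq> carrier G" using insert.prems subgroup.subset[OF H] by auto
  note gen = generate_is_subgroup[OF sub]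
  have "adjoin G H' g \<subseteq> generate G (H \<union> insert g S)"
  proof
    fix x assume "x \<in> adjoin G H' g"
    then obtain h k where x: "x = h \<otimes> g [^] (k::int)" "h \<in> H'" by (auto simp: adjoin_def)
    have "h \<in> generate G (H \<union> insert g S)"
      using H'(4) x(2) mono_generate[of "H \<union> S" "H \<union> insert g S"] by auto
    moreover have "g [^] k \<in> generate G (H \<union> insert g S)"
      by (rule subgroup_int_pow_closed[OF gen]) (auto intro: generate.incl)
    ultimately show "x \<in> generate G (H \<union> insert g S)" using x(1) subgroup.m_closed[OF gen] by simp
  qed
  moreover have "relative_towers G D (adjoin G H' g)"
    using D H' by (intro relative_towers_adjoin[OF count _ H'(1) H'(5) g]) auto
  ultimately show ?case
    using subgroup_adjoin[OF H'(1) g] H' by (intro exI[of _ "adjoin G H' g"]) auto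
qed

text \<open>The first form serves a finite \<Delta>. The second is the starting point for adjoining
  the elements of \<open>F\<close> to an infinite \<Delta>, keeping the values in finitely many
  cosets of \<Delta>.\<close>

lemma relative_towers_fg:
  assumes count: "countable (carrier G)" and S: "finite S" "S \<subseteq> carrier G"
  shows "relative_towers G {\<one>} (generate G S)" "relative_towers G (generate G S) (generate G S)"
proof -
  have one: "subgroup {\<one>} G" by (rule triv_subgroup)
  obtain H' where H': "subgroup H' G" "S \<subseteq> H'" "H' \<subseteq> generate G ({\<one>} \<union> S)" "relative_towers G {\<one>} H'"
    using relative_towers_extend[OF count S subset_refl one relative_towers_trivial] by blast
  have "generate G ({\<one>} \<union> S) \<subseteq> generate G S"
    by (rule generate_subgroup_incl[OF _ generate_is_subgroup[OF S(2)]]) (auto intro: generate.incl generate.one)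
  moreover have "generate G S \<subseteq> H'" by (rule generate_subgroup_incl[OF H'(2,1)])
  ultimately have "H' = generate G S" using H'(3) by auto
  then show 1: "relative_towers G {\<one>} (generate G S)" using H'(4) by simp
  show "relative_towers G (generate G S) (generate G S)"
    by (rule relative_towers_refl[OF generate_is_subgroup[OF S(2)] 1])
qed

end

subsection \<open>Rotations with dense multiples\<close>

text \<open>
  Round each coordinate to a fraction with its own large prime denominator; the multiples of such a
  point fill a fine grid by the Chinese remainder theorem.
\<close>

lemma dense_multiples:
  fixes x :: "nat \<Rightarrow> real"
  assumes eta: "\<eta> > 0"
  obtains v where "\<And>i. i < m \<Longrightarrow> \<bar>v i\<bar> < \<eta>"
    "\<And>t. \<exists>n::nat. \<forall>i<m. \<exists>j::int. \<bar>real n * (x i + v i) - t i - of_int j\<bar> < \<eta>"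
proof -
  \<comment> \<open>Denominators above 1/\<eta> make the mesh of the grid finer than \<eta>.\<close>
  obtain B :: nat where B: "1 / \<eta> < B" using reals_Archimedean2 by blast
  let ?P = "{p::nat. prime p \<and> p > B}"
  have "infinite ?P"
    unfolding infinite_nat_iff_unbounded
  proof
    fix N
    obtain p where "prime p" "max N B < p" using bigger_prime by blast
    then show "\<exists>n>N. n \<in> ?P" by auto
  qed
  then have inj: "inj (enumerate ?P)" and inP: "\<And>i. enumerate ?P i \<in> ?P"
    using strict_mono_enumerate[of ?P] enumerate_in_set[of ?P] by (auto simp: strict_mono_imp_inj_on)
  define q where "q = enumerate ?P"
  have q: "prime (q i)" "q i > B" for i using inP[of i] by (simp_all add: q_def)
  have q0: "real (q i) > 0" for i using q(2)[of i] by simp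
  have q1: "1 / real (q i) < \<eta>" for i
  proof -
    have "1 / \<eta> < real (q i)" using B q(2)[of i] by linarith
    then show ?thesis using eta q0[of i] by (simp add: field_simps)
  qed
  \<comment> \<open>If the prime divides the rounded numerator, the next integer is taken. The
    fraction is then in lowest terms, and the numerator is still within 1 of q x.\<close>
  define p where "p i = (if int (q i) dvd \<lfloor>q i * x i\<rfloor> then \<lfloor>q i * x i\<rfloor> + 1 else \<lfloor>q i * x i\<rfloor>)" for i
  have ndvd: "\<not> int (q i) dvd p i" for i
  proof
    assume d: "int (q i) dvd p i"
    then have "int (q i) dvd \<lfloor>q i * x i\<rfloor>" "p i = \<lfloor>q i * x i\<rfloor> + 1"
      by (auto simp: p_def split: if_splits)
    then have "int (q i) dvd 1" using d by (metis dvd_add_right_iff)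
    then show False using q(1)[of i] by (simp add: prime_gt_1_nat)
  qed
  have pq: "\<bar>of_int (p i) - q i * x i\<bar> \<le> 1" for i unfolding p_def by (auto simp: abs_le_iff) linarith+
  define v where "v i = of_int (p i) / q i - x i" for i
  have grid: "\<bar>of_int a / q i - t\<bar> < \<eta>" if "\<bar>of_int a - q i * t\<bar> \<le> 1" for a :: int and i and t :: real
  proof -
    have "\<bar>of_int a / q i - t\<bar> = \<bar>of_int a - q i * t\<bar> / q i"
      using q0[of i] by (simp add: field_simps flip: abs_divide) (simp add: abs_divide)
    also have "\<dots> \<le> 1 / q i" using that q0[of i] by (intro divide_right_mono) auto
    finally show ?thesis using q1[of i] by linarith
  qed
  show ?thesis
  proof (rule that)
    show "\<bar>v i\<bar> < \<eta>" if "i < m" for i unfolding v_def by (rule grid[OF pq])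
    fix t :: "nat \<Rightarrow> real"
    define a where "a i = \<lfloor>q i * t i\<rfloor>" for i
    have "\<exists>b. [p i * b = 1] (mod int (q i))" for i
    proof (rule cong_solve_coprime_int)
      have "coprime (int (q i)) (p i)" using q(1)[of i] ndvd[of i] by (simp add: prime_imp_coprime)
      then show "coprime (p i) (int (q i))" by (simp add: coprime_commute)
    qed
    then obtain b where b: "\<And>i. [p i * b i = 1] (mod int (q i))" by metis
    \<comment> \<open>Since \<open>b i\<close> inverts \<open>p i\<close> modulo \<open>q i\<close>,
      this congruence gives n p = a modulo q in each coordinate. Thus the n-th multiple is a / q
      modulo integers, where a / q is the grid point next to the target.\<close>
    have "\<exists>n. \<forall>i\<in>{..<m}. [n = nat ((a i * b i) mod int (q i))] (mod q i)"
    proof (rule chinese_remainder_nat)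
      show "\<forall>i\<in>{..<m}. \<forall>j\<in>{..<m}. i \<noteq> j \<longrightarrow> coprime (q i) (q j)"
        using q(1) inj by (auto simp: q_def inj_eq intro!: primes_coprime)
    qed simp
    then obtain n where n: "\<And>i. i < m \<Longrightarrow> [n = nat ((a i * b i) mod int (q i))] (mod q i)" by auto
    have "\<exists>j::int. \<bar>real n * (x i + v i) - t i - of_int j\<bar> < \<eta>" if i: "i < m" for i
    proof -
      have "[int n = a i * b i] (mod int (q i))"
      proof -
        have "[int n = int (nat ((a i * b i) mod int (q i)))] (mod int (q i))" using n[OF i] by (simp only: cong_int_iff)
        moreover have "int (nat ((a i * b i) mod int (q i))) = (a i * b i) mod int (q i)" using q0[of i] by simp
        ultimately show ?thesis by (simp add: cong_def)
      qed
      then have "[int n * p i = a i * b i * p i] (mod int (q i))" by (rule cong_scalar_right)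
      moreover have "[a i * (p i * b i) = a i * 1] (mod int (q i))" by (rule cong_scalar_left[OF b])
      ultimately have "[int n * p i = a i] (mod int (q i))" by (simp add: mult_ac) (erule cong_trans, assumption)
      then obtain j where j: "int n * p i - a i = int (q i) * j" by (auto simp: cong_iff_dvd_diff elim: dvdE)
      have "real n * (x i + v i) = real_of_int (int n * p i) / q i" by (simp add: v_def)
      also have "\<dots> = (of_int (a i) + q i * of_int j) / q i"
        using arg_cong[OF j, of real_of_int] by (simp add: algebra_simps)
      also have "\<dots> = of_int (a i) / q i + of_int j" using q0[of i] by (simp add: add_divide_distrib)
      finally have "real n * (x i + v i) - t i - of_int j = of_int (a i) / q i - t i" by simp
      moreover have "\<bar>of_int (a i) / q i - t i\<bar> < \<eta>"
        by (rule grid) (unfold a_def, linarith)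
      ultimately have "\<bar>real n * (x i + v i) - t i - of_int j\<bar> < \<eta>" by (simp only:)
      then show ?thesis by blast
    qed
    then show "\<exists>n::nat. \<forall>i<m. \<exists>j::int. \<bar>real n * (x i + v i) - t i - of_int j\<bar> < \<eta>" by blast
  qed
qed

subsection \<open>Absorption of the infinite torus\<close>

text \<open>The binary digit of index \<open>k\<close> after the point, counted from 0. The formula
  has period 1 in \<open>x\<close>, so it reads the fractional part of any real.\<close>

definition digit :: "nat \<Rightarrow> real \<Rightarrow> bool" where
  "digit k x \<longleftrightarrow> odd \<lfloor>2 ^ Suc k * x\<rfloor>"

definition binary_value :: "(nat \<Rightarrow> bool) \<Rightarrow> real" where
  "binary_value w = (\<Sum>k. of_bool (w k) / 2 ^ Suc k)"

lemma measurable_digit [measurable]: "digit k \<in> measurable borel (count_space UNIV)"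
  unfolding digit_def by measurable

lemma digit_frac: "digit k (frac x) = digit k x"
proof -
  have "2 ^ Suc k * frac x = 2 ^ Suc k * x - of_int (2 ^ Suc k * \<lfloor>x\<rfloor>)"
    by (simp add: frac_def algebra_simps)
  then have "\<lfloor>2 ^ Suc k * frac x\<rfloor> = \<lfloor>2 ^ Suc k * x\<rfloor> - 2 ^ Suc k * \<lfloor>x\<rfloor>"
    by (simp only: floor_diff_of_int)
  then show ?thesis by (simp add: digit_def)
qed

lemma digit_Suc: "digit (Suc k) x = digit k (frac (2 * x))"
  unfolding digit_frac by (simp add: digit_def mult.assoc mult.left_commute)

section \<open>The law of the binary digits of a uniform point\<close>

lemma emeasure_lborel_double:
  assumes "A \<in> sets borel"
  shows "emeasure lborel A = 2 * emeasure lborel {x::real. c + 2 * x \<in> A}"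
proof -
  have "emeasure lborel A = emeasure (density (distr lborel borel (\<lambda>x. c + 2 * x)) (\<lambda>_. ennreal \<bar>2\<bar>)) A"
    by (subst lborel_real_affine[of 2 c]) simp_all
  also have "\<dots> = 2 * emeasure (distr lborel borel (\<lambda>x. c + 2 * x)) A"
    using assms by (subst emeasure_density) (simp_all add: nn_integral_cmult_indicator)
  also have "emeasure (distr lborel borel (\<lambda>x. c + 2 * x)) A = emeasure lborel {x. c + 2 * x \<in> A}"
    using assms by (subst emeasure_distr) (auto simp: vimage_def)
  finally show ?thesis .
qed

text \<open>On the half of [0,1) whose first digit is \<open>b\<close>, the doubling map is affine
  with slope 2 onto [0,1), so it halves measures under preimages.\<close>

lemma measure_unif_double:
  assumes A: "A \<in> sets borel"
  shows "measure unif {x. digit 0 x = b \<and> frac (2 * x) \<in> A} = measure unif A / 2"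
proof -
  interpret U: prob_space unif by (rule prob_space_unif)
  let ?S = "{x. digit 0 x = b \<and> frac (2 * x) \<in> A}" and ?c = "- of_bool b :: real"
  have S: "?S \<in> sets borel" using A by measurable
  have "{0..<1} \<inter> ?S = {x. ?c + 2 * x \<in> {0..<1} \<inter> A}"
  proof (rule Set.set_eqI)
    fix x :: real
    show "x \<in> {0..<1} \<inter> ?S \<longleftrightarrow> x \<in> {x. ?c + 2 * x \<in> {0..<1} \<inter> A}"
    proof (cases "0 \<le> x \<and> x < 1")
      case True
      then consider "\<lfloor>2 * x\<rfloor> = 0" "x < 1 / 2" | "\<lfloor>2 * x\<rfloor> = 1" "x \<ge> 1 / 2" by linarith
      then show ?thesis using True by cases (auto simp: digit_def frac_def)
    next
      case False then show ?thesis by (cases b) auto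
    qed
  qed
  then have "emeasure unif ?S = emeasure lborel {x. ?c + 2 * x \<in> {0..<1} \<inter> A}"
    using emeasure_unif[OF S] by simp
  moreover have "emeasure lborel ({0..<1} \<inter> A) = 2 * emeasure lborel {x. ?c + 2 * x \<in> {0..<1} \<inter> A}"
    using A by (intro emeasure_lborel_double) auto
  ultimately have "emeasure unif A = 2 * emeasure unif ?S" using emeasure_unif[OF A] by simp
  then have "measure unif A = 2 * measure unif ?S" by (simp add: measure_def enn2real_mult)
  then show ?thesis by simp
qed

text \<open>The fair coin, obtained as the law of the first binary digit.\<close>

definition coin :: "bool measure" where
  "coin = distr unif (count_space UNIV) (digit 0)"

lemma sets_coin [simp, measurable_cong]: "sets coin = UNIV" and space_coin [simp]: "space coin = UNIV"
  by (simp_all add: coin_def)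

lemma digit_measurable_unif: "digit k \<in> measurable unif (count_space UNIV)"
  by (subst measurable_cong_sets[OF sets_unif refl]) (rule measurable_digit)

lemma prob_space_coin: "prob_space coin"
  unfolding coin_def by (rule prob_space.prob_space_distr[OF prob_space_unif digit_measurable_unif])

lemma measure_unif_digit0:
  assumes A: "A \<in> sets borel"
  shows "measure unif {x. digit 0 x \<in> S \<and> frac (2 * x) \<in> A} = measure coin S * measure unif A"
proof -
  interpret U: prob_space unif by (rule prob_space_unif)
  have *: "measure unif {x. digit 0 x \<in> S \<and> frac (2 * x) \<in> B} = card S * measure unif B / 2"
    if B: "B \<in> sets borel" for B
  proof -
    have "{x. digit 0 x \<in> S \<and> frac (2 * x) \<in> B} = (\<Union>b\<in>S. {x. digit 0 x = b \<and> frac (2 * x) \<in> B})" by auto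
    also have "measure unif \<dots> = (\<Sum>b\<in>S. measure unif {x. digit 0 x = b \<and> frac (2 * x) \<in> B})"
      using B by (intro U.finite_measure_finite_Union) (auto simp: disjoint_family_on_def)
    finally show ?thesis by (simp add: measure_unif_double[OF B])
  qed
  have "measure coin S = measure unif {x. digit 0 x \<in> S \<and> frac (2 * x) \<in> UNIV}"
    unfolding coin_def by (subst measure_distr[OF digit_measurable_unif]) (auto simp: vimage_def)
  also have "\<dots> = card S / 2" using *[of UNIV] U.prob_space by simp
  finally have c: "measure coin S = card S / 2" .
  show ?thesis unfolding c *[OF A] by simp
qed

text \<open>Induction along the doubling map: the later digits of x are the digits of
  \<open>frac (2 * x)\<close>, which is uniform and independent of the first digit.\<close>

lemma measure_unif_digits:
  "measure unif {x. \<forall>j<n. digit j x \<in> F j} = (\<Prod>j<n. measure coin (F j))"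
proof (induction n arbitrary: F)
  case 0
  interpret U: prob_space unif by (rule prob_space_unif)
  show ?case using U.prob_space by simp
next
  case (Suc n)
  let ?A = "{x. \<forall>j<n. digit j x \<in> F (Suc j)}"
  have A: "?A \<in> sets borel" by measurable
  have "{x. \<forall>j<Suc n. digit j x \<in> F j} = {x. digit 0 x \<in> F 0 \<and> frac (2 * x) \<in> ?A}"
    by (auto simp: digit_Suc less_Suc_eq_0_disj)
  then show ?case
    using measure_unif_digit0[OF A, of "F 0"] Suc[of "\<lambda>j. F (Suc j)"]
    by (simp only: prod.lessThan_Suc_shift)
qed

lemma distr_digits:
  "distr unif (PiM UNIV (\<lambda>_::nat. coin)) (\<lambda>x k. digit k x) = PiM UNIV (\<lambda>_. coin)"
proof -
  interpret U: prob_space unif by (rule prob_space_unif)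
  interpret C: prob_space coin by (rule prob_space_coin)
  interpret product_prob_space "\<lambda>_::nat. coin" UNIV
    by (rule product_prob_spaceI) (rule prob_space_coin)
  have m: "(\<lambda>x k. digit k x) \<in> measurable unif (PiM UNIV (\<lambda>_::nat. coin))"
  proof (rule measurable_PiM_single')
    have "sets coin = sets (count_space UNIV)" by simp
    then show "digit i \<in> measurable unif coin" for i
      using digit_measurable_unif[of i] measurable_cong_sets[OF refl, of coin "count_space UNIV" unif] by simp
  qed simp
  show ?thesis
  proof (rule PiM_eq)
    fix J :: "nat set" and F assume J: "finite J" "J \<subseteq> UNIV" "\<And>j. j \<in> J \<Longrightarrow> F j \<in> sets coin"
    let ?X = "prod_emb UNIV (\<lambda>_. coin) J (Pi\<^sub>E J F)"
    obtain n where n: "\<forall>j\<in>J. j < n" using finite_nat_set_iff_bounded J(1) by auto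
    \<comment> \<open>Padding with \<open>UNIV\<close> turns a condition on finitely many digits
      into one on an initial segment, without changing the product of the measures.\<close>
    define F' where "F' j = (if j \<in> J then F j else UNIV)" for j
    have "emeasure (distr unif (PiM UNIV (\<lambda>_. coin)) (\<lambda>x k. digit k x)) ?X =
        emeasure unif ((\<lambda>x k. digit k x) -` ?X \<inter> space unif)"
      using J by (intro emeasure_distr[OF m] sets_PiM_I) auto
    also have "(\<lambda>x k. digit k x) -` ?X \<inter> space unif = {x. \<forall>j<n. digit j x \<in> F' j}"
      using n by (auto simp: prod_emb_def F'_def PiE_iff)
    also have "emeasure unif \<dots> = (\<Prod>j<n. measure coin (F' j))"
      by (simp add: U.emeasure_eq_measure measure_unif_digits)
    also have "(\<Prod>j<n. measure coin (F' j)) = (\<Prod>j\<in>J. measure coin (F j))"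
    proof (rule prod.mono_neutral_cong_right)
      show "J \<subseteq> {..<n}" using n by auto
      show "\<forall>i\<in>{..<n} - J. measure coin (F' i) = 1" using C.prob_space by (simp add: F'_def)
    qed (auto simp: F'_def)
    also have "ennreal (\<Prod>j\<in>J. measure coin (F j)) = (\<Prod>j\<in>J. emeasure coin (F j))"
      by (simp add: C.emeasure_eq_measure prod_ennreal)
    finally show "emeasure (distr unif (PiM UNIV (\<lambda>_. coin)) (\<lambda>x k. digit k x)) ?X = (\<Prod>j\<in>J. emeasure coin (F j))" .
  qed simp
qed

lemma binary_summable: "summable (\<lambda>k. of_bool (w k) / 2 ^ Suc k :: real)"
proof (rule summable_comparison_test)
  show "\<exists>N. \<forall>n\<ge>N. norm (of_bool (w n) / 2 ^ Suc n :: real) \<le> (1/2) ^ Suc n"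
    by (auto simp: power_divide)
  show "summable (\<lambda>n. (1/2) ^ Suc n :: real)" by (subst summable_Suc_iff) (simp add: summable_geometric)
qed

lemma binary_near:
  assumes "\<And>k. k < n \<Longrightarrow> w k = w' k"
  shows "\<bar>binary_value w - binary_value w'\<bar> \<le> 1 / 2 ^ n"
proof -
  let ?f = "\<lambda>w k. of_bool (w k) / 2 ^ Suc k :: real"
  have split: "binary_value w = (\<Sum>k. ?f w (k + n)) + (\<Sum>k<n. ?f w k)" for w
    unfolding binary_value_def by (rule suminf_split_initial_segment[OF binary_summable])
  have geo: "(\<lambda>k. (1 / 2 ^ n) * (1/2) ^ Suc k) sums ((1 / 2 ^ n) * (1::real))"
    by (intro sums_mult) (use power_half_series in simp)
  have le: "0 \<le> (\<Sum>k. ?f w (k + n)) \<and> (\<Sum>k. ?f w (k + n)) \<le> 1 / 2 ^ n" for w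
  proof
    have s: "summable (\<lambda>k. ?f w (k + n))" using binary_summable by (rule summable_ignore_initial_segment)
    show "0 \<le> (\<Sum>k. ?f w (k + n))" by (rule suminf_nonneg[OF s]) simp
    have "(\<Sum>k. ?f w (k + n)) \<le> (\<Sum>k. (1 / 2 ^ n) * (1/2) ^ Suc k)"
      by (rule suminf_le[OF _ s sums_summable[OF geo]]) (simp add: power_divide power_add mult_ac)
    then show "(\<Sum>k. ?f w (k + n)) \<le> 1 / 2 ^ n" using sums_unique[OF geo] by simp
  qed
  have "(\<Sum>k<n. ?f w k) = (\<Sum>k<n. ?f w' k)" using assms by (intro sum.cong) auto
  then show ?thesis using split[of w] split[of w'] le[of w] le[of w'] by (simp add: abs_le_iff)
qed

text \<open>With y = frac x, the first n digits sum up to floor(2^n y) / 2^n, which is within 2^-n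
  of y. The identity holds at every point, since digits read off by floors never end in repeating
  ones.\<close>

lemma binary_digits: "binary_value (\<lambda>k. digit k x) = frac x"
proof -
  define y where "y = frac x"
  have y: "0 \<le> y" "y < 1" by (simp_all add: y_def frac_lt_1)
  have part: "(\<Sum>k<n. of_bool (digit k x) / 2 ^ Suc k) = of_int \<lfloor>2 ^ n * y\<rfloor> / (2 ^ n :: real)" for n
  proof (induction n)
    case 0
    have "\<lfloor>y\<rfloor> = 0" using y by linarith
    then show ?case by simp
  next
    case (Suc n)
    define z where "z = 2 ^ n * y"
    have d: "digit n x = odd \<lfloor>2 * z\<rfloor>" using digit_frac[of n x] by (simp add: digit_def y_def z_def mult.assoc)
    have "\<lfloor>2 * z\<rfloor> = 2 * \<lfloor>z\<rfloor> \<or> \<lfloor>2 * z\<rfloor> = 2 * \<lfloor>z\<rfloor> + 1" by linarith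
    then have "\<lfloor>2 * z\<rfloor> = 2 * \<lfloor>z\<rfloor> + of_bool (odd \<lfloor>2 * z\<rfloor>)" by auto
    then have "real_of_int \<lfloor>2 * z\<rfloor> = 2 * real_of_int \<lfloor>z\<rfloor> + of_bool (digit n x)"
      unfolding d by (metis of_int_add of_int_mult of_int_numeral of_int_of_bool)
    then have "of_int \<lfloor>2 ^ Suc n * y\<rfloor> / (2 ^ Suc n :: real) = of_int \<lfloor>2 ^ n * y\<rfloor> / 2 ^ n + of_bool (digit n x) / 2 ^ Suc n"
      by (simp add: z_def mult.assoc add_divide_distrib)
    then show ?case using Suc by simp
  qed
  have near: "\<bar>binary_value (\<lambda>k. digit k x) - y\<bar> \<le> 2 * (1/2) ^ n" for n
  proof -
    have "binary_value (\<lambda>k. digit k x \<and> k < n) = (\<Sum>k<n. of_bool (digit k x) / 2 ^ Suc k)"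
      unfolding binary_value_def by (subst suminf_finite[of "{..<n}"]) auto
    then have 1: "binary_value (\<lambda>k. digit k x \<and> k < n) = of_int \<lfloor>2 ^ n * y\<rfloor> / 2 ^ n" by (simp only: part)
    have "\<bar>binary_value (\<lambda>k. digit k x) - binary_value (\<lambda>k. digit k x \<and> k < n)\<bar> \<le> 1 / 2 ^ n"
      by (rule binary_near) simp
    moreover have "\<bar>of_int \<lfloor>2 ^ n * y\<rfloor> / 2 ^ n - y\<bar> \<le> 1 / 2 ^ n"
    proof -
      have "of_int \<lfloor>2 ^ n * y\<rfloor> / 2 ^ n - y = (of_int \<lfloor>2 ^ n * y\<rfloor> - 2 ^ n * y) / 2 ^ n"
        by (simp add: diff_divide_distrib)
      moreover have "\<bar>of_int \<lfloor>2 ^ n * y\<rfloor> - 2 ^ n * y\<bar> \<le> 1" by linarith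
      ultimately show ?thesis by (simp add: divide_right_mono)
    qed
    ultimately show ?thesis using 1 by (simp add: power_divide)
  qed
  have "\<bar>binary_value (\<lambda>k. digit k x) - y\<bar> \<le> 0"
  proof (rule LIMSEQ_le_const)
    show "(\<lambda>n. 2 * (1/2) ^ n) \<longlonglongrightarrow> (0::real)"
      by (rule tendsto_mult_right_zero, rule LIMSEQ_power_zero) simp
  qed (use near in auto)
  then show ?thesis by (simp add: y_def)
qed

lemma measurable_binary [measurable]:
  assumes "\<And>k. Measurable.pred N (\<lambda>x. w x k)"
  shows "(\<lambda>x. binary_value (w x)) \<in> borel_measurable N"
proof -
  note [measurable] = assms
  show ?thesis unfolding binary_value_def by measurable
qed

text \<open>A left inverse suffices: if g (f x) = x, then y = f x satisfies f (g y) = y, and these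
  points have full measure because \<open>N\<close> is the image of \<open>M\<close>.\<close>

lemma mp_iso_left_inverse:
  assumes f: "f \<in> measurable M N" and d: "distr M N f = N" and g: "g \<in> measurable N M"
    and gf: "AE x in M. g (f x) = x" and fg: "{y \<in> space N. f (g y) = y} \<in> sets N"
  shows "mp_iso M N f" "mp_iso N M g"
proof -
  have gfm: "(\<lambda>x. g (f x)) \<in> measurable M M" by (rule measurable_compose[OF f g])
  have "distr N M g = distr (distr M N f) M g" by (simp add: d)
  also have "\<dots> = distr M M (\<lambda>x. g (f x))" using distr_distr[OF g f] by (simp add: comp_def)
  also have "\<dots> = M"
  proof (rule measure_eqI)
    fix A assume "A \<in> sets (distr M M (\<lambda>x. g (f x)))"
    then have A: "A \<in> sets M" by simp
    have "emeasure (distr M M (\<lambda>x. g (f x))) A = emeasure M ((\<lambda>x. g (f x)) -` A \<inter> space M)"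
      by (rule emeasure_distr[OF gfm A])
    also have "\<dots> = emeasure M A"
    proof (rule emeasure_eq_AE)
      show "AE x in M. x \<in> (\<lambda>x. g (f x)) -` A \<inter> space M \<longleftrightarrow> x \<in> A"
        using gf AE_space by eventually_elim (use sets.sets_into_space[OF A] in auto)
      show "(\<lambda>x. g (f x)) -` A \<inter> space M \<in> sets M" by (rule measurable_sets[OF gfm A])
    qed (rule A)
    finally show "emeasure (distr M M (\<lambda>x. g (f x))) A = emeasure M A" .
  qed simp
  finally have dg: "distr N M g = M" .
  have "AE y in distr M N f. f (g y) = y"
    unfolding AE_distr_iff[OF f fg] using gf by eventually_elim simp
  then have fg': "AE y in N. f (g y) = y" by (simp only: d)
  note m = mp_map_measurable_imp[OF f d] mp_map_measurable_imp[OF g dg]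
  show "mp_iso M N f" by (rule mp_isoI[OF m gf fg'])
  show "mp_iso N M g" by (rule mp_isoI[OF m(2,1) fg' gf])
qed

section \<open>Shuffling digits between one number and a sequence of numbers\<close>

abbreviation coins :: "(nat \<Rightarrow> bool) measure" where
  "coins \<equiv> PiM UNIV (\<lambda>_. coin)"

lemma sets_coin_eq: "sets coin = sets (count_space UNIV)"
  by simp

lemma measurable_digit_coin: "digit k \<in> measurable unif coin"
  unfolding measurable_cong_sets[OF refl sets_coin_eq] by (rule digit_measurable_unif)

lemma measurable_coins_component: "Measurable.pred coins (\<lambda>w. w k)"
proof -
  have "(\<lambda>w. w k) \<in> measurable coins coin" by (rule measurable_component_singleton) simp
  then show ?thesis unfolding measurable_cong_sets[OF refl sets_coin_eq] .
qed

lemma measurable_binary_coins: "binary_value \<in> measurable coins unif"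
  unfolding measurable_cong_sets[OF refl sets_unif] by (rule measurable_binary) (rule measurable_coins_component)

lemma measurable_digits: "(\<lambda>x j. digit (h j) x) \<in> measurable unif coins"
  by (rule measurable_PiM_single') (simp_all add: measurable_digit_coin)

lemma distr_digits_reindex:
  assumes h: "inj h"
  shows "distr unif coins (\<lambda>x j. digit (h j) x) = coins"
proof -
  have m: "(\<lambda>w n. w (h n)) \<in> measurable coins coins"
    by (rule measurable_PiM_single') (auto intro: measurable_component_singleton)
  have "coins = distr coins coins (\<lambda>w n. w (h n))"
    using distr_PiM_reindex[of UNIV "\<lambda>_. coin" h UNIV] h by (simp add: prob_space_coin restrict_UNIV)
  also have "\<dots> = distr (distr unif coins (\<lambda>x k. digit k x)) coins (\<lambda>w n. w (h n))"
    by (simp only: distr_digits)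
  also have "\<dots> = distr unif coins (\<lambda>x j. digit (h j) x)"
    by (subst distr_distr[OF m measurable_digits[of "\<lambda>k. k"]]) (simp add: comp_def)
  finally show ?thesis by simp
qed

lemma distr_binary: "distr coins unif binary_value = unif"
proof -
  have "distr coins unif binary_value = distr (distr unif coins (\<lambda>x k. digit k x)) unif binary_value"
    by (simp only: distr_digits)
  also have "\<dots> = distr unif unif (\<lambda>x. binary_value (\<lambda>k. digit k x))"
    by (subst distr_distr[OF measurable_binary_coins measurable_digits[of "\<lambda>k. k"]]) (simp add: comp_def)
  also have "\<dots> = unif" using distr_unif_rotation[of 0] by (simp add: binary_digits)
  finally show ?thesis .
qed

lemma measurable_binary_digits: "(\<lambda>x. binary_value (\<lambda>j. digit (h j) x)) \<in> measurable unif unif"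
  using measurable_compose[OF measurable_digits measurable_binary_coins] .

lemma distr_binary_digits:
  assumes h: "inj h"
  shows "distr unif unif (\<lambda>x. binary_value (\<lambda>j. digit (h j) x)) = unif"
proof -
  have "distr unif unif (\<lambda>x. binary_value (\<lambda>j. digit (h j) x)) = distr (distr unif coins (\<lambda>x j. digit (h j) x)) unif binary_value"
    by (subst distr_distr[OF measurable_binary_coins measurable_digits]) (simp add: comp_def)
  then show ?thesis by (simp only: distr_digits_reindex[OF h] distr_binary)
qed

text \<open>A sequence ending in repeating ones is not recovered from its binary value. Digit
  sequences of real numbers are always recovered, and their law is that of the coins, so the
  exceptional sequences form a null set.\<close>

lemma AE_digit_binary:
  assumes h: "inj h"
  shows "AE x in unif. \<forall>j. digit j (binary_value (\<lambda>j. digit (h j) x)) = digit (h j) x"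
proof -
  have "{w \<in> space coins. \<forall>j. digit j (binary_value w) = w j} \<in> sets coins"
  proof -
    have [measurable]: "Measurable.pred coins (\<lambda>w. digit j (binary_value w))" for j
      using measurable_compose[OF measurable_binary_coins digit_measurable_unif] .
    note [measurable] = measurable_coins_component
    show ?thesis by measurable
  qed
  then have "AE w in distr unif coins (\<lambda>x k. digit k x). \<forall>j. digit j (binary_value w) = w j"
    by (subst AE_distr_iff[OF measurable_digits[of "\<lambda>k. k"]]) (auto simp: binary_digits digit_frac)
  then have "AE w in distr unif coins (\<lambda>x j. digit (h j) x). \<forall>j. digit j (binary_value w) = w j"
    by (simp only: distr_digits distr_digits_reindex[OF h])
  then show ?thesis by (rule AE_distrD[OF measurable_digits])
qed

lemma indep_digits: "prob_space.indep_vars unif (\<lambda>_. coin) digit UNIV"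
proof -
  interpret U: prob_space unif by (rule prob_space_unif)
  have "distr unif coin (digit i) = coin" for i
  proof -
    have m: "(\<lambda>w. w i) \<in> measurable coins coin" by (rule measurable_component_singleton) simp
    have "coin = distr coins coin (\<lambda>w. w i)"
      by (rule distr_PiM_component[symmetric]) (simp_all add: prob_space_coin)
    also have "\<dots> = distr (distr unif coins (\<lambda>x k. digit k x)) coin (\<lambda>w. w i)" by (simp only: distr_digits)
    also have "\<dots> = distr unif coin (digit i)"
      by (subst distr_distr[OF m measurable_digits[of "\<lambda>k. k"]]) (simp add: comp_def)
    finally show ?thesis by simp
  qed
  then show ?thesis
    by (subst U.indep_vars_iff_distr_eq_PiM) (simp_all add: measurable_digit_coin distr_digits restrict_UNIV)
qed

lemma inj_Pair1: "inj h \<Longrightarrow> inj (\<lambda>j. h (i, j))"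
  by (rule injI) (drule injD, assumption, simp)

text \<open>The injection deals out the digits of one number to infinitely many numbers. The blocks
  are disjoint, hence independent, and each block reassembles to a uniform number.\<close>

lemma distr_binary_shuffle:
  fixes h :: "nat \<times> nat \<Rightarrow> nat"
  assumes h: "inj h"
  shows "(\<lambda>x i. binary_value (\<lambda>j. digit (h (i, j)) x)) \<in> measurable unif torus"
    "distr unif torus (\<lambda>x i. binary_value (\<lambda>j. digit (h (i, j)) x)) = torus"
proof -
  interpret U: prob_space unif by (rule prob_space_unif)
  let ?E = "\<lambda>i x. binary_value (\<lambda>j. digit (h (i, j)) x)"
  have hi: "inj (\<lambda>j. h (i, j))" for i using h by (rule inj_Pair1)
  show "(\<lambda>x i. ?E i x) \<in> measurable unif torus"
    unfolding torus_def by (rule measurable_PiM_single') (auto intro: measurable_binary_digits)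
  let ?K = "\<lambda>i. range (\<lambda>j. h (i, j))"
  have "U.indep_vars (\<lambda>i. PiM (?K i) (\<lambda>_. coin)) (\<lambda>i x. restrict (\<lambda>k. digit k x) (?K i)) UNIV"
  proof (rule U.indep_vars_restrict[OF indep_digits])
    show "disjoint_family_on ?K UNIV"
      unfolding disjoint_family_on_def
    proof (intro ballI impI)
      fix i i' :: nat assume "i \<noteq> i'"
      then have "h (i, j) \<noteq> h (i', j')" for j j' using injD[OF h, of "(i, j)" "(i', j')"] by auto
      then show "?K i \<inter> ?K i' = {}" by auto
    qed
  qed simp
  then have "U.indep_vars (\<lambda>_. unif) (\<lambda>i x. binary_value (\<lambda>j. restrict (\<lambda>k. digit k x) (?K i) (h (i, j)))) UNIV"
  proof (rule U.indep_vars_compose2[where Y = "\<lambda>i w. binary_value (\<lambda>j. w (h (i, j)))"])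
    fix i
    have "(\<lambda>w. w (h (i, j))) \<in> measurable (PiM (?K i) (\<lambda>_. coin)) coin" for j
      by (rule measurable_component_singleton) simp
    then show "(\<lambda>w. binary_value (\<lambda>j. w (h (i, j)))) \<in> measurable (PiM (?K i) (\<lambda>_. coin)) unif"
      unfolding measurable_cong_sets[OF refl sets_unif] measurable_cong_sets[OF refl sets_coin_eq]
      by (rule measurable_binary)
  qed
  then have "U.indep_vars (\<lambda>_. unif) ?E UNIV" by simp
  then have "distr unif (PiM UNIV (\<lambda>_. unif)) (\<lambda>x. \<lambda>i\<in>UNIV. ?E i x) = PiM UNIV (\<lambda>i. distr unif unif (?E i))"
    by (subst (asm) U.indep_vars_iff_distr_eq_PiM) (auto intro: measurable_binary_digits)
  then show "distr unif torus (\<lambda>x i. ?E i x) = torus"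
    by (simp add: distr_binary_digits[OF hi] torus_def restrict_UNIV)
qed

text \<open>The opposite direction to dealing out: the digits of all coordinates are merged into one
  number in the order given by \<open>b\<close>. Recovering them uses the inverse of
  \<open>b\<close> as the injection.\<close>

lemma mp_iso_shuffle:
  fixes b :: "nat \<Rightarrow> nat \<times> nat"
  assumes b: "bij b"
  shows "mp_iso torus unif (\<lambda>s. binary_value (\<lambda>k. digit (snd (b k)) (s (fst (b k)))))"
proof -
  define h where "h = inv_into UNIV b"
  have h: "inj h" "\<And>k. h (b k) = k" using b by (simp_all add: h_def bij_imp_bij_inv bij_is_inj)
  have hi: "inj (\<lambda>j. h (i, j))" for i using h(1) by (rule inj_Pair1)
  let ?E = "\<lambda>x i. binary_value (\<lambda>j. digit (h (i, j)) x)"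
  let ?D = "\<lambda>s. binary_value (\<lambda>k. digit (snd (b k)) (s (fst (b k))))"
  have D: "?D \<in> borel_measurable torus"
  proof (rule measurable_binary)
    fix k
    show "Measurable.pred torus (\<lambda>s. digit (snd (b k)) (s (fst (b k))))"
      by (rule measurable_compose[OF measurable_torus_component measurable_digit])
  qed
  show ?thesis
  proof (rule mp_iso_left_inverse(2)[OF distr_binary_shuffle[OF h(1)]])
    show "?D \<in> measurable torus unif" using D unfolding measurable_cong_sets[OF refl sets_unif] .
    have "AE x in unif. \<forall>i j. digit j (?E x i) = digit (h (i, j)) x"
      unfolding AE_all_countable using AE_digit_binary[OF hi] by (auto simp: AE_all_countable)
    then show "AE x in unif. ?D (?E x) = x"
      using AE_unif by eventually_elim (simp add: h(2) binary_digits frac_eq)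
    have "(\<lambda>s. binary_value (\<lambda>j. digit (h (i, j)) (?D s))) \<in> borel_measurable torus" for i
      by (rule measurable_binary) (rule measurable_compose[OF D measurable_digit])
    then have "{s \<in> space torus. ?E (?D s) i = s i} \<in> sets torus" for i
      by (rule borel_measurable_eq) (rule measurable_torus_component)
    then have "Measurable.pred torus (\<lambda>s. ?E (?D s) i = s i)" for i by (simp add: pred_def)
    then have p: "Measurable.pred torus (\<lambda>s. \<forall>i. ?E (?D s) i = s i)"
      by (rule pred_intros_countable(1))
    have "{s \<in> space torus. ?E (?D s) = s} = {s \<in> space torus. \<forall>i. ?E (?D s) i = s i}"
      by (auto simp: fun_eq_iff)
    also have "\<dots> \<in> sets torus" using p by (simp add: pred_def)
    finally show "{s \<in> space torus. ?E (?D s) = s} \<in> sets torus" .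
  qed
qed

lemma mp_iso_case_nat: "mp_iso (unif \<Otimes>\<^sub>M torus) torus (\<lambda>p. case_nat (fst p) (snd p))"
proof -
  interpret sequence_space unif
    by (rule sequence_space.intro, rule product_prob_spaceI, rule prob_space_unif)
  have m: "(\<lambda>p. case_nat (fst p) (snd p)) \<in> measurable (unif \<Otimes>\<^sub>M torus) torus"
    unfolding torus_def by measurable
  show ?thesis
  proof (rule mp_iso_left_inverse(1)[OF m])
    show "distr (unif \<Otimes>\<^sub>M torus) torus (\<lambda>p. case_nat (fst p) (snd p)) = torus"
    proof -
      have "(\<lambda>p. case_nat (fst p) (snd p)) = (\<lambda>(s, w). case_nat s w :: nat \<Rightarrow> real)"
        by (rule ext) (simp add: case_prod_unfold)
      then show ?thesis using PiM_iter by (simp only: torus_def)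
    qed
    show "(\<lambda>s. (s 0, \<lambda>i. s (Suc i))) \<in> measurable torus (unif \<Otimes>\<^sub>M torus)"
      unfolding torus_def
      by (intro measurable_Pair measurable_PiM_single' measurable_component_singleton) auto
    show "{y \<in> space torus. case_nat (fst (y 0, \<lambda>i. y (Suc i))) (snd (y 0, \<lambda>i. y (Suc i))) = y} \<in> sets torus"
    proof -
      have "case_nat (y 0) (\<lambda>i. y (Suc i)) = y" for y :: "nat \<Rightarrow> real"
        by (auto simp: fun_eq_iff split: nat.split)
      then show ?thesis using sets.top[of torus] by simp
    qed
  qed simp
qed

text \<open>An order of merging that starts with the first n digits of coordinate 0. The merged
  number is then within 2^-n of that coordinate, whatever the others are.\<close>

lemma ex_bij_prefix: "\<exists>b :: nat \<Rightarrow> nat \<times> nat. bij b \<and> (\<forall>k<n. b k = (0, k))"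
proof -
  let ?P = "(\<lambda>k. (0::nat, k)) ` {..<n}"
  have "infinite (UNIV - ?P)" by (rule Diff_infinite_finite) (auto simp: finite_prod)
  then have B: "bij_betw (from_nat_into (UNIV - ?P)) UNIV (UNIV - ?P)"
    by (intro bij_betw_from_nat_into) auto
  define b where "b k = (if k < n then (0, k) else from_nat_into (UNIV - ?P) (k - n))" for k
  have "bij_betw (\<lambda>k. k - n) {n..} UNIV"
    by (rule bij_betw_byWitness[where f' = "\<lambda>k. k + n"]) auto
  from bij_betw_trans[OF this B] have 1: "bij_betw b {n..} (UNIV - ?P)"
    by (rule bij_betw_cong[THEN iffD1, rotated]) (auto simp: b_def)
  have "bij_betw (\<lambda>k. (0::nat, k)) {..<n} ?P" by (auto simp: bij_betw_def inj_on_def)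
  then have 2: "bij_betw b {..<n} ?P"
    by (rule bij_betw_cong[THEN iffD1, rotated]) (auto simp: b_def)
  have "bij_betw b ({..<n} \<union> {n..}) (?P \<union> (UNIV - ?P))" by (rule bij_betw_combine[OF 2 1]) auto
  moreover have "{..<n} \<union> {n..} = UNIV" by auto
  ultimately have "bij b" by simp
  then show ?thesis by (intro exI[of _ b]) (simp add: b_def)
qed

section \<open>Absorbing isomorphisms on a standard space\<close>

lemma mp_iso_lebesgue_unif: "mp_iso (lebesgue_on {0..1}) unif (\<lambda>x. x)"
proof -
  \<comment> \<open>The default 0 only brings a null set of reals into the space of
    \<open>?L\<close>.\<close>
  let ?L = "lebesgue_on {0..1::real}" and ?k = "\<lambda>x. if x \<in> {0..1} then x else (0::real)"
  have UL: "AE x in unif. P x" if "AE x in lborel. P x" for P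
  proof -
    obtain Z where Z: "Z \<in> null_sets lborel" "{x \<in> space lborel. \<not> P x} \<subseteq> Z"
      using \<open>AE x in lborel. P x\<close> by (auto simp: eventually_ae_filter)
    have "emeasure lborel ({0..<1} \<inter> Z) \<le> emeasure lborel Z" using Z(1) by (intro emeasure_mono) auto
    then have "Z \<in> null_sets unif" using Z(1) by (auto simp: null_sets_def emeasure_unif)
    then show ?thesis using Z(2) by (auto simp: eventually_ae_filter)
  qed
  have ne1: "AE x in lborel. x \<noteq> (1::real)" by (rule AE_lborel_singleton)
  have m1: "mp_map ?L unif (\<lambda>x. x)"
  proof (rule mp_mapI)
    have "(\<lambda>x. x) \<in> measurable ?L borel" by (intro measurable_restrict_space1 measurable_completion) simp
    then show "(\<lambda>x. x) \<in> measurable (completion ?L) unif"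
      unfolding measurable_cong_sets[OF refl sets_unif] by (rule measurable_completion)
    fix B assume "B \<in> sets unif"
    then have B: "B \<in> sets borel" by simp
    have "emeasure (completion ?L) ((\<lambda>x. x) -` B \<inter> space ?L) = emeasure ?L (B \<inter> {0..1})"
    proof -
      have "B \<inter> {0..1} \<in> sets ?L" using B by (subst sets_restrict_space_iff) auto
      then show ?thesis by simp
    qed
    also have "\<dots> = emeasure lebesgue (B \<inter> {0..1})" using B by (subst emeasure_restrict_space) auto
    also have "\<dots> = emeasure lborel (B \<inter> {0..1})" using B by simp
    also have "\<dots> = emeasure lborel ({0..<1} \<inter> B)"
      using B ne1 by (intro emeasure_eq_AE) (auto elim!: eventually_mono)
    finally show "emeasure (completion ?L) ((\<lambda>x. x) -` B \<inter> space ?L) = emeasure unif B"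
      by (simp add: emeasure_unif[OF B])
  qed
  have m2: "mp_map unif ?L ?k"
  proof (rule mp_mapI)
    have main: "?k -` B \<inter> space unif \<in> sets (completion unif) \<and>
        emeasure (completion unif) (?k -` B \<inter> space unif) = emeasure ?L B" if B: "B \<in> sets ?L" for B
    proof -
      have BL: "B \<in> sets lebesgue" "B \<subseteq> {0..1}" using B by (auto simp: sets_restrict_space)
      define S where "S = main_part lborel B"
      have S: "S \<in> sets borel" using main_part_sets[OF BL(1)] by (simp add: S_def)
      have BS: "AE x in lborel. x \<in> B \<longleftrightarrow> x \<in> S"
        using AE_in_main_part[OF BL(1)] unfolding S_def by eventually_elim auto
      have ae: "AE x in unif. x \<in> S \<longleftrightarrow> x \<in> ?k -` B \<inter> space unif"
        using UL[OF BS] AE_unif by eventually_elim auto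
      have aec: "AE x in completion unif. x \<in> S \<longleftrightarrow> x \<in> ?k -` B \<inter> space unif"
        using ae by (rule AE_completion)
      have "?k -` B \<inter> space unif \<in> sets (completion unif)"
        by (rule completion.in_sets_AE[OF aec]) (use S in auto)
      moreover have "emeasure (completion unif) (?k -` B \<inter> space unif) = emeasure (completion unif) S"
        by (rule emeasure_eq_AE) (use aec S calculation in \<open>auto elim!: eventually_mono\<close>)
      moreover have "emeasure (completion unif) S = emeasure lborel ({0..<1} \<inter> S)"
        using S by (simp add: emeasure_unif)
      moreover have "emeasure lborel ({0..<1} \<inter> S) = emeasure lebesgue ({0..<1} \<inter> S)" using S by simp
      moreover have "emeasure lebesgue ({0..<1} \<inter> S) = emeasure lebesgue B"
      proof (rule emeasure_eq_AE)
        have "AE x in lborel. x \<in> {0..<1} \<inter> S \<longleftrightarrow> x \<in> B"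
          using BS ne1 by eventually_elim (use BL(2) in \<open>auto simp: less_le\<close>)
        then show "AE x in lebesgue. x \<in> {0..<1} \<inter> S \<longleftrightarrow> x \<in> B" by (rule AE_completion)
      qed (use S BL in auto)
      moreover have "emeasure lebesgue B = emeasure ?L B"
        using BL by (subst emeasure_restrict_space) auto
      ultimately show ?thesis by simp
    qed
    show "?k \<in> measurable (completion unif) ?L"
      by (rule measurableI) (use main in auto)
    show "emeasure (completion unif) (?k -` B \<inter> space unif) = emeasure ?L B" if "B \<in> sets ?L" for B
      using main[OF that] by simp
  qed
  show ?thesis
  proof (rule mp_isoI[OF m1 m2])
    show "AE x in ?L. ?k x = x" by (rule AE_I2) simp
    show "AE x in unif. ?k x = x" using AE_unif by eventually_elim simp
  qed
qed

lemma standard_mp_iso_unif: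
  assumes "standard_atomless_prob_space M"
  obtains f where "mp_iso M unif f"
proof -
  obtain f where "mp_iso M (lebesgue_on {0..1::real}) f"
    using assms by (auto simp: standard_atomless_prob_space_def)
  from mp_iso_compose[OF this mp_iso_lebesgue_unif] show ?thesis by (rule that)
qed

text \<open>For a half-line the two preimages differ only where \<open>g\<close> is within 2^-n of
  its end, up to a null set. From half-lines, which are stable under intersection and generate the
  Borel sets, the convergence spreads over complements and disjoint unions.\<close>

lemma measure_vimage_converges:
  assumes P: "prob_space P" and f: "\<And>n. mp_map P unif (f n)" and g: "mp_map P unif g"
    and near: "\<And>n. AE p in P. \<bar>f n p - g p\<bar> \<le> 1 / 2 ^ n" and A: "A \<in> sets borel"
  shows "(\<lambda>n. sd P (f n -` A \<inter> space P) (g -` A \<inter> space P)) \<longlonglongrightarrow> 0"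
proof -
  interpret C: prob_space "completion P" by (rule prob_space_completion[OF P])
  interpret U: prob_space unif by (rule prob_space_unif)
  have fs: "f n -` B \<inter> space P \<in> sets (completion P)" and gs: "g -` B \<inter> space P \<in> sets (completion P)"
    and fm: "measure (completion P) (f n -` B \<inter> space P) = measure unif B"
    and gm: "measure (completion P) (g -` B \<inter> space P) = measure unif B" if "B \<in> sets borel" for B n
    using mp_map_vimage[OF f, of B] mp_map_vimage[OF g, of B] mp_map_measure[OF f, of B] mp_map_measure[OF g, of B] that
    by simp_all
  let ?G = "range (\<lambda>a::real. {..a})"
  have Int: "Int_stable ?G"
  proof (rule Int_stableI)
    fix A B :: "real set" assume "A \<in> ?G" "B \<in> ?G"
    then obtain a b where "A = {..a}" "B = {..b}" by auto
    then have "A \<inter> B = {..min a b}" by auto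
    then show "A \<inter> B \<in> ?G" by auto
  qed
  have bor: "sets borel = sigma_sets UNIV ?G" by (simp add: borel_eq_atMost)
  have Pow: "?G \<subseteq> Pow UNIV" by simp
  have "A \<in> sigma_sets UNIV ?G" using A by (simp add: bor)
  with Int Pow show ?thesis
  proof (induction A rule: sigma_sets_induct_disjoint)
    case (basic A)
    then obtain a where a: "A = {..a}" by auto
    have bound: "sd P (f n -` A \<inter> space P) (g -` A \<inter> space P) \<le> 2 * (1/2) ^ n" for n
    proof -
      let ?I = "{a - 1 / 2 ^ n..a + 1 / 2 ^ n}"
      have "sd P (f n -` A \<inter> space P) (g -` A \<inter> space P) \<le> measure (completion P) (g -` ?I \<inter> space P)"
        unfolding sd_def
      proof (rule C.finite_measure_mono_AE)
        have "AE p in completion P. \<bar>f n p - g p\<bar> \<le> 1 / 2 ^ n" by (rule AE_completion[OF near])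
        then show "AE p in completion P. p \<in> sym_diff (f n -` A \<inter> space P) (g -` A \<inter> space P) \<longrightarrow> p \<in> g -` ?I \<inter> space P"
          by eventually_elim (auto simp: a abs_le_iff)
        show "g -` ?I \<inter> space P \<in> sets (completion P)" by (rule gs) simp
      qed
      also have "\<dots> = measure unif ?I" by (rule gm) simp
      also have "\<dots> \<le> 2 * (1/2) ^ n"
      proof -
        have "emeasure unif ?I = emeasure lborel ({0..<1} \<inter> ?I)" by (rule emeasure_unif) simp
        also have "\<dots> \<le> emeasure lborel ?I" by (rule emeasure_mono) auto
        also have "\<dots> = ennreal (2 * (1/2) ^ n)" by (simp add: power_divide)
        finally show ?thesis unfolding measure_def by (intro enn2real_leI) auto
      qed
      finally show ?thesis .
    qed
    show ?case
    proof (rule tendsto_sandwich[where f = "\<lambda>_. 0" and h = "\<lambda>n. 2 * (1/2) ^ n"])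
      show "(\<lambda>n. 2 * (1/2) ^ n) \<longlonglongrightarrow> (0::real)"
        by (rule tendsto_mult_right_zero, rule LIMSEQ_power_zero) simp
      show "\<forall>\<^sub>F n in sequentially. 0 \<le> sd P (f n -` A \<inter> space P) (g -` A \<inter> space P)"
        by (simp add: sd_nonneg)
    qed (use bound in auto)
  next
    case empty
    show ?case by simp
  next
    case (compl A)
    have "sd P (h -` (UNIV - A) \<inter> space P) (k -` (UNIV - A) \<inter> space P) = sd P (h -` A \<inter> space P) (k -` A \<inter> space P)"
      for h k unfolding sd_def by (rule arg_cong[of _ _ "measure (completion P)"]) auto
    then show ?case using compl(2) by simp
  next
    case (union A)
    have Ab: "A i \<in> sets borel" for i using union(2) by (auto simp: bor)
    show ?case
    proof (rule LIMSEQ_I)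
      fix e :: real assume e: "e > 0"
      have "(\<lambda>i. measure unif (A i)) sums measure unif (\<Union>i. A i)"
        using Ab union(1) by (intro U.finite_measure_UNION) auto
      then have "(\<lambda>N. \<Sum>i<N. measure unif (A i)) \<longlonglongrightarrow> measure unif (\<Union>i. A i)" by (simp add: sums_def)
      from LIMSEQ_D[OF this, of "e / 4"] e
      obtain N where N: "\<bar>(\<Sum>i<N. measure unif (A i)) - measure unif (\<Union>i. A i)\<bar> < e / 4" by auto
      \<comment> \<open>The preimages of the tail under \<open>g\<close> and under all
        \<open>f n\<close> have the same measure, so the tail is negligible uniformly in n and
        convergence is needed for finitely many \<open>A i\<close> only.\<close>
      define T where "T = (\<Union>i. A i) - (\<Union>i<N. A i)"
      have T: "T \<in> sets borel" using Ab by (auto simp: T_def)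
      have "measure unif (\<Union>i<N. A i) = (\<Sum>i<N. measure unif (A i))"
        using Ab union(1) by (intro U.finite_measure_finite_Union) (auto intro: disjoint_family_on_mono)
      moreover have "measure unif T = measure unif (\<Union>i. A i) - measure unif (\<Union>i<N. A i)"
        unfolding T_def using Ab by (intro U.finite_measure_Diff) auto
      ultimately have Tm: "measure unif T < e / 4" using N by linarith
      have "(\<lambda>n. \<Sum>i<N. sd P (f n -` A i \<inter> space P) (g -` A i \<inter> space P)) \<longlonglongrightarrow> (\<Sum>i<N. 0)"
        by (rule tendsto_sum) (rule union(3))
      from LIMSEQ_D[OF this, of "e / 4"] e
      obtain n0 where n0: "\<And>n. n \<ge> n0 \<Longrightarrow> (\<Sum>i<N. sd P (f n -` A i \<inter> space P) (g -` A i \<inter> space P)) < e / 4"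
        by force
      show "\<exists>no. \<forall>n\<ge>no. norm (sd P (f n -` (\<Union>i. A i) \<inter> space P) (g -` (\<Union>i. A i) \<inter> space P) - 0) < e"
      proof (intro exI allI impI)
        fix n assume n: "n \<ge> n0"
        let ?S = "\<lambda>i. sym_diff (f n -` A i \<inter> space P) (g -` A i \<inter> space P)"
        have S: "?S i \<in> sets (completion P)" for i using fs[OF Ab] gs[OF Ab] by auto
        have "sd P (f n -` (\<Union>i. A i) \<inter> space P) (g -` (\<Union>i. A i) \<inter> space P) \<le>
            measure (completion P) ((\<Union>i<N. ?S i) \<union> ((f n -` T \<inter> space P) \<union> (g -` T \<inter> space P)))"
          unfolding sd_def
        proof (rule C.finite_measure_mono)
          show "sym_diff (f n -` (\<Union>i. A i) \<inter> space P) (g -` (\<Union>i. A i) \<inter> space P) \<subseteq>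
            (\<Union>i<N. ?S i) \<union> ((f n -` T \<inter> space P) \<union> (g -` T \<inter> space P))"
          proof
            fix p assume "p \<in> sym_diff (f n -` (\<Union>i. A i) \<inter> space P) (g -` (\<Union>i. A i) \<inter> space P)"
            then have p: "p \<in> space P" "f n p \<in> (\<Union>i. A i) \<longleftrightarrow> g p \<notin> (\<Union>i. A i)" by blast+
            have *: "y \<in> T \<or> (\<exists>i<N. y \<in> A i)" if "y \<in> (\<Union>i. A i)" for y
              using that unfolding T_def by blast
            show "p \<in> (\<Union>i<N. ?S i) \<union> ((f n -` T \<inter> space P) \<union> (g -` T \<inter> space P))"
            proof (cases "f n p \<in> (\<Union>i. A i)")
              case True
              with p(2) have "\<And>i. g p \<notin> A i" by blast
              with *[OF True] p(1) show ?thesis by fastforce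
            next
              case False
              with p(2) have g: "g p \<in> (\<Union>i. A i)" by blast
              from False have "\<And>i. f n p \<notin> A i" by blast
              with *[OF g] p(1) show ?thesis by fastforce
            qed
          qed
          show "(\<Union>i<N. ?S i) \<union> ((f n -` T \<inter> space P) \<union> (g -` T \<inter> space P)) \<in> sets (completion P)"
            by (intro sets.Un sets.finite_UN S fs gs T) simp
        qed
        also have "\<dots> \<le> measure (completion P) (\<Union>i<N. ?S i) +
            measure (completion P) ((f n -` T \<inter> space P) \<union> (g -` T \<inter> space P))"
          by (intro measure_Un_le sets.Un sets.finite_UN S fs gs T) simp
        also have "measure (completion P) (\<Union>i<N. ?S i) \<le> (\<Sum>i<N. measure (completion P) (?S i))"
          using S by (intro C.finite_measure_subadditive_finite) auto
        also have "(\<Sum>i<N. measure (completion P) (?S i)) < e / 4"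
          using n0[OF n] by (simp add: sd_def)
        also have "measure (completion P) ((f n -` T \<inter> space P) \<union> (g -` T \<inter> space P)) \<le> e / 4 + e / 4"
          using measure_Un_le[OF fs[OF T, of n] gs[OF T]] Tm by (simp add: fm[OF T] gm[OF T])
        finally show "norm (sd P (f n -` (\<Union>i. A i) \<inter> space P) (g -` (\<Union>i. A i) \<inter> space P) - 0) < e"
          using e sd_nonneg[of P] by simp
      qed
    qed
  qed
qed

text \<open>With \<open>M\<close> carried to the circle by \<open>\<phi>\<close>, the value
  \<open>\<phi> x\<close> is put in front of the torus coordinates and all digits are merged,
  beginning with n digits of \<open>\<phi> x\<close>. The result is within 2^-n of
  \<open>\<phi> x\<close> and still keeps all coordinates; \<open>\<psi>\<close> then returns to
  \<open>M\<close>.\<close>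

lemma ex_absorbing_isos:
  assumes M: "standard_atomless_prob_space M"
  obtains \<Theta> where "\<And>n. mp_iso (M \<Otimes>\<^sub>M torus) M (\<Theta> n)"
    "\<And>A. A \<in> sets (completion M) \<Longrightarrow>
      (\<lambda>n. sd (M \<Otimes>\<^sub>M torus) (\<Theta> n -` A \<inter> space (M \<Otimes>\<^sub>M torus)) (A \<times> UNIV)) \<longlonglongrightarrow> 0"
proof -
  have pM: "prob_space M" using M by (simp add: standard_atomless_prob_space_def)
  let ?P = "M \<Otimes>\<^sub>M torus"
  have pP: "prob_space ?P"
    by (rule prob_space_pair[OF pM prob_space_torus])
  obtain \<phi> where \<phi>: "mp_iso M unif \<phi>" by (rule standard_mp_iso_unif[OF M])
  obtain \<psi> where \<psi>: "mp_iso unif M \<psi>" "AE x in M. \<psi> (\<phi> x) = x" "AE y in unif. \<phi> (\<psi> y) = y"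
    by (rule mp_iso_inverse[OF \<phi>])
  obtain b :: "nat \<Rightarrow> nat \<Rightarrow> nat \<times> nat" where b: "\<And>n. bij (b n)" "\<And>n k. k < n \<Longrightarrow> b n k = (0, k)"
    using choice[of "\<lambda>n b. bij b \<and> (\<forall>k<n. b k = (0, k))"] ex_bij_prefix by blast
  define D where "D n s = binary_value (\<lambda>k. digit (snd (b n k)) (s (fst (b n k))))" for n and s :: "nat \<Rightarrow> real"
  define F where "F n p = D n (case_nat (\<phi> (fst p)) (snd p))" for n p
  have D: "mp_iso torus unif (D n)" for n unfolding D_def by (rule mp_iso_shuffle[OF b(1)])
  have F: "mp_iso ?P unif (F n)" for n
    using mp_iso_compose[OF mp_iso_compose[OF mp_iso_Times[OF pM prob_space_unif prob_space_torus \<phi>] mp_iso_case_nat] D[of n]]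
    by (simp add: F_def[abs_def])
  define g where "g p = \<phi> (fst p)" for p :: "'a \<times> (nat \<Rightarrow> real)"
  have g: "mp_map ?P unif g"
    unfolding g_def[abs_def] by (rule mp_map_compose[OF mp_map_fst[OF pM prob_space_torus] mp_iso_map[OF \<phi>]])
  have near: "AE p in ?P. \<bar>F n p - g p\<bar> \<le> 1 / 2 ^ n" for n
    using mp_map_AE[OF g AE_unif]
  proof eventually_elim
    case (elim p)
    have "\<bar>F n p - binary_value (\<lambda>k. digit k (g p))\<bar> \<le> 1 / 2 ^ n"
      unfolding F_def D_def g_def by (rule binary_near) (simp add: b(2))
    moreover have "binary_value (\<lambda>k. digit k (g p)) = g p" using elim by (simp add: binary_digits frac_eq)
    ultimately show ?case by simp
  qed
  show ?thesis
  proof (rule that[of "\<lambda>n p. \<psi> (F n p)"])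
    show "mp_iso ?P M (\<lambda>p. \<psi> (F n p))" for n by (rule mp_iso_compose[OF F \<psi>(1)])
    fix A assume A: "A \<in> sets (completion M)"
    define A' where "A' = \<psi> -` A \<inter> space unif"
    have A': "A' \<in> sets (completion unif)"
      unfolding A'_def by (rule mp_map_vimage[OF mp_iso_map[OF \<psi>(1)] A])
    define B where "B = main_part unif A'"
    have B: "B \<in> sets borel" using main_part_sets[OF A'] by (simp add: B_def)
    have AB: "AE x in unif. x \<in> A' \<longleftrightarrow> x \<in> B"
      using AE_in_main_part[OF A'] unfolding B_def by eventually_elim auto
    have "sd ?P ((\<lambda>p. \<psi> (F n p)) -` A \<inter> space ?P) (A \<times> UNIV) = sd ?P (F n -` B \<inter> space ?P) (g -` B \<inter> space ?P)" for n
    proof (rule sd_AE_cong)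
      show "AE p in ?P. (p \<in> (\<lambda>p. \<psi> (F n p)) -` A \<inter> space ?P \<longleftrightarrow> p \<in> F n -` B \<inter> space ?P) \<and>
          (p \<in> A \<times> UNIV \<longleftrightarrow> p \<in> g -` B \<inter> space ?P)"
        using mp_map_AE[OF mp_iso_map[OF F] AB] mp_map_AE[OF g AB] AE_space
          mp_map_AE[OF mp_map_fst[OF pM prob_space_torus] \<psi>(2)]
        by eventually_elim (auto simp: A'_def g_def)
      show "(\<lambda>p. \<psi> (F n p)) -` A \<inter> space ?P \<in> sets (completion ?P)"
        by (rule mp_map_vimage[OF mp_map_compose[OF mp_iso_map[OF F] mp_iso_map[OF \<psi>(1)]] A])
      show "A \<times> UNIV \<in> sets (completion ?P)"
        by (rule completion_Times(1)[OF pM prob_space_torus A]) (use sets.top[of torus] in auto)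
      show "F n -` B \<inter> space ?P \<in> sets (completion ?P)" "g -` B \<inter> space ?P \<in> sets (completion ?P)"
        using mp_map_vimage[OF mp_iso_map[OF F], of B] mp_map_vimage[OF g, of B] B by auto
    qed
    then show "(\<lambda>n. sd ?P ((\<lambda>p. \<psi> (F n p)) -` A \<inter> space ?P) (A \<times> UNIV)) \<longlonglongrightarrow> 0"
      using measure_vimage_converges[OF pP mp_iso_map[OF F] g near B] by simp
  qed
qed

subsection \<open>Skew product actions\<close>

text \<open>
  The cocycle of the extension by the torus of the action \<open>r\<close>, conjugated by the fibrewise
  automorphism \<open>f\<close>.
\<close>

definition cocycle :: "'a measure \<Rightarrow> (nat \<Rightarrow> 'g \<Rightarrow> real) \<Rightarrow> ((nat \<Rightarrow> real) \<Rightarrow> ('a \<Rightarrow> 'a) set) \<Rightarrow>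
    ('g \<Rightarrow> ('a \<Rightarrow> 'a) set) \<Rightarrow> 'g \<Rightarrow> (nat \<Rightarrow> real) \<Rightarrow> ('a \<Rightarrow> 'a) set" where
  "cocycle M X f r x k = f (shift X x k) \<otimes>\<^bsub>Aut M\<^esub> r x \<otimes>\<^bsub>Aut M\<^esub> inv\<^bsub>Aut M\<^esub> (f k)"

text \<open>Up to integers the shift by the unit is the reduction \<open>frac\<close>, which fixes
  the points with all coordinates in [0,1).\<close>

lemma AE_shift_one:
  assumes "comm_group L" "\<And>i. hom_mod \<int> L (carrier L) (X i)"
  shows "AE k in torus. shift X \<one>\<^bsub>L\<^esub> k = k"
proof -
  have "AE k in torus. \<forall>i. 0 \<le> k i \<and> k i < 1"
    unfolding AE_all_countable using AE_torus_component[OF AE_unif] by blast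
  then show ?thesis
  proof eventually_elim
    case (elim k)
    show ?case
    proof
      fix i
      have "shift X \<one>\<^bsub>L\<^esub> k i = frac (shift X \<one>\<^bsub>L\<^esub> k i)" by (simp add: shift_def rot_def)
      also have "\<dots> = frac (k i)" by (rule comm_group.frac_shift_one[OF assms])
      also have "\<dots> = k i" using elim by (simp add: frac_eq)
      finally show "shift X \<one>\<^bsub>L\<^esub> k i = k i" .
    qed
  qed
qed

lemma mp_map_shift: "mp_map torus torus (shift X x)"
  unfolding shift_def by (rule mp_map_measurable_imp[OF measurable_rot distr_rot])

lemma cocycle_sets:
  assumes fin: "finite (range f)" and f: "\<And>a. {k. f k = a} \<in> sets torus"
  shows "{k. P (cocycle M X f r x k)} \<in> sets torus"
proof -
  have "{k. (\<lambda>p. P (fst p \<otimes>\<^bsub>Aut M\<^esub> r x \<otimes>\<^bsub>Aut M\<^esub> inv\<^bsub>Aut M\<^esub> (snd p))) ((\<lambda>k. (f (shift X x k), f k)) k)} \<in> sets torus"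
  proof (rule finite_range_sets[where f = "\<lambda>k. (f (shift X x k), f k)"
        and P = "\<lambda>p. P (fst p \<otimes>\<^bsub>Aut M\<^esub> r x \<otimes>\<^bsub>Aut M\<^esub> inv\<^bsub>Aut M\<^esub> (snd p))"])
    show "finite (range f \<times> range f)" using fin by simp
    fix a
    have "{k. (f (shift X x k), f k) = a} = {k. rot (\<lambda>i. X i x) k \<in> {k. f k = fst a}} \<inter> {k. f k = snd a}"
      by (auto simp: shift_def)
    also have "\<dots> \<in> sets torus" by (intro sets.Int measure_rot f)
    finally show "{k. (f (shift X x k), f k) = a} \<in> sets torus" .
  qed auto
  then show ?thesis by (simp add: cocycle_def)
qed

lemma finite_range_cocycle:
  assumes "finite (range f)"
  shows "finite (range (cocycle M X f r x))"
proof -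
  have "range (cocycle M X f r x) \<subseteq> (\<lambda>(a, b). a \<otimes>\<^bsub>Aut M\<^esub> r x \<otimes>\<^bsub>Aut M\<^esub> inv\<^bsub>Aut M\<^esub> b) ` (range f \<times> range f)"
    by (auto simp: cocycle_def)
  then show ?thesis by (rule finite_subset) (use assms in simp)
qed

text \<open>The fibre of \<open>S\<close> over k is the image of \<open>A\<close> under
  \<open>j k\<close>, so the distance is an average over k of fibre distances. Fibres at distance at
  most \<open>e\<close> contribute at most \<open>e\<close>, and each of the others is bounded by
  1.\<close>

lemma skew_estimate:
  assumes M: "prob_space M" and A: "A \<in> sets (completion M)" and C: "C \<in> sets (completion M)"
    and j: "finite (range j)" "\<And>a. {k. j k = a} \<in> sets torus" "\<And>k. j k \<in> carrier (Aut M)" and e: "e \<ge> 0"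
    and S: "S \<in> sets (completion (M \<Otimes>\<^sub>M torus))"
    and SA: "AE p in M \<Otimes>\<^sub>M torus. p \<in> S \<longleftrightarrow> fst p \<in> aut_image M (j (snd p)) A"
  shows "sd (M \<Otimes>\<^sub>M torus) S (C \<times> UNIV) \<le> e + measure torus {k. sd M (aut_image M (j k) A) C > e}"
proof -
  let ?P = "M \<Otimes>\<^sub>M torus"
  interpret T: prob_space torus by (rule prob_space_torus)
  interpret CM: prob_space "completion M" by (rule prob_space_completion[OF M])
  interpret CP: prob_space "completion ?P" by (rule prob_space_completion[OF prob_space_pair[OF M prob_space_torus]])
  let ?I = "range j" and ?J = "\<lambda>a. {k. j k = a}" and ?B = "\<lambda>a. sym_diff (aut_image M a A) C"
  have B: "?B a \<in> sets (completion M)" if "a \<in> ?I" for a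
    using aut_image_sets[OF _ A, of a] C j(3) that by auto
  have J: "?J a \<in> sets (completion torus)" for a using j(2) by simp
  have UT: "UNIV \<in> sets (completion torus)" using sets.top[of torus] by simp
  have "sd ?P S (C \<times> UNIV) = measure (completion ?P) (\<Union>a\<in>?I. ?B a \<times> ?J a)"
    unfolding sd_def
  proof (rule measure_eq_AE)
    show "AE p in completion ?P. p \<in> sym_diff S (C \<times> UNIV) \<longleftrightarrow> p \<in> (\<Union>a\<in>?I. ?B a \<times> ?J a)"
      using AE_completion[OF SA] by eventually_elim (auto simp: mem_Times_iff)
    show "sym_diff S (C \<times> UNIV) \<in> sets (completion ?P)"
      using S completion_Times(1)[OF M prob_space_torus C UT] by auto
    show "(\<Union>a\<in>?I. ?B a \<times> ?J a) \<in> sets (completion ?P)"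
      using j(1) B J by (intro sets.finite_UN completion_Times(1)[OF M prob_space_torus]) auto
  qed
  also have "\<dots> = (\<Sum>a\<in>?I. measure (completion ?P) (?B a \<times> ?J a))"
    using j(1) B J
    by (intro CP.finite_measure_finite_Union) (auto simp: disjoint_family_on_def intro!: completion_Times(1)[OF M prob_space_torus])
  also have "\<dots> = (\<Sum>a\<in>?I. sd M (aut_image M a A) C * measure torus (?J a))"
  proof (rule sum.cong[OF refl])
    fix a assume a: "a \<in> ?I"
    have "measure (completion torus) (?J a) = measure torus (?J a)" using j(2) by simp
    then show "measure (completion ?P) (?B a \<times> ?J a) = sd M (aut_image M a A) C * measure torus (?J a)"
      unfolding sd_def by (simp only: measure_completion_Times[OF M prob_space_torus B[OF a] J])
  qed
  also have "\<dots> \<le> (\<Sum>a\<in>?I. e * measure torus (?J a) + (if sd M (aut_image M a A) C > e then measure torus (?J a) else 0))"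
  proof (rule sum_mono)
    fix a assume "a \<in> ?I"
    have "sd M (aut_image M a A) C \<le> 1" unfolding sd_def by (rule CM.prob_le_1)
    then have "sd M (aut_image M a A) C * measure torus (?J a) \<le> 1 * measure torus (?J a)"
      by (intro mult_right_mono) auto
    moreover have "sd M (aut_image M a A) C * measure torus (?J a) \<le> e * measure torus (?J a)"
      if "\<not> sd M (aut_image M a A) C > e" using that by (intro mult_right_mono) auto
    moreover have "0 \<le> e * measure torus (?J a)" using e by simp
    ultimately show "sd M (aut_image M a A) C * measure torus (?J a) \<le>
        e * measure torus (?J a) + (if sd M (aut_image M a A) C > e then measure torus (?J a) else 0)"
      by auto
  qed
  also have "\<dots> = e * (\<Sum>a\<in>?I. measure torus (?J a)) + (\<Sum>a\<in>{a\<in>?I. sd M (aut_image M a A) C > e}. measure torus (?J a))"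
    using j(1) by (simp add: sum.distrib sum_distrib_left sum.inter_filter)
  also have "(\<Sum>a\<in>?I. measure torus (?J a)) = measure torus (\<Union>a\<in>?I. ?J a)"
    using j by (intro T.finite_measure_finite_Union[symmetric]) (auto simp: disjoint_family_on_def)
  also have "(\<Union>a\<in>?I. ?J a) = space torus" by auto
  also have "measure torus (space torus) = 1" by (rule T.prob_space)
  also have "(\<Sum>a\<in>{a\<in>?I. sd M (aut_image M a A) C > e}. measure torus (?J a)) =
      measure torus (\<Union>a\<in>{a\<in>?I. sd M (aut_image M a A) C > e}. ?J a)"
    using j by (intro T.finite_measure_finite_Union[symmetric]) (auto simp: disjoint_family_on_def)
  also have "(\<Union>a\<in>{a\<in>?I. sd M (aut_image M a A) C > e}. ?J a) = {k. sd M (aut_image M (j k) A) C > e}" by auto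
  finally show ?thesis by simp
qed

text \<open>The skew product is an action on the product with the torus, modulo null sets, and is
  carried to \<open>M\<close> by \<open>\<Theta> n\<close>. Since \<open>\<Theta> n\<close> tends to
  the first projection, a set A of \<open>M\<close> can be replaced by the rectangle over A, for
  which the fibrewise estimate applies. The arbitrarily small \<open>e'\<close> absorbs the error of
  this replacement.\<close>

lemma skew_actions:
  fixes L :: "('g, 'm) monoid_scheme"
  assumes M: "standard_atomless_prob_space M" and L: "comm_group L"
    and X: "\<And>i. hom_mod \<int> L (carrier L) (X i)"
    and fin: "finite (range f)" and f: "\<And>a. {k. f k = a} \<in> sets torus" and fc: "\<And>k. f k \<in> carrier (Aut M)"
    and r: "r \<in> hom L (Aut M)"
  obtains p where "\<And>n. p n \<in> hom L (Aut M)"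
    "\<And>x A C e e'. x \<in> carrier L \<Longrightarrow> A \<in> sets (completion M) \<Longrightarrow> C \<in> sets (completion M) \<Longrightarrow> e \<ge> 0 \<Longrightarrow> e' > 0 \<Longrightarrow>
      eventually (\<lambda>n. sd M (aut_image M (p n x) A) C <
        e + measure torus {k. sd M (aut_image M (cocycle M X f r x k) A) C > e} + e') sequentially"
proof -
  interpret L: comm_group L by (rule L)
  interpret G: group "Aut M" by (rule group_Aut)
  have pM: "prob_space M" using M by (simp add: standard_atomless_prob_space_def)
  let ?P = "M \<Otimes>\<^sub>M torus"
  note pT = prob_space_torus
  have pP: "prob_space ?P" by (rule prob_space_pair[OF pM pT])
  have rc: "r x \<in> carrier (Aut M)" if "x \<in> carrier L" for x using r that by (auto simp: hom_def)
  have rm: "r (x \<otimes>\<^bsub>L\<^esub> y) = r x \<otimes>\<^bsub>Aut M\<^esub> r y" if "x \<in> carrier L" "y \<in> carrier L" for x y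
    using r that by (simp add: hom_def)
  let ?a = "cocycle M X f r"
  have ac: "?a x k \<in> carrier (Aut M)" if "x \<in> carrier L" for x k
    using fc rc[OF that] by (simp add: cocycle_def)
  \<comment> \<open>The cocycle identity: the two values of \<open>f\<close> at the intermediate
    point cancel.\<close>
  have amult: "?a (x \<otimes>\<^bsub>L\<^esub> y) k = ?a x (shift X y k) \<otimes>\<^bsub>Aut M\<^esub> ?a y k"
    if "x \<in> carrier L" "y \<in> carrier L" for x y k
  proof -
    have "inv\<^bsub>Aut M\<^esub> (f (shift X y k)) \<otimes>\<^bsub>Aut M\<^esub> (f (shift X y k) \<otimes>\<^bsub>Aut M\<^esub> r y \<otimes>\<^bsub>Aut M\<^esub> inv\<^bsub>Aut M\<^esub> (f k)) =
        r y \<otimes>\<^bsub>Aut M\<^esub> inv\<^bsub>Aut M\<^esub> (f k)"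
      using fc rc that by (simp add: G.m_assoc[symmetric])
    then show ?thesis
      using fc rc that by (simp add: cocycle_def rm L.shift_shift[OF X] G.m_assoc)
  qed
  define act where "act x q = (aut_rep (?a x (snd q)) (fst q), shift X x (snd q))" for x and q :: "'a \<times> (nat \<Rightarrow> real)"
  have act_mp: "mp_map ?P ?P (act x)" if x: "x \<in> carrier L" for x
    unfolding act_def[abs_def]
  proof (rule mp_map_skew[OF pM pM pT pT finite_range_cocycle[OF fin]])
    show "?a x k \<in> range (?a x)" for k by simp
    show "{k \<in> space torus. ?a x k = i} \<in> sets (completion torus)" for i
    proof -
      have "{k. ?a x k = i} \<in> sets torus" by (rule cocycle_sets[OF fin f])
      then show ?thesis by simp
    qed
    show "mp_map M M (aut_rep i)" if "i \<in> range (?a x)" for i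
      using that ac[OF x] by (auto intro!: mp_iso_map aut_rep)
  qed (rule mp_map_shift)
  have act_mult: "AE q in ?P. act x (act y q) = act (x \<otimes>\<^bsub>L\<^esub> y) q" if x: "x \<in> carrier L" and y: "y \<in> carrier L" for x y
  proof -
    have "AE z in M. \<forall>i\<in>range (?a x). \<forall>j\<in>range (?a y). aut_rep (i \<otimes>\<^bsub>Aut M\<^esub> j) z = aut_rep i (aut_rep j z)"
      unfolding AE_finite_all[OF finite_range_cocycle[OF fin]]
      using ac[OF x] ac[OF y] by (intro ballI aut_rep_mult) auto
    from mp_map_AE[OF mp_map_fst[OF pM pT] this] show ?thesis
      by eventually_elim (simp add: act_def amult[OF x y] L.shift_shift[OF X x y])
  qed
  have snd_one: "AE q in ?P. shift X \<one>\<^bsub>L\<^esub> (snd q) = snd q"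
    by (rule mp_map_AE[OF mp_map_snd[OF pM pT] AE_shift_one[OF L X]])
  have fst_one: "AE q in ?P. aut_rep \<one>\<^bsub>Aut M\<^esub> (fst q) = fst q"
    by (rule mp_map_AE[OF mp_map_fst[OF pM pT] aut_rep_one])
  have act_one: "AE q in ?P. act \<one>\<^bsub>L\<^esub> q = q"
    using snd_one fst_one
  proof eventually_elim
    case (elim q)
    have "r \<one>\<^bsub>L\<^esub> = \<one>\<^bsub>Aut M\<^esub>" using hom_one[OF r L.is_group group_Aut] .
    then have "?a \<one>\<^bsub>L\<^esub> (snd q) = \<one>\<^bsub>Aut M\<^esub>" using elim(1) fc by (simp add: cocycle_def)
    then show ?case using elim by (simp add: act_def prod_eq_iff)
  qed
  have act_inv: "AE q in ?P. act (inv\<^bsub>L\<^esub> x) (act x q) = q" "AE q in ?P. act x (act (inv\<^bsub>L\<^esub> x) q) = q"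
    if x: "x \<in> carrier L" for x
  proof -
    show "AE q in ?P. act (inv\<^bsub>L\<^esub> x) (act x q) = q"
      using act_mult[OF L.inv_closed[OF x] x] act_one by eventually_elim (simp add: x)
    show "AE q in ?P. act x (act (inv\<^bsub>L\<^esub> x) q) = q"
      using act_mult[OF x L.inv_closed[OF x]] act_one by eventually_elim (simp add: x)
  qed
  have act_iso: "mp_iso ?P ?P (act x)" if x: "x \<in> carrier L" for x
    by (rule mp_isoI[OF act_mp[OF x] act_mp[OF L.inv_closed[OF x]] act_inv[OF x]])
  obtain \<Theta> where \<Theta>: "\<And>n. mp_iso ?P M (\<Theta> n)"
    and lim: "\<And>A. A \<in> sets (completion M) \<Longrightarrow> (\<lambda>n. sd ?P (\<Theta> n -` A \<inter> space ?P) (A \<times> UNIV)) \<longlonglongrightarrow> 0"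
    by (rule ex_absorbing_isos[OF M]) blast
  have "\<forall>n. \<exists>\<Theta>'. mp_iso M ?P \<Theta>' \<and> (AE q in ?P. \<Theta>' (\<Theta> n q) = q) \<and> (AE z in M. \<Theta> n (\<Theta>' z) = z)"
  proof
    fix n
    obtain g where "mp_iso M ?P g" "AE q in ?P. g (\<Theta> n q) = q" "AE z in M. \<Theta> n (g z) = z"
      by (rule mp_iso_inverse[OF \<Theta>])
    then show "\<exists>\<Theta>'. mp_iso M ?P \<Theta>' \<and> (AE q in ?P. \<Theta>' (\<Theta> n q) = q) \<and> (AE z in M. \<Theta> n (\<Theta>' z) = z)"
      by (intro exI[of _ g] conjI)
  qed
  from choice[OF this] obtain \<Theta>' where \<Theta>': "\<forall>n. mp_iso M ?P (\<Theta>' n) \<and> (AE q in ?P. \<Theta>' n (\<Theta> n q) = q) \<and> (AE z in M. \<Theta> n (\<Theta>' n z) = z)"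
    by (elim exE)
  have i': "mp_iso M ?P (\<Theta>' n)" and \<Theta>'\<Theta>: "AE q in ?P. \<Theta>' n (\<Theta> n q) = q" and \<Theta>\<Theta>': "AE z in M. \<Theta> n (\<Theta>' n z) = z" for n
    using \<Theta>' by simp_all
  define c where "c n x z = \<Theta> n (act x (\<Theta>' n z))" for n x z
  have c: "mp_iso M M (c n x)" if "x \<in> carrier L" for n x
    unfolding c_def[abs_def] by (rule mp_iso_compose[OF mp_iso_compose[OF i' act_iso[OF that]] \<Theta>])
  have c_mult: "AE z in M. c n x (c n y z) = c n (x \<otimes>\<^bsub>L\<^esub> y) z" if x: "x \<in> carrier L" and y: "y \<in> carrier L" for n x y
    using mp_map_AE[OF mp_map_compose[OF mp_iso_map[OF i'[of n]] act_mp[OF y]] \<Theta>'\<Theta>[of n]]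
      mp_map_AE[OF mp_iso_map[OF i'[of n]] act_mult[OF x y]]
    by eventually_elim (simp add: c_def)
  have c_inv: "AE z in M. c n x (c n (inv\<^bsub>L\<^esub> x) z) = z" if x: "x \<in> carrier L" for n x
    using c_mult[OF x L.inv_closed[OF x], of n] mp_map_AE[OF mp_iso_map[OF i'[of n]] act_one] \<Theta>\<Theta>'[of n]
    by eventually_elim (simp add: c_def x)
  define p where "p n x = aut_class M (c n x)" for n x
  show ?thesis
  proof (rule that[of p])
    show "p n \<in> hom L (Aut M)" for n
    proof (rule homI)
      show "p n x \<in> carrier (Aut M)" if "x \<in> carrier L" for x
        unfolding p_def by (rule aut_class_carrier[OF c[OF that]])
      show "p n (x \<otimes>\<^bsub>L\<^esub> y) = p n x \<otimes>\<^bsub>Aut M\<^esub> p n y" if x: "x \<in> carrier L" and y: "y \<in> carrier L" for x y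
        unfolding p_def aut_mult[OF c[OF x] c[OF y]]
        by (rule aut_class_eqI[symmetric, OF mp_iso_compose[OF c[OF y] c[OF x]] c[OF L.m_closed[OF x y]] c_mult[OF x y]])
    qed
    fix x A C and e e' :: real
    assume x: "x \<in> carrier L" and A: "A \<in> sets (completion M)" and C: "C \<in> sets (completion M)" and e: "e \<ge> 0" "e' > 0"
    let ?x' = "inv\<^bsub>L\<^esub> x"
    have x': "?x' \<in> carrier L" using x by simp
    let ?pre = "\<lambda>n A. \<Theta> n -` A \<inter> space ?P" and ?act = "\<lambda>B. act ?x' -` B \<inter> space ?P"
    have pre: "?pre n B \<in> sets (completion ?P)" if "B \<in> sets (completion M)" for n B
      by (rule mp_map_vimage[OF mp_iso_map[OF \<Theta>] that])
    have apre: "?act B \<in> sets (completion ?P)" if "B \<in> sets (completion ?P)" for B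
      by (rule mp_map_vimage[OF act_mp[OF x'] that])
    have rect: "B \<times> UNIV \<in> sets (completion ?P)" if "B \<in> sets (completion M)" for B
      by (rule completion_Times(1)[OF pM pT that]) (use sets.top[of torus] in auto)
    let ?m = "measure torus {k. sd M (aut_image M (?a x k) A) C > e}"
    have mid: "sd ?P (?act (A \<times> UNIV)) (C \<times> UNIV) \<le> e + ?m"
    proof -
      \<comment> \<open>Over a point \<open>k\<close>, the image of the rectangle comes from the
        fibre over \<open>k\<close> shifted back by \<open>x\<close>, so the cocycle has to be taken
        there. Its inverse is the cocycle of the inverse element at \<open>k\<close>. The backward
        shift preserves the measure.\<close>
      define j where "j k = ?a x (shift X ?x' k)" for k
      have jfin: "finite (range j)"
        by (rule finite_subset[OF _ finite_range_cocycle[OF fin, of M X r x]]) (auto simp: j_def)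
      have js: "{k. P (j k)} \<in> sets torus \<and> measure torus {k. P (j k)} = measure torus {k. P (?a x k)}" for P
        using measure_rot[of "{k. P (?a x k)}" "\<lambda>i. X i ?x'"] cocycle_sets[OF fin f, of P M X r x]
        by (simp add: j_def shift_def)
      have jc: "j k \<in> carrier (Aut M)" for k using ac[OF x] by (simp add: j_def)
      have jae: "AE q in ?P. q \<in> ?act (A \<times> UNIV) \<longleftrightarrow> fst q \<in> aut_image M (j (snd q)) A"
        using snd_one AE_space
      proof eventually_elim
        case (elim q)
        have "r \<one>\<^bsub>L\<^esub> = \<one>\<^bsub>Aut M\<^esub>" using hom_one[OF r L.is_group group_Aut] .
        then have "?a \<one>\<^bsub>L\<^esub> (snd q) = \<one>\<^bsub>Aut M\<^esub>" using elim(1) fc by (simp add: cocycle_def)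
        then have "j (snd q) \<otimes>\<^bsub>Aut M\<^esub> ?a ?x' (snd q) = \<one>\<^bsub>Aut M\<^esub>"
          using amult[OF x x', of "snd q"] x by (simp add: j_def)
        then have "?a ?x' (snd q) \<otimes>\<^bsub>Aut M\<^esub> j (snd q) = \<one>\<^bsub>Aut M\<^esub>"
          by (rule G.inv_comm) (use ac[OF x] ac[OF x'] in \<open>simp_all add: j_def\<close>)
        then have "inv\<^bsub>Aut M\<^esub> (j (snd q)) = ?a ?x' (snd q)"
          by (rule G.inv_equality) (use ac[OF x] ac[OF x'] in \<open>simp_all add: j_def\<close>)
        then show ?case using elim(2) by (auto simp: aut_image_eq act_def space_pair_measure)
      qed
      have "sd ?P (?act (A \<times> UNIV)) (C \<times> UNIV) \<le> e + measure torus {k. sd M (aut_image M (j k) A) C > e}"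
        by (rule skew_estimate[OF pM A C jfin conjunct1[OF js] jc e(1) apre[OF rect[OF A]] jae])
      then show ?thesis using conjunct2[OF js[of "\<lambda>b. sd M (aut_image M b A) C > e"]] by (simp only:)
    qed
    \<comment> \<open>Only the first and the last term depend on n, and both tend to 0.\<close>
    have key: "sd M (aut_image M (p n x) A) C \<le>
        sd ?P (?pre n A) (A \<times> UNIV) + (e + ?m) + sd ?P (?pre n C) (C \<times> UNIV)" for n
    proof -
      let ?E = "?act (?pre n A)"
      have "sd M (aut_image M (p n x) A) (c n ?x' -` A \<inter> space M) = 0"
        unfolding p_def by (rule aut_image_class[OF c[OF x] c[OF x'] c_inv[OF x] A])
      then have "sd M (aut_image M (p n x) A) C \<le> sd M (c n ?x' -` A \<inter> space M) C"
        using sd_triangle[OF pM aut_image_sets[OF aut_class_carrier[OF c[OF x]] A] mp_map_vimage[OF mp_iso_map[OF c[OF x']] A] C, of n n]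
        by (simp add: p_def)
      also have "\<dots> = sd M (\<Theta>' n -` ?E \<inter> space M) (\<Theta>' n -` ?pre n C \<inter> space M)"
      proof (rule sd_AE_cong)
        show "AE z in M. (z \<in> c n ?x' -` A \<inter> space M \<longleftrightarrow> z \<in> \<Theta>' n -` ?E \<inter> space M) \<and>
            (z \<in> C \<longleftrightarrow> z \<in> \<Theta>' n -` ?pre n C \<inter> space M)"
          using \<Theta>\<Theta>'[of n] AE_space
        proof eventually_elim
          case (elim z)
          have "\<Theta>' n z \<in> space ?P" by (rule mp_map_space[OF mp_iso_map[OF i'] elim(2)])
          moreover from this have "act ?x' (\<Theta>' n z) \<in> space ?P" by (rule mp_map_space[OF act_mp[OF x']])
          ultimately show ?case using elim by (simp add: c_def)
        qed
        show "c n ?x' -` A \<inter> space M \<in> sets (completion M)"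
          by (rule mp_map_vimage[OF mp_iso_map[OF c[OF x']] A])
        show "C \<in> sets (completion M)" by (rule C)
        show "\<Theta>' n -` ?E \<inter> space M \<in> sets (completion M)" "\<Theta>' n -` ?pre n C \<inter> space M \<in> sets (completion M)"
          by (rule mp_map_vimage[OF mp_iso_map[OF i']], intro apre pre A C)+
      qed
      also have "\<dots> = sd ?P ?E (?pre n C)"
        by (rule sd_vimage[OF mp_iso_map[OF i'] apre[OF pre[OF A]] pre[OF C]])
      also have "\<dots> \<le> sd ?P ?E (?act (A \<times> UNIV)) + sd ?P (?act (A \<times> UNIV)) (?pre n C)"
        by (intro sd_triangle pP apre pre rect A C)
      also have "sd ?P ?E (?act (A \<times> UNIV)) = sd ?P (?pre n A) (A \<times> UNIV)"
        by (rule sd_vimage[OF act_mp[OF x'] pre[OF A] rect[OF A]])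
      also have "sd ?P (?act (A \<times> UNIV)) (?pre n C) \<le> sd ?P (?act (A \<times> UNIV)) (C \<times> UNIV) + sd ?P (C \<times> UNIV) (?pre n C)"
        by (intro sd_triangle pP apre pre rect A C)
      also have "sd ?P (?act (A \<times> UNIV)) (C \<times> UNIV) \<le> e + ?m" by (rule mid)
      also have "sd ?P (C \<times> UNIV) (?pre n C) = sd ?P (?pre n C) (C \<times> UNIV)" by (rule sd_commute)
      finally show ?thesis by simp
    qed
    have "(\<lambda>n. sd ?P (?pre n A) (A \<times> UNIV) + (e + ?m) + sd ?P (?pre n C) (C \<times> UNIV)) \<longlonglongrightarrow> 0 + (e + ?m) + 0"
      by (intro tendsto_add lim A C tendsto_const)
    then have "eventually (\<lambda>n. sd ?P (?pre n A) (A \<times> UNIV) + (e + ?m) + sd ?P (?pre n C) (C \<times> UNIV) < e + ?m + e') sequentially"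
      by (rule order_tendstoD) (use e in simp)
    then show "eventually (\<lambda>n. sd M (aut_image M (p n x) A) C < e + ?m + e') sequentially"
      by eventually_elim (rule le_less_trans[OF key])
  qed
qed

subsection \<open>Approximation by restricted homomorphisms\<close>

text \<open>
  The open set of all \<open>s\<close> near \<open>p1\<close> lies in the closure of the restrictions of the homomorphisms
  near \<open>p\<close>.
\<close>

definition nearby_extensions :: "'a measure \<Rightarrow> ('g, 'm) monoid_scheme \<Rightarrow> 'g set \<Rightarrow>
    ('g \<Rightarrow> ('a \<Rightarrow> 'a) set) \<Rightarrow> 'g set \<Rightarrow> 'a set set \<Rightarrow> real \<Rightarrow> bool" where
  "nearby_extensions M L D p F As e \<longleftrightarrow>
     (\<exists>p1 D' As' d. p1 \<in> hom (L\<lparr>carrier := D\<rparr>) (Aut M) \<and> finite D' \<and> D' \<subseteq> D \<and>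
        finite As' \<and> As' \<subseteq> sets M \<and> d > (0::real) \<and>
        (\<forall>s S Bs e'. s \<in> hom (L\<lparr>carrier := D\<rparr>) (Aut M) \<longrightarrow>
          (\<forall>l\<in>D'. \<forall>A\<in>As'. sd M (aut_image M (s l) A) (aut_image M (p1 l) A) < d) \<longrightarrow>
          finite S \<longrightarrow> S \<subseteq> D \<longrightarrow> finite Bs \<longrightarrow> Bs \<subseteq> sets M \<longrightarrow> e' > (0::real) \<longrightarrow>
          (\<exists>p'\<in>hom L (Aut M).
            (\<forall>l\<in>F. \<forall>A\<in>As. sd M (aut_image M (p' l) A) (aut_image M (p l) A) < e) \<and>
            (\<forall>l\<in>S. \<forall>B\<in>Bs. sd M (aut_image M (p' l) B) (aut_image M (s l) B) < e'))))"

text \<open>Each of the finitely many conditions holds for all large n, hence all hold at a common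
  n. This lets every condition be checked on its own along one sequence.\<close>

lemma nearby_extensionsI:
  assumes "p1 \<in> hom (L\<lparr>carrier := D\<rparr>) (Aut M)" "finite D'" "D' \<subseteq> D" "finite As'" "As' \<subseteq> sets M" "d > 0"
    and "\<And>s S Bs e'. s \<in> hom (L\<lparr>carrier := D\<rparr>) (Aut M) \<Longrightarrow>
          (\<And>l A. l \<in> D' \<Longrightarrow> A \<in> As' \<Longrightarrow> sd M (aut_image M (s l) A) (aut_image M (p1 l) A) < d) \<Longrightarrow>
          finite S \<Longrightarrow> S \<subseteq> D \<Longrightarrow> finite Bs \<Longrightarrow> Bs \<subseteq> sets M \<Longrightarrow> e' > 0 \<Longrightarrow>
          \<exists>q. (\<forall>n. q n \<in> hom L (Aut M)) \<and>
            (\<forall>l\<in>F. \<forall>A\<in>As. eventually (\<lambda>n. sd M (aut_image M (q n l) A) (aut_image M (p l) A) < e) sequentially) \<and>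
            (\<forall>l\<in>S. \<forall>B\<in>Bs. eventually (\<lambda>n. sd M (aut_image M (q n l) B) (aut_image M (s l) B) < e') sequentially)"
    and F: "finite F" "finite As"
  shows "nearby_extensions M L D p F As e"
  unfolding nearby_extensions_def
proof (intro exI conjI allI impI)
  fix s S Bs and e' :: real
  assume s: "s \<in> hom (L\<lparr>carrier := D\<rparr>) (Aut M)"
    "\<forall>l\<in>D'. \<forall>A\<in>As'. sd M (aut_image M (s l) A) (aut_image M (p1 l) A) < d"
    "finite S" "S \<subseteq> D" "finite Bs" "Bs \<subseteq> sets M" "e' > 0"
  have "\<exists>q. (\<forall>n. q n \<in> hom L (Aut M)) \<and>
      (\<forall>l\<in>F. \<forall>A\<in>As. eventually (\<lambda>n. sd M (aut_image M (q n l) A) (aut_image M (p l) A) < e) sequentially) \<and>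
      (\<forall>l\<in>S. \<forall>B\<in>Bs. eventually (\<lambda>n. sd M (aut_image M (q n l) B) (aut_image M (s l) B) < e') sequentially)"
    by (rule assms(7)[OF s(1) _ s(3-7)]) (use s(2) in simp)
  then obtain q where q: "\<forall>n. q n \<in> hom L (Aut M)"
    "\<forall>l\<in>F. \<forall>A\<in>As. eventually (\<lambda>n. sd M (aut_image M (q n l) A) (aut_image M (p l) A) < e) sequentially"
    "\<forall>l\<in>S. \<forall>B\<in>Bs. eventually (\<lambda>n. sd M (aut_image M (q n l) B) (aut_image M (s l) B) < e') sequentially"
    by (elim exE conjE)
  have "eventually (\<lambda>n. (\<forall>l\<in>F. \<forall>A\<in>As. sd M (aut_image M (q n l) A) (aut_image M (p l) A) < e) \<and>
      (\<forall>l\<in>S. \<forall>B\<in>Bs. sd M (aut_image M (q n l) B) (aut_image M (s l) B) < e')) sequentially"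
    using q(2,3) F s(3,5) by (intro eventually_conj eventually_ball_finite ballI) auto
  then obtain n where "(\<forall>l\<in>F. \<forall>A\<in>As. sd M (aut_image M (q n l) A) (aut_image M (p l) A) < e) \<and>
      (\<forall>l\<in>S. \<forall>B\<in>Bs. sd M (aut_image M (q n l) B) (aut_image M (s l) B) < e')"
    using eventually_happens'[OF sequentially_bot] by blast
  then show "\<exists>p'\<in>hom L (Aut M).
      (\<forall>l\<in>F. \<forall>A\<in>As. sd M (aut_image M (p' l) A) (aut_image M (p l) A) < e) \<and>
      (\<forall>l\<in>S. \<forall>B\<in>Bs. sd M (aut_image M (p' l) B) (aut_image M (s l) B) < e')"
    using q(1) by (intro bexI[of _ "q n"]) auto
qed (rule assms)+

lemma tower_sets:
  assumes "tower G m X c"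
  shows "{k. P (c k)} \<in> sets torus"
  using tower_rot_sets[OF assms, of "\<lambda>_. P"] .

lemma measure_subset_defect:
  assumes "tower G m X c" "B \<subseteq> defect G X c x"
  shows "measure torus B \<le> measure torus (defect G X c x)"
proof -
  interpret T: prob_space torus by (rule prob_space_torus)
  show ?thesis by (rule T.finite_measure_mono[OF assms(2) defect_sets[OF assms(1)]])
qed

lemma hom_cong_restrict:
  assumes "p \<in> hom L G" "subgroup D L"
  shows "p \<in> hom (L\<lparr>carrier := D\<rparr>) G"
  using assms subgroup.subset[OF assms(2)] by (auto simp: hom_def Pi_iff subset_iff)

section \<open>The case of a finite \<Delta>\<close>

context comm_group
begin

text \<open>In a commutative group, adjoining an element of order n adds at most n translates of the
  subgroup, so finiteness survives each generator.\<close>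

lemma finite_generate_torsion:
  assumes S: "finite S" "S \<subseteq> carrier G" and tor: "\<And>x. x \<in> generate G S \<Longrightarrow> \<exists>n>0. x [^] int n = \<one>"
  shows "finite (generate G S)"
  using S tor
proof (induction S)
  case empty
  then show ?case by (simp add: generate_empty)
next
  case (insert g S)
  have g: "g \<in> carrier G" and SG: "S \<subseteq> carrier G" using insert.prems by auto
  note H = generate_is_subgroup[OF SG]
  have "generate G S \<subseteq> generate G (insert g S)" by (rule mono_generate) auto
  then have fin: "finite (generate G S)" using insert.IH[OF SG] insert.prems(2) by blast
  have "g \<in> generate G (insert g S)" by (auto intro: generate.incl)
  then obtain n where n: "n > 0" "g [^] int n = \<one>" using insert.prems(2) by blast
  have "adjoin G (generate G S) g \<subseteq> (\<lambda>(h, j). h \<otimes> g [^] int j) ` (generate G S \<times> {..<n})"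
  proof
    fix x assume "x \<in> adjoin G (generate G S) g"
    then obtain h k where x: "x = h \<otimes> g [^] (k::int)" "h \<in> generate G S" by (auto simp: adjoin_def)
    have "k = int n * (k div int n) + int (nat (k mod int n))" using n(1) by simp
    then have "g [^] k = (g [^] int n) [^] (k div int n) \<otimes> g [^] int (nat (k mod int n))"
      using int_pow_mult[OF g, of "int n * (k div int n)" "int (nat (k mod int n))"] int_pow_pow[OF g, of "int n" "k div int n"]
      by (simp only:)
    then have "g [^] k = g [^] int (nat (k mod int n))" using g n(2) by simp
    moreover have "nat (k mod int n) < n" using n(1) by (simp add: nat_less_iff)
    ultimately show "x \<in> (\<lambda>(h, j). h \<otimes> g [^] int j) ` (generate G S \<times> {..<n})"
      using x by (intro image_eqI[of _ _ "(h, nat (k mod int n))"]) auto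
  qed
  then have "finite (adjoin G (generate G S) g)" by (rule finite_subset) (use fin in simp)
  moreover have "generate G (insert g S) \<subseteq> adjoin G (generate G S) g"
  proof (rule generate_subgroup_incl)
    show "insert g S \<subseteq> adjoin G (generate G S) g"
      using subgroup_adjoin[OF H g] by (auto intro: generate.incl)
  qed (rule subgroup_adjoin[OF H g])
  ultimately show ?case by (rule finite_subset[rotated])
qed

text \<open>With g d = s(d) p(d)\<inverse>, the cocycle of \<open>l\<close> is g(d) p(l)
  g(d')\<inverse> for certain d, d' \<in> D, at every point of the torus. Every such
  \<open>g d\<close> nearly fixes the relevant sets because all of \<open>D\<close> is tested, so
  closeness to \<open>p\<close> is uniform. The tower has to be precise only on \<open>S\<close>,
  where the cocycle becomes \<open>s l\<close> off the defect.\<close>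

lemma nearby_extensions_finite:
  fixes M :: "'c measure"
  assumes M: "standard_atomless_prob_space M" and count: "countable (carrier G)"
    and S0: "finite S0" "S0 \<subseteq> carrier G" and D: "D = generate G S0" and finD: "finite D"
    and p: "p \<in> hom G (Aut M)" and F: "finite F" "F \<subseteq> carrier G" and As: "finite As" "As \<subseteq> sets M" and e: "e > 0"
  shows "nearby_extensions M G D p F As e"
proof -
  interpret A: group "Aut M" by (rule group_Aut)
  have pM: "prob_space M" using M by (simp add: standard_atomless_prob_space_def)
  let ?im = "aut_image M"
  have Dsub: "subgroup D G" unfolding D by (rule generate_is_subgroup[OF S0(2)])
  have Dc: "d \<in> carrier G" if "d \<in> D" for d using subgroup.mem_carrier[OF Dsub that] .
  have pc: "p x \<in> carrier (Aut M)" if "x \<in> carrier G" for x using p that by (auto simp: hom_def)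
  have pm: "p (x \<otimes> y) = p x \<otimes>\<^bsub>Aut M\<^esub> p y" if "x \<in> carrier G" "y \<in> carrier G" for x y
    using p that by (simp add: hom_def)
  have pinv: "p (inv x) = inv\<^bsub>Aut M\<^esub> (p x)" if "x \<in> carrier G" for x
    using group_hom.hom_inv[of G "Aut M" p x] p that by (simp add: group_hom_def group_hom_axioms_def group_Aut)
  have AsC: "A \<in> sets (completion M)" if "A \<in> As" for A using As that by auto
  \<comment> \<open>\<open>g d\<close> moves the image of A under \<open>p l\<close> as little as
    \<open>s d\<close> and \<open>p d\<close> differ on that image carried back by
    \<open>p d\<close>. Hence these sets are tested too, each replaced by an almost equal member of
    \<open>sets M\<close>.\<close>
  define As' where "As' = As \<union> (\<lambda>(d, l, A). main_part M (?im (p (inv d)) (?im (p l) A))) ` (D \<times> F \<times> As)"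
  have imC: "?im (p (inv d)) (?im (p l) A) \<in> sets (completion M)" "?im (p l) A \<in> sets (completion M)"
    if "d \<in> D" "l \<in> F" "A \<in> As" for d l A
    using that Dc F(2) pc AsC by (auto intro!: aut_image_sets)
  \<comment> \<open>Two units for the two corrections around \<open>p l\<close>, a third for the
    passage to the limit; the bound 3 e1 is below \<open>e\<close>.\<close>
  define e1 where "e1 = e / 4"
  have e1: "e1 > 0" using e by (simp add: e1_def)
  show ?thesis
  proof (rule nearby_extensionsI)
    show "p \<in> hom (G\<lparr>carrier := D\<rparr>) (Aut M)" by (rule hom_cong_restrict[OF p Dsub])
    show "finite D" "D \<subseteq> D" by (rule finD, rule subset_refl)
    show "finite As'" using finD F As by (simp add: As'_def)
    show "As' \<subseteq> sets M" using As imC by (auto simp: As'_def)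
    show "e1 > 0" by (rule e1)
    show "finite F" "finite As" by (rule F, rule As)
    fix s S Bs and e' :: real
    assume s: "s \<in> hom (G\<lparr>carrier := D\<rparr>) (Aut M)"
      and near: "\<And>l A. l \<in> D \<Longrightarrow> A \<in> As' \<Longrightarrow> sd M (?im (s l) A) (?im (p l) A) < e1"
      and S: "finite S" "S \<subseteq> D" and Bs: "finite Bs" "Bs \<subseteq> sets M" and e': "e' > 0"
    have sc: "s x \<in> carrier (Aut M)" if "x \<in> D" for x using s that by (auto simp: hom_def)
    have sm: "s (x \<otimes> y) = s x \<otimes>\<^bsub>Aut M\<^esub> s y" if "x \<in> D" "y \<in> D" for x y
      using s that by (simp add: hom_def)
    have Dinv: "inv d \<in> D" if "d \<in> D" for d using subgroup.m_inv_closed[OF Dsub that] .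
    have sinv: "s (inv d) = inv\<^bsub>Aut M\<^esub> (s d)" if d: "d \<in> D" for d
    proof -
      interpret H: group "G\<lparr>carrier := D\<rparr>" by (rule subgroup_imp_group[OF Dsub])
      have "s (inv\<^bsub>G\<lparr>carrier := D\<rparr>\<^esub> d) = inv\<^bsub>Aut M\<^esub> (s d)"
        using group_hom.hom_inv[of "G\<lparr>carrier := D\<rparr>" "Aut M" s d] s d
        by (simp add: group_hom_def group_hom_axioms_def group_Aut H.is_group)
      then show ?thesis using m_inv_consistent[OF Dsub d] by simp
    qed
    have e4: "e' / 4 > 0" using e' by simp
    obtain E where E: "finite E" "E \<subseteq> D" "\<And>S' e''. finite S' \<Longrightarrow> S' \<subseteq> {\<one>} \<Longrightarrow> e'' > 0 \<Longrightarrow>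
      \<exists>m X c. tower G m X c \<and> (\<forall>k. \<exists>d\<in>{\<one>}. \<exists>x\<in>E. c k = d \<otimes> x) \<and>
        (\<forall>f\<in>S. measure torus (defect G X c f) < e' / 4) \<and> (\<forall>s\<in>S'. measure torus (defect G X c s) < e'')"
      by (rule relative_towersE[OF relative_towers_fg(1)[OF count S0, folded D] S e4]) auto
    obtain m X c where t: "tower G m X c" and cE: "\<forall>k. \<exists>d\<in>{\<one>}. \<exists>x\<in>E. c k = d \<otimes> x"
      and df: "\<forall>f\<in>S. measure torus (defect G X c f) < e' / 4"
      using E(3)[OF finite.emptyI empty_subsetI zero_less_one] by (elim exE conjE)
    have cD: "c k \<in> D" for k
    proof -
      obtain x where "x \<in> E" "c k = \<one> \<otimes> x" using cE by blast
      then show ?thesis using E(2) Dc by auto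
    qed
    have X: "\<And>i. hom_mod \<int> G (carrier G) (X i)" and cfin: "finite (range c)"
      using t unfolding tower_def by blast+
    define g where "g d = s d \<otimes>\<^bsub>Aut M\<^esub> inv\<^bsub>Aut M\<^esub> (p d)" for d
    have gc: "g d \<in> carrier (Aut M)" if "d \<in> D" for d using that sc pc Dc by (simp add: g_def)
    define f where "f k = g (c k)" for k
    have ffin: "finite (range f)"
      by (rule finite_subset[OF _ finite_imageI[OF cfin, of g]]) (auto simp: f_def)
    have fs: "{k. f k = a} \<in> sets torus" for a unfolding f_def by (rule tower_sets[OF t])
    have fc: "f k \<in> carrier (Aut M)" for k unfolding f_def by (rule gc[OF cD])
    obtain q where q: "\<And>n. q n \<in> hom G (Aut M)"
      and ev: "\<And>x A C e e'. x \<in> carrier G \<Longrightarrow> A \<in> sets (completion M) \<Longrightarrow> C \<in> sets (completion M) \<Longrightarrow> e \<ge> 0 \<Longrightarrow> e' > 0 \<Longrightarrow>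
        eventually (\<lambda>n. sd M (?im (q n x) A) C <
          e + measure torus {k. sd M (?im (cocycle M X f p x k) A) C > e} + e') sequentially"
      by (rule skew_actions[where X = X and f = f and r = p, OF M comm_group_axioms X ffin fs fc p]) blast
    \<comment> \<open>The right factor is controlled on \<open>A\<close> through \<open>s\<close> at
      the inverse of d', the left factor on the image of \<open>A\<close> under
      \<open>p l\<close>.\<close>
    have est: "sd M (?im (cocycle M X f p l k) A) (?im (p l) A) \<le> 2 * e1"
      if l: "l \<in> F" and A: "A \<in> As" for l A k
    proof -
      define d d' where "d = c (shift X l k)" and "d' = c k"
      have d: "d \<in> D" "d' \<in> D" by (simp_all add: d_def d'_def cD)
      have lc: "l \<in> carrier G" using F(2) l by auto
      note C[simp] = gc[OF d(1)] gc[OF d(2)] pc[OF lc] pc[OF Dc[OF d(1)]] pc[OF Dc[OF d(2)]] sc[OF d(1)] sc[OF d(2)] AsC[OF A]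
      let ?u = "inv\<^bsub>Aut M\<^esub> (g d')"
      have imc: "?im x B \<in> sets (completion M)" if "x \<in> carrier (Aut M)" "B \<in> sets (completion M)" for x B
        by (rule aut_image_sets[OF that])
      have z: "sd M (?im (x \<otimes>\<^bsub>Aut M\<^esub> y) B) (?im x (?im y B)) = 0"
        if "x \<in> carrier (Aut M)" "y \<in> carrier (Aut M)" "B \<in> sets (completion M)" for x y B
        by (rule aut_image_mult[OF that])
      have tri: "sd M P R \<le> sd M P Q + sd M Q R"
        if "P \<in> sets (completion M)" "Q \<in> sets (completion M)" "R \<in> sets (completion M)" for P Q R
        by (rule sd_triangle[OF pM that])
      have cancel: "sd M (?im x (?im (inv\<^bsub>Aut M\<^esub> x) B)) B = 0"
        if x: "x \<in> carrier (Aut M)" and B: "B \<in> sets (completion M)" for x B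
      proof -
        have "sd M (?im x (?im (inv\<^bsub>Aut M\<^esub> x) B)) B \<le>
            sd M (?im x (?im (inv\<^bsub>Aut M\<^esub> x) B)) (?im (x \<otimes>\<^bsub>Aut M\<^esub> inv\<^bsub>Aut M\<^esub> x) B) +
            sd M (?im (x \<otimes>\<^bsub>Aut M\<^esub> inv\<^bsub>Aut M\<^esub> x) B) B"
          using x B by (intro tri imc) auto
        also have "\<dots> = 0"
          using x B z[OF x A.inv_closed[OF x] B] aut_image_one[OF B] by (simp add: sd_commute)
        finally show ?thesis using sd_nonneg[of M] by (simp add: order.antisym)
      qed
      have u: "?u = p d' \<otimes>\<^bsub>Aut M\<^esub> s (inv d')"
        using C by (simp add: g_def A.inv_mult_group sinv[OF d(2)])
      have s1: "sd M (?im ?u A) A \<le> e1"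
      proof -
        have si: "s (inv d') \<in> carrier (Aut M)" by (rule sc[OF Dinv[OF d(2)]])
        have ii: "p (inv d') = inv\<^bsub>Aut M\<^esub> (p d')" by (rule pinv[OF Dc[OF d(2)]])
        have "sd M (?im ?u A) A \<le> sd M (?im ?u A) (?im (p d') (?im (s (inv d')) A)) + sd M (?im (p d') (?im (s (inv d')) A)) A"
          using si by (intro tri imc) auto
        also have "sd M (?im ?u A) (?im (p d') (?im (s (inv d')) A)) = 0"
          unfolding u by (rule z) (use si in auto)
        also have "sd M (?im (p d') (?im (s (inv d')) A)) A \<le>
            sd M (?im (p d') (?im (s (inv d')) A)) (?im (p d') (?im (p (inv d')) A)) + sd M (?im (p d') (?im (p (inv d')) A)) A"
          using si ii by (intro tri imc) auto
        also have "sd M (?im (p d') (?im (p (inv d')) A)) A = 0"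
          unfolding ii by (rule cancel) auto
        also have "sd M (?im (p d') (?im (s (inv d')) A)) (?im (p d') (?im (p (inv d')) A)) =
            sd M (?im (s (inv d')) A) (?im (p (inv d')) A)"
          using si ii by (intro sd_aut_image imc) auto
        also have "\<dots> \<le> e1" using near[OF Dinv[OF d(2)], of A] A by (simp add: As'_def)
        finally show ?thesis by simp
      qed
      define B where "B = ?im (p l) A"
      define B' where "B' = main_part M (?im (p (inv d)) B)"
      have B: "B \<in> sets (completion M)" unfolding B_def by (rule imC(2)[OF d(1) l A])
      have pB: "?im (p (inv d)) B \<in> sets (completion M)" unfolding B_def by (rule imC(1)[OF d(1) l A])
      have B': "B' \<in> As'" "B' \<in> sets (completion M)"
        using d l A pB by (auto simp: As'_def B'_def B_def intro!: image_eqI[of _ _ "(d, l, A)"])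
      have BB': "sd M (?im (p (inv d)) B) B' = 0"
      proof (rule sd_AE_zero)
        show "AE x in M. x \<in> ?im (p (inv d)) B \<longleftrightarrow> x \<in> B'"
          using AE_in_main_part[OF pB] unfolding B'_def by eventually_elim auto
      qed (use pB B' in auto)
      have ii: "p (inv d) = inv\<^bsub>Aut M\<^esub> (p d)" by (rule pinv[OF Dc[OF d(1)]])
      have s2: "sd M (?im (g d) B) B \<le> e1"
      proof -
        have "sd M (?im (g d) B) B \<le> sd M (?im (g d) B) (?im (s d) (?im (p (inv d)) B)) + sd M (?im (s d) (?im (p (inv d)) B)) B"
          using B ii by (intro tri imc) auto
        also have "sd M (?im (g d) B) (?im (s d) (?im (p (inv d)) B)) = 0"
          unfolding g_def ii by (rule z) (use B in auto)
        also have "sd M (?im (s d) (?im (p (inv d)) B)) B \<le> sd M (?im (s d) (?im (p (inv d)) B)) (?im (s d) B') + sd M (?im (s d) B') B"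
          using B B' pB ii by (intro tri imc) auto
        also have "sd M (?im (s d) (?im (p (inv d)) B)) (?im (s d) B') = 0"
          using sd_aut_image[OF sc[OF d(1)] pB B'(2)] BB' by simp
        also have "sd M (?im (s d) B') B \<le> sd M (?im (s d) B') (?im (p d) B') + sd M (?im (p d) B') B"
          using B B' by (intro tri imc) auto
        also have "sd M (?im (s d) B') (?im (p d) B') \<le> e1" using near[OF d(1) B'(1)] by simp
        also have "sd M (?im (p d) B') B \<le> sd M (?im (p d) B') (?im (p d) (?im (p (inv d)) B)) + sd M (?im (p d) (?im (p (inv d)) B)) B"
          using B B' pB ii by (intro tri imc) auto
        also have "sd M (?im (p d) B') (?im (p d) (?im (p (inv d)) B)) = 0"
          using sd_aut_image[OF pc[OF Dc[OF d(1)]] B'(2) pB] BB' by (simp add: sd_commute)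
        also have "sd M (?im (p d) (?im (p (inv d)) B)) B = 0"
          unfolding ii by (rule cancel) (use B in auto)
        finally show ?thesis by simp
      qed
      have co: "cocycle M X f p l k = (g d \<otimes>\<^bsub>Aut M\<^esub> p l) \<otimes>\<^bsub>Aut M\<^esub> ?u"
        by (simp add: cocycle_def f_def d_def d'_def)
      have uc: "?u \<in> carrier (Aut M)" "g d \<otimes>\<^bsub>Aut M\<^esub> p l \<in> carrier (Aut M)" by auto
      have "sd M (?im (cocycle M X f p l k) A) B \<le>
          sd M (?im (cocycle M X f p l k) A) (?im (g d \<otimes>\<^bsub>Aut M\<^esub> p l) (?im ?u A)) +
          sd M (?im (g d \<otimes>\<^bsub>Aut M\<^esub> p l) (?im ?u A)) B"
        using uc B unfolding co by (intro tri imc) auto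
      also have "sd M (?im (cocycle M X f p l k) A) (?im (g d \<otimes>\<^bsub>Aut M\<^esub> p l) (?im ?u A)) = 0"
        unfolding co by (rule z) (use uc in auto)
      also have "sd M (?im (g d \<otimes>\<^bsub>Aut M\<^esub> p l) (?im ?u A)) B \<le>
          sd M (?im (g d \<otimes>\<^bsub>Aut M\<^esub> p l) (?im ?u A)) (?im (g d \<otimes>\<^bsub>Aut M\<^esub> p l) A) +
          sd M (?im (g d \<otimes>\<^bsub>Aut M\<^esub> p l) A) B"
        using uc B by (intro tri imc) auto
      also have "sd M (?im (g d \<otimes>\<^bsub>Aut M\<^esub> p l) (?im ?u A)) (?im (g d \<otimes>\<^bsub>Aut M\<^esub> p l) A) = sd M (?im ?u A) A"
        using uc by (intro sd_aut_image imc) auto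
      also have "sd M (?im (g d \<otimes>\<^bsub>Aut M\<^esub> p l) A) B \<le>
          sd M (?im (g d \<otimes>\<^bsub>Aut M\<^esub> p l) A) (?im (g d) B) + sd M (?im (g d) B) B"
        using uc B by (intro tri imc) auto
      also have "sd M (?im (g d \<otimes>\<^bsub>Aut M\<^esub> p l) A) (?im (g d) B) = 0"
        unfolding B_def by (rule z) auto
      finally show ?thesis using s1 s2 by (simp add: B_def)
    qed
    show "\<exists>q. (\<forall>n. q n \<in> hom G (Aut M)) \<and>
      (\<forall>l\<in>F. \<forall>A\<in>As. eventually (\<lambda>n. sd M (?im (q n l) A) (?im (p l) A) < e) sequentially) \<and>
      (\<forall>l\<in>S. \<forall>B\<in>Bs. eventually (\<lambda>n. sd M (?im (q n l) B) (?im (s l) B) < e') sequentially)"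
    proof (intro exI[of _ q] conjI ballI allI q)
      fix l A assume l: "l \<in> F" and A: "A \<in> As"
      have lc: "l \<in> carrier G" using F(2) l by auto
      have "{k. sd M (?im (cocycle M X f p l k) A) (?im (p l) A) > 2 * e1} = {}"
        using est[OF l A] by (auto simp: not_less)
      then have "eventually (\<lambda>n. sd M (?im (q n l) A) (?im (p l) A) < 2 * e1 + 0 + e1) sequentially"
        using ev[OF lc AsC[OF A] aut_image_sets[OF pc[OF lc] AsC[OF A]], of "2 * e1" e1] e1 by simp
      then show "eventually (\<lambda>n. sd M (?im (q n l) A) (?im (p l) A) < e) sequentially"
        by eventually_elim (use e in \<open>simp add: e1_def\<close>)
    next
      fix l B assume l: "l \<in> S" and B: "B \<in> Bs"
      have lD: "l \<in> D" and BC: "B \<in> sets (completion M)" using S Bs l B by auto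
      \<comment> \<open>Off the defect the tower advances by \<open>l\<close>. As the images under
        \<open>p\<close> commute, and so do those under \<open>s\<close>, all factors except
        \<open>s l\<close> cancel.\<close>
      have same: "cocycle M X f p l k = s l" if "k \<notin> defect G X c l" for k
      proof -
        have ck: "c (shift X l k) = c k \<otimes> l" using that by (simp add: defect_def)
        note C = sc[OF lD] sc[OF cD[of k]] pc[OF Dc[OF lD]] pc[OF Dc[OF cD[of k]]]
        have com: "p l \<otimes>\<^bsub>Aut M\<^esub> p (c k) = p (c k) \<otimes>\<^bsub>Aut M\<^esub> p l" "s l \<otimes>\<^bsub>Aut M\<^esub> s (c k) = s (c k) \<otimes>\<^bsub>Aut M\<^esub> s l"
          using pm[OF Dc[OF lD] Dc[OF cD[of k]]] pm[OF Dc[OF cD[of k]] Dc[OF lD]]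
            sm[OF lD cD[of k]] sm[OF cD[of k] lD] m_comm[OF Dc[OF lD] Dc[OF cD[of k]]] by simp_all
        have "cocycle M X f p l k = (s l \<otimes>\<^bsub>Aut M\<^esub> s (c k)) \<otimes>\<^bsub>Aut M\<^esub> inv\<^bsub>Aut M\<^esub> (p l \<otimes>\<^bsub>Aut M\<^esub> p (c k)) \<otimes>\<^bsub>Aut M\<^esub> p l \<otimes>\<^bsub>Aut M\<^esub>
            inv\<^bsub>Aut M\<^esub> (s (c k) \<otimes>\<^bsub>Aut M\<^esub> inv\<^bsub>Aut M\<^esub> (p (c k)))"
          by (simp only: cocycle_def f_def g_def ck com sm[OF cD lD] pm[OF Dc[OF cD] Dc[OF lD]])
        also have "\<dots> = s l"
        proof -
          have "inv\<^bsub>Aut M\<^esub> (p l \<otimes>\<^bsub>Aut M\<^esub> p (c k)) \<otimes>\<^bsub>Aut M\<^esub> p l = inv\<^bsub>Aut M\<^esub> (p (c k))"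
            using C by (simp add: A.inv_mult_group A.m_assoc)
          moreover have "inv\<^bsub>Aut M\<^esub> (s (c k) \<otimes>\<^bsub>Aut M\<^esub> inv\<^bsub>Aut M\<^esub> (p (c k))) = p (c k) \<otimes>\<^bsub>Aut M\<^esub> inv\<^bsub>Aut M\<^esub> (s (c k))"
            using C by (simp add: A.inv_mult_group)
          moreover have "inv\<^bsub>Aut M\<^esub> (p (c k)) \<otimes>\<^bsub>Aut M\<^esub> (p (c k) \<otimes>\<^bsub>Aut M\<^esub> inv\<^bsub>Aut M\<^esub> (s (c k))) = inv\<^bsub>Aut M\<^esub> (s (c k))"
            using C by (simp flip: A.m_assoc)
          ultimately show ?thesis using C by (simp add: A.m_assoc)
        qed
        finally show ?thesis .
      qed
      have "measure torus {k. sd M (?im (cocycle M X f p l k) B) (?im (s l) B) > 0} \<le> measure torus (defect G X c l)"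
        by (rule measure_subset_defect[OF t]) (use same in force)
      also have "\<dots> < e' / 4" using df l by blast
      finally have small: "measure torus {k. sd M (?im (cocycle M X f p l k) B) (?im (s l) B) > 0} < e' / 4" .
      have "eventually (\<lambda>n. sd M (?im (q n l) B) (?im (s l) B) <
          0 + measure torus {k. sd M (?im (cocycle M X f p l k) B) (?im (s l) B) > 0} + e' / 4) sequentially"
        by (rule ev[OF Dc[OF lD] BC aut_image_sets[OF sc[OF lD] BC]]) (use e' in auto)
      then show "eventually (\<lambda>n. sd M (?im (q n l) B) (?im (s l) B) < e') sequentially"
        by eventually_elim (use small e' in linarith)
    qed
  qed
qed

end

section \<open>The case of an element of infinite order in \<Delta>\<close>

context comm_group
begin

text \<open>Exact additivity, and not only modulo integers, is what keeps any real multiple of the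
  map additive; such multiples serve to perturb characters.\<close>

lemma hom_mod_zero_value:
  assumes count: "countable (carrier G)" and z: "z \<in> carrier G" "\<And>k::int. z [^] k = \<one> \<Longrightarrow> k = 0"
  obtains f where "\<And>x y. x \<in> carrier G \<Longrightarrow> y \<in> carrier G \<Longrightarrow> f (x \<otimes> y) = f x + f y" "f z = (1::real)"
proof -
  have N: "add_subgroup {0}" by (simp add: add_subgroup_def)
  have f0: "hom_mod {0} G {\<one>} (\<lambda>_. 0)" by (simp add: hom_mod_def)
  have v: "1 * of_int k - 0 \<in> {0::real}" if "z [^] k \<in> {\<one>}" for k :: int using z(2)[of k] that by simp
  obtain f where f: "hom_mod {0} G (carrier G) f" "f z - 1 \<in> {0}"
    by (rule hom_mod_extend_value[OF N triv_subgroup f0 count z(1) v]) blast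
  have "f (x \<otimes> y) - f x - f y = 0" if "x \<in> carrier G" "y \<in> carrier G" for x y
    using f(1) that by (simp add: hom_mod_def)
  then have "f (x \<otimes> y) = f x + f y" if "x \<in> carrier G" "y \<in> carrier G" for x y
    using that by (simp add: algebra_simps)
  then show ?thesis by (rule that) (use f(2) in simp_all)
qed

text \<open>Two towers are used. The first, \<open>c0\<close>, is fixed at once and yields
  \<open>p1\<close>: an element of \<open>D\<close> that rotates almost like \<open>l\<close> moves
  \<open>c0\<close> almost as \<open>l\<close> does, so \<open>p1\<close> sends it near
  \<open>p l\<close>. The second, \<open>c\<close>, is chosen after \<open>s\<close> and enters
  through \<open>r \<circ> c\<close>: off its defect, \<open>l\<close> acts on the fibre by
  \<open>s\<close> of a step of \<open>r\<close>, and such a step is one of the tested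
  elements.\<close>

lemma nearby_extensions_infinite:
  fixes M :: "'c measure"
  assumes M: "standard_atomless_prob_space M" and count: "countable (carrier G)"
    and S0: "finite S0" "S0 \<subseteq> carrier G" and D: "D = generate G S0"
    and z: "z \<in> D" "\<forall>k::int. z [^] k = \<one> \<longrightarrow> k = 0"
    and p: "p \<in> hom G (Aut M)" and F: "finite F" "F \<subseteq> carrier G" and As: "finite As" "As \<subseteq> sets M" and e: "e > 0"
  shows "nearby_extensions M G D p F As e"
proof -
  interpret A: group "Aut M" by (rule group_Aut)
  interpret T: prob_space torus by (rule prob_space_torus)
  have pM: "prob_space M" using M by (simp add: standard_atomless_prob_space_def)
  let ?im = "aut_image M"
  have Dsub: "subgroup D G" unfolding D by (rule generate_is_subgroup[OF S0(2)])
  have Dc: "d \<in> carrier G" if "d \<in> D" for d using subgroup.mem_carrier[OF Dsub that] .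
  have Dm: "x \<otimes> y \<in> D" if "x \<in> D" "y \<in> D" for x y using subgroup.m_closed[OF Dsub that] .
  have Dinv: "inv x \<in> D" if "x \<in> D" for x using subgroup.m_inv_closed[OF Dsub that] .
  have zc: "z \<in> carrier G" by (rule Dc[OF z(1)])
  have zD: "z [^] (k::int) \<in> D" for k by (rule subgroup_int_pow_closed[OF Dsub z(1)])
  have pc: "p x \<in> carrier (Aut M)" if "x \<in> carrier G" for x using p that by (auto simp: hom_def)
  have pm: "p (x \<otimes> y) = p x \<otimes>\<^bsub>Aut M\<^esub> p y" if "x \<in> carrier G" "y \<in> carrier G" for x y
    using p that by (simp add: hom_def)
  have AsC: "A \<in> sets (completion M)" if "A \<in> As" for A using As that by auto
  have Fc: "l \<in> carrier G" if "l \<in> F" for l using F(2) that by auto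
  \<comment> \<open>The distance from \<open>p1 d\<close> to \<open>p l\<close> costs 3 units, from
    \<open>s d\<close> to \<open>p1 d\<close> one more, the defect of the second tower and its limit
    one each: 6 e1 < e.\<close>
  define e1 where "e1 = e / 8"
  have e1: "e1 > 0" using e by (simp add: e1_def)
  obtain lam where lam: "\<And>x y. x \<in> carrier G \<Longrightarrow> y \<in> carrier G \<Longrightarrow> lam (x \<otimes> y) = lam x + lam y" "lam z = (1::real)"
    by (rule hom_mod_zero_value[OF count zc z(2)[rule_format]]) blast+
  text \<open>The rotation of the first tower is perturbed along \<open>lam\<close> until the multiples of \<open>z\<close> become dense.\<close>
  obtain H0 where H0: "F \<subseteq> H0" "relative_towers G {\<one>} H0"
    using relative_towers_extend[OF count F subset_refl triv_subgroup relative_towers_trivial] by blast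
  obtain E0 where E0: "\<And>S e'. finite S \<Longrightarrow> S \<subseteq> {\<one>} \<Longrightarrow> e' > 0 \<Longrightarrow>
      \<exists>m X c. tower G m X c \<and> (\<forall>k. \<exists>d\<in>{\<one>}. \<exists>x\<in>E0. c k = d \<otimes> x) \<and>
        (\<forall>f\<in>F. measure torus (defect G X c f) < e1) \<and> (\<forall>s\<in>S. measure torus (defect G X c s) < e')"
    by (rule relative_towersE[OF H0(2) F(1) H0(1) e1]) blast
  obtain m0 X0 c0 where t0: "tower G m0 X0 c0" and df0: "\<forall>f\<in>F. measure torus (defect G X0 c0 f) < e1"
    using E0[OF finite.emptyI empty_subsetI zero_less_one] by (elim exE conjE)
  have X0: "\<And>i. hom_mod \<int> G (carrier G) (X0 i)" and c0: "\<And>k. c0 k \<in> carrier G" and c0fin: "finite (range c0)"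
    and c0cont: "\<forall>e>0. \<exists>d>0. \<forall>t. (\<forall>i<m0. \<exists>j::int. \<bar>t i - of_int j\<bar> < d) \<longrightarrow> measure torus {k. c0 (rot t k) \<noteq> c0 k} < e"
    using t0 unfolding tower_def by blast+
  obtain d0 where d0: "d0 > 0" "\<And>t. (\<forall>i<m0. \<exists>j::int. \<bar>t i - of_int j\<bar> < d0) \<Longrightarrow> measure torus {k. c0 (rot t k) \<noteq> c0 k} < e1"
    using c0cont[rule_format, OF e1] by blast
  define K where "K = (\<Sum>l\<in>F. \<bar>lam l\<bar>)"
  have K0: "K \<ge> 0" by (simp add: K_def sum_nonneg)
  have K: "\<bar>lam l\<bar> \<le> K" if "l \<in> F" for l
    unfolding K_def using F that by (intro member_le_sum) auto
  \<comment> \<open>A step of \<open>r\<close> carries two retraction errors below \<eta> and a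
    perturbation of at most K \<eta>, so its rotation is off by less than (K + 2) \<eta>; the
    denominator K + 3 keeps this below \<open>d0\<close>.\<close>
  define \<eta> where "\<eta> = d0 / (K + 3)"
  have \<eta>: "\<eta> > 0" "(K + 2) * \<eta> < d0"
  proof -
    show "\<eta> > 0" using d0 K0 by (simp add: \<eta>_def)
    moreover have "(K + 3) * \<eta> = d0" using K0 by (simp add: \<eta>_def)
    ultimately show "(K + 2) * \<eta> < d0" by (simp add: algebra_simps)
  qed
  obtain v where v: "\<And>i. i < m0 \<Longrightarrow> \<bar>v i\<bar> < \<eta>"
    and dense: "\<And>t. \<exists>n::nat. \<forall>i<m0. \<exists>j::int. \<bar>real n * (X0 i z + v i) - t i - of_int j\<bar> < \<eta>"
    by (rule dense_multiples[OF \<eta>(1), of m0 "\<lambda>i. X0 i z"]) blast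
  \<comment> \<open>As \<open>lam z = 1\<close>, the rotation of \<open>z\<close> becomes exactly
    the perturbed vector; that of \<open>l\<close> in \<open>F\<close> moves by at most K \<eta> in
    the first \<open>m0\<close> coordinates.\<close>
  define X1 where "X1 i x = X0 i x + lam x * v i" for i x
  have X1: "hom_mod \<int> G (carrier G) (X1 i)" for i
    using X0[of i] lam(1) by (simp add: hom_mod_def X1_def algebra_simps)
  have X1m: "X1 i (x \<otimes> y) - X1 i x - X1 i y \<in> \<int>" if "x \<in> carrier G" "y \<in> carrier G" for i x y
    using X1[of i] that by (simp add: hom_mod_def)
  have "\<exists>n::nat. \<forall>i<m0. \<exists>j::int. \<bar>X1 i (z [^] int n) - X1 i x - of_int j\<bar> < \<eta>" for x
  proof -
    obtain n where n: "\<forall>i<m0. \<exists>j::int. \<bar>real n * (X0 i z + v i) - X1 i x - of_int j\<bar> < \<eta>"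
      using dense[of "\<lambda>i. X1 i x"] by blast
    have "\<exists>j::int. \<bar>X1 i (z [^] int n) - X1 i x - of_int j\<bar> < \<eta>" if i: "i < m0" for i
    proof -
      obtain j :: int where j: "\<bar>real n * (X0 i z + v i) - X1 i x - of_int j\<bar> < \<eta>" using n i by blast
      have "X1 i (z [^] int n) - of_int (int n) * X1 i z \<in> \<int>"
        by (rule hom_mod_int_pow[OF add_subgroup_Ints subgroup_self X1 zc])
      then obtain j' :: int where "X1 i (z [^] int n) - real n * X1 i z = of_int j'" by (auto elim: Ints_cases)
      then have "X1 i (z [^] int n) - X1 i x - of_int (j + j') = real n * (X0 i z + v i) - X1 i x - of_int j"
        by (simp add: X1_def lam(2))
      with j show ?thesis by (intro exI[of _ "j + j'"]) simp
    qed
    then show ?thesis by blast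
  qed
  then obtain nz where nz: "\<And>x i. i < m0 \<Longrightarrow> \<exists>j::int. \<bar>X1 i (z [^] int (nz x)) - X1 i x - of_int j\<bar> < \<eta>" by metis
  obtain H where H: "subgroup H G" "F \<subseteq> H" "relative_towers G D H"
    using relative_towers_extend[OF count F subset_refl Dsub relative_towers_fg(2)[OF count S0, folded D]] by blast
  obtain E where E: "finite E" "E \<subseteq> H" "\<And>S e'. finite S \<Longrightarrow> S \<subseteq> D \<Longrightarrow> e' > 0 \<Longrightarrow>
      \<exists>m X c. tower G m X c \<and> (\<forall>k. \<exists>d\<in>D. \<exists>x\<in>E. c k = d \<otimes> x) \<and>
        (\<forall>f\<in>F. measure torus (defect G X c f) < e1) \<and> (\<forall>s\<in>S. measure torus (defect G X c s) < e')"
    by (rule relative_towersE[OF H(3) F(1) H(2) e1]) blast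
  have Ec: "x \<in> carrier G" if "x \<in> E" for x using E(2) subgroup.mem_carrier[OF H(1)] that by auto
  text \<open>An almost homomorphic, \<open>D\<close>-equivariant retraction of \<open>D E\<close> onto \<open>D\<close>.\<close>
  define DE where "DE = {d \<otimes> x | d x. d \<in> D \<and> x \<in> E}"
  define rep where "rep x = (SOME y. y \<in> E \<and> x \<otimes> inv y \<in> D)" for x
  define r where "r x = x \<otimes> inv (rep x) \<otimes> z [^] int (nz (rep x))" for x
  have DEc: "x \<in> carrier G" if "x \<in> DE" for x using that Dc Ec by (auto simp: DE_def)
  have rep: "rep x \<in> E \<and> x \<otimes> inv (rep x) \<in> D" if x: "x \<in> DE" for x
    unfolding rep_def
  proof (rule someI_ex)
    obtain d y where "x = d \<otimes> y" "d \<in> D" "y \<in> E" using x by (auto simp: DE_def)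
    then have "y \<in> E \<and> x \<otimes> inv y \<in> D" using Dc Ec by (simp add: m_assoc)
    then show "\<exists>y. y \<in> E \<and> x \<otimes> inv y \<in> D" by blast
  qed
  have rD: "r x \<in> D" if "x \<in> DE" for x using rep[OF that] Dm zD by (simp add: r_def)
  \<comment> \<open>On a coset of \<open>D\<close> the predicate defining the choice is the same on
    all members, so the chosen representatives coincide; this is the source of the equivariance of
    \<open>r\<close>.\<close>
  have rep_eq: "rep (x \<otimes> d) = rep x" if x: "x \<in> carrier G" and d: "d \<in> D" for x d
  proof -
    have "x \<otimes> d \<otimes> inv y \<in> D \<longleftrightarrow> x \<otimes> inv y \<in> D" if y: "y \<in> E" for y
    proof -
      have eq: "x \<otimes> d \<otimes> inv y = (x \<otimes> inv y) \<otimes> d" using x Dc[OF d] Ec[OF y] by (simp add: m_ac)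
      have "x \<otimes> inv y = (x \<otimes> d \<otimes> inv y) \<otimes> inv d" using x Dc[OF d] Ec[OF y] by (simp add: eq m_assoc)
      then show ?thesis using eq Dm[OF _ d] Dm[OF _ Dinv[OF d]] by metis
    qed
    then show ?thesis unfolding rep_def by metis
  qed
  have rm: "r (x \<otimes> d) = r x \<otimes> d" if x: "x \<in> DE" and d: "d \<in> D" for x d
  proof -
    have "inv (rep x) \<in> carrier G" "z [^] int (nz (rep x)) \<in> carrier G"
      using Ec[OF conjunct1[OF rep[OF x]]] Dc[OF zD] by auto
    moreover define i where "i = inv (rep x)"
    moreover define w where "w = z [^] int (nz (rep x))"
    ultimately have "x \<otimes> d \<otimes> i \<otimes> w = x \<otimes> i \<otimes> w \<otimes> d"
      using DEc[OF x] Dc[OF d] by (simp add: m_ac)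
    then show ?thesis unfolding r_def rep_eq[OF DEc[OF x] d] i_def w_def .
  qed
  \<comment> \<open>Passing from x to \<open>r x\<close> exchanges \<open>rep x\<close> for a power
    of \<open>z\<close> with nearly the same rotation, so the total rotation changes by less than
    \<eta> modulo integers although \<open>r x\<close> lies in \<open>D\<close>.\<close>
  have rX: "\<exists>j::int. \<bar>X1 i (r x) - X1 i x - of_int j\<bar> < \<eta>" if i: "i < m0" and x: "x \<in> DE" for i x
  proof -
    let ?y = "rep x" and ?w = "z [^] int (nz (rep x))"
    have c: "x \<in> carrier G" "?y \<in> carrier G" "?w \<in> carrier G" using DEc[OF x] Ec[OF conjunct1[OF rep[OF x]]] Dc[OF zD] by auto
    have ry: "r x \<otimes> ?y = x \<otimes> ?w"
    proof -
      have "x \<otimes> i \<otimes> w \<otimes> y = x \<otimes> w \<otimes> (i \<otimes> y)"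
        if "i \<in> carrier G" "w \<in> carrier G" "y \<in> carrier G" for i w y using c(1) that by (simp add: m_ac)
      from this[OF inv_closed[OF c(2)] c(3,2)] have "r x \<otimes> ?y = x \<otimes> ?w \<otimes> (inv ?y \<otimes> ?y)" unfolding r_def .
      then show ?thesis using c by simp
    qed
    obtain a b j :: int where a: "X1 i (r x \<otimes> ?y) - X1 i (r x) - X1 i ?y = of_int a"
      and b: "X1 i (x \<otimes> ?w) - X1 i x - X1 i ?w = of_int b"
      and j: "\<bar>X1 i ?w - X1 i ?y - of_int j\<bar> < \<eta>"
      using X1m[OF Dc[OF rD[OF x]] c(2), of i] X1m[OF c(1,3), of i] nz[OF i, of ?y] by (auto elim!: Ints_cases)
    have "X1 i (r x) - X1 i x - of_int (j + b - a) = X1 i ?w - X1 i ?y - of_int j"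
      using a b by (simp add: ry)
    with j show ?thesis by (intro exI[of _ "j + b - a"]) simp
  qed
  \<comment> \<open>The elements that imitate \<open>l\<close>. By equivariance of \<open>r\<close>,
    the steps from all x in \<open>DE\<close> already occur for x in the finite set \<open>E\<close>
    (\<open>Dl_mem\<close>), so the test set is finite and is fixed before \<open>s\<close>.\<close>
  define Dl where "Dl l = {r (x \<otimes> l) \<otimes> inv (r x) | x. x \<in> E \<and> x \<otimes> l \<in> DE}" for l
  have E_DE: "x \<in> DE" if "x \<in> E" for x
    unfolding DE_def mem_Collect_eq using that subgroup.one_closed[OF Dsub] Ec[OF that] by (intro exI[of _ "\<one>"] exI[of _ x]) simp
  have DlD: "Dl l \<subseteq> D" for l using rD E_DE Dm Dinv by (auto simp: Dl_def)
  have Dlfin: "finite (Dl l)" for l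
    by (rule finite_subset[OF _ finite_imageI[OF E(1), of "\<lambda>x. r (x \<otimes> l) \<otimes> inv (r x)"]]) (auto simp: Dl_def)
  have Dl_mem: "r (x \<otimes> l) \<otimes> inv (r x) \<in> Dl l" if x: "x \<in> DE" and xl: "x \<otimes> l \<in> DE" and l: "l \<in> carrier G" for x l
  proof -
    obtain d y where dy: "x = d \<otimes> y" "d \<in> D" "y \<in> E" using x by (auto simp: DE_def)
    note cc = Dc[OF dy(2)] Ec[OF dy(3)] l
    have "y \<otimes> l \<in> DE"
    proof -
      obtain d' y' where "x \<otimes> l = d' \<otimes> y'" "d' \<in> D" "y' \<in> E" using xl by (auto simp: DE_def)
      moreover have "y \<otimes> l = inv d \<otimes> (x \<otimes> l)" using cc by (simp add: dy(1) m_assoc[symmetric])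
      ultimately have "y \<otimes> l = (inv d \<otimes> d') \<otimes> y'" using cc Dc Ec by (simp add: m_assoc)
      then show ?thesis using Dm[OF Dinv[OF dy(2)] \<open>d' \<in> D\<close>] \<open>y' \<in> E\<close> by (auto simp: DE_def)
    qed
    moreover have "r (x \<otimes> l) = r (y \<otimes> l) \<otimes> d" "r x = r y \<otimes> d"
    proof -
      have "x \<otimes> l = (y \<otimes> l) \<otimes> d" "x = y \<otimes> d" using cc by (simp_all add: dy(1) m_ac)
      then show "r (x \<otimes> l) = r (y \<otimes> l) \<otimes> d" "r x = r y \<otimes> d"
        using rm[OF calculation dy(2)] rm[OF E_DE[OF dy(3)] dy(2)] by simp_all
    qed
    moreover have "(r (y \<otimes> l) \<otimes> d) \<otimes> inv (r y \<otimes> d) = r (y \<otimes> l) \<otimes> inv (r y)"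
    proof -
      have c': "r (y \<otimes> l) \<in> carrier G" "r y \<in> carrier G" "d \<in> carrier G"
        using Dc rD calculation(1) E_DE[OF dy(3)] dy(2) by auto
      have "a \<otimes> d \<otimes> (i \<otimes> j) = a \<otimes> i \<otimes> (d \<otimes> j)"
        if "a \<in> carrier G" "i \<in> carrier G" "j \<in> carrier G" for a i j using c'(3) that by (simp add: m_ac)
      from this[OF c'(1) inv_closed[OF c'(2)] inv_closed[OF c'(3)]]
      have "(r (y \<otimes> l) \<otimes> d) \<otimes> inv (r y \<otimes> d) = r (y \<otimes> l) \<otimes> inv (r y) \<otimes> (d \<otimes> inv d)"
        unfolding inv_mult[OF c'(2,3)] .
      then show ?thesis using c' by simp
    qed
    ultimately show ?thesis using dy(3) by (auto simp: Dl_def)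
  qed
  have DlX: "\<exists>j::int. \<bar>X1 i d - X0 i l - of_int j\<bar> < d0" if i: "i < m0" and l: "l \<in> F" and d: "d \<in> Dl l" for i l d
  proof -
    obtain x where x: "d = r (x \<otimes> l) \<otimes> inv (r x)" "x \<in> E" "x \<otimes> l \<in> DE" using d by (auto simp: Dl_def)
    note cc = Dc[OF rD[OF x(3)]] Dc[OF rD[OF E_DE[OF x(2)]]] Fc[OF l] Ec[OF x(2)]
    have dc: "d \<in> carrier G" using x(1) cc by simp
    have "d \<otimes> r x = r (x \<otimes> l)" using cc by (simp add: x(1) m_assoc)
    then obtain a :: int where a: "X1 i (r (x \<otimes> l)) - X1 i d - X1 i (r x) = of_int a"
      using X1m[OF dc cc(2), of i] by (auto elim!: Ints_cases)
    obtain b :: int where b: "X1 i (x \<otimes> l) - X1 i x - X1 i l = of_int b"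
      using X1m[OF cc(4,3), of i] by (auto elim!: Ints_cases)
    obtain j1 j2 :: int where j1: "\<bar>X1 i (r (x \<otimes> l)) - X1 i (x \<otimes> l) - of_int j1\<bar> < \<eta>"
      and j2: "\<bar>X1 i (r x) - X1 i x - of_int j2\<bar> < \<eta>"
      using rX[OF i x(3)] rX[OF i E_DE[OF x(2)]] by blast
    have eq: "X1 i d - X0 i l - of_int (j1 - j2 + b - a) =
      (X1 i (r (x \<otimes> l)) - X1 i (x \<otimes> l) - of_int j1) - (X1 i (r x) - X1 i x - of_int j2) + lam l * v i"
      using a b by (simp add: X1_def[of i l])
    have "\<bar>lam l * v i\<bar> \<le> K * \<eta>"
      unfolding abs_mult using K[OF l] v[OF i] K0 by (intro mult_mono) auto
    then have "\<bar>X1 i d - X0 i l - of_int (j1 - j2 + b - a)\<bar> < (K + 2) * \<eta>"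
      unfolding eq using j1 j2 by (simp add: algebra_simps abs_if split: if_splits)
    then show ?thesis using \<eta>(2) by (intro exI[of _ "j1 - j2 + b - a"]) linarith
  qed
  let ?L = "G\<lparr>carrier := D\<rparr>"
  have L: "comm_group ?L"
    using group.group_comm_groupI[OF subgroup_imp_group[OF Dsub]] Dc by (simp add: m_comm)
  have X1L: "hom_mod \<int> ?L (carrier ?L) (X1 i)" for i
    using X1[of i] Dc by (simp add: hom_mod_def)
  have oneL: "(\<lambda>_. \<one>\<^bsub>Aut M\<^esub>) \<in> hom ?L (Aut M)" and oneG: "(\<lambda>_. \<one>\<^bsub>Aut M\<^esub>) \<in> hom G (Aut M)"
    by (auto simp: hom_def)
  define f0 where "f0 k = p (c0 k)" for k
  have f0: "finite (range f0)" "{k. f0 k = a} \<in> sets torus" "f0 k \<in> carrier (Aut M)" for a k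
  proof -
    show "finite (range f0)"
      by (rule finite_subset[OF _ finite_imageI[OF c0fin, of p]]) (auto simp: f0_def)
    show "{k. f0 k = a} \<in> sets torus" unfolding f0_def by (rule tower_sets[OF t0])
    show "f0 k \<in> carrier (Aut M)" unfolding f0_def by (rule pc[OF c0])
  qed
  obtain q1 where q1: "\<And>n. q1 n \<in> hom ?L (Aut M)"
    and ev1: "\<And>x A C e e'. x \<in> carrier ?L \<Longrightarrow> A \<in> sets (completion M) \<Longrightarrow> C \<in> sets (completion M) \<Longrightarrow> e \<ge> 0 \<Longrightarrow> e' > 0 \<Longrightarrow>
      eventually (\<lambda>n. sd M (?im (q1 n x) A) C <
        e + measure torus {k. sd M (?im (cocycle M X1 f0 (\<lambda>_. \<one>\<^bsub>Aut M\<^esub>) x k) A) C > e} + e') sequentially"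
    by (rule skew_actions[where X = X1 and f = f0 and r = "\<lambda>_. \<one>\<^bsub>Aut M\<^esub>", OF M L X1L f0 oneL]) blast
  have near1: "eventually (\<lambda>n. sd M (?im (q1 n d) A) (?im (p l) A) < 3 * e1) sequentially"
    if l: "l \<in> F" and d: "d \<in> Dl l" and A: "A \<in> As" for l d A
  proof -
    have dD: "d \<in> D" using DlD d by auto
    \<comment> \<open>By \<open>DlX\<close> this vector is within \<open>d0\<close> of integers in
      the first \<open>m0\<close> coordinates, which are the ones that \<open>c0\<close> sees. So
      \<open>c0\<close> moves under \<open>d\<close> as it does under \<open>l\<close>, outside a
      set of measure below \<open>e1\<close>.\<close>
    define t where "t i = X1 i d - X0 i l" for i
    have sh: "shift X1 d k = rot t (shift X0 l k)" for k
      unfolding shift_def by (rule rot_rot[symmetric]) (simp add: t_def)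
    have sm: "measure torus {k. c0 (rot t k) \<noteq> c0 k} < e1"
      using DlX[OF _ l d] by (intro d0(2)) (auto simp: t_def)
    let ?B = "{k. shift X0 l k \<in> {k. c0 (rot t k) \<noteq> c0 k}}"
    have B: "?B \<in> sets torus" "measure torus ?B < e1"
      using measure_rot[OF tower_rot_sets[OF t0, of "\<lambda>x y. x \<noteq> y" t], of "\<lambda>i. X0 i l"] sm by (simp_all add: shift_def)
    have same: "cocycle M X1 f0 (\<lambda>_. \<one>\<^bsub>Aut M\<^esub>) d k = p l" if "k \<notin> ?B \<union> defect G X0 c0 l" for k
    proof -
      have "c0 (shift X1 d k) = l \<otimes> c0 k"
        using that c0 Fc[OF l] by (auto simp: sh defect_def m_comm)
      then show ?thesis
        using pc[OF c0[of k]] pc[OF Fc[OF l]] by (simp add: cocycle_def f0_def pm[OF Fc[OF l] c0] A.m_assoc)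
    qed
    have "{k. sd M (?im (cocycle M X1 f0 (\<lambda>_. \<one>\<^bsub>Aut M\<^esub>) d k) A) (?im (p l) A) > 0} \<subseteq> ?B \<union> defect G X0 c0 l"
    proof
      fix k assume k: "k \<in> {k. sd M (?im (cocycle M X1 f0 (\<lambda>_. \<one>\<^bsub>Aut M\<^esub>) d k) A) (?im (p l) A) > 0}"
      show "k \<in> ?B \<union> defect G X0 c0 l"
      proof (rule ccontr)
        assume "k \<notin> ?B \<union> defect G X0 c0 l"
        then show False using k same[of k] by simp
      qed
    qed
    then have "measure torus {k. sd M (?im (cocycle M X1 f0 (\<lambda>_. \<one>\<^bsub>Aut M\<^esub>) d k) A) (?im (p l) A) > 0} \<le>
        measure torus (?B \<union> defect G X0 c0 l)"
      using B defect_sets[OF t0] by (intro T.finite_measure_mono) auto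
    also have "\<dots> \<le> measure torus ?B + measure torus (defect G X0 c0 l)"
      using B defect_sets[OF t0] by (intro measure_Un_le) auto
    also have "\<dots> < e1 + e1" using B df0 l by (intro add_strict_mono) auto
    finally have "measure torus {k. sd M (?im (cocycle M X1 f0 (\<lambda>_. \<one>\<^bsub>Aut M\<^esub>) d k) A) (?im (p l) A) > 0} < 2 * e1" by simp
    then show ?thesis
      using ev1[of d A "?im (p l) A" 0 e1] dD AsC[OF A] aut_image_sets[OF pc[OF Fc[OF l]] AsC[OF A]] e1
      by (auto elim!: eventually_mono)
  qed
  have "eventually (\<lambda>n. \<forall>l\<in>F. \<forall>d\<in>Dl l. \<forall>A\<in>As. sd M (?im (q1 n d) A) (?im (p l) A) < 3 * e1) sequentially"
    using near1 F As Dlfin by (intro eventually_ball_finite ballI) auto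
  then obtain n1 where n1: "\<And>l d A. l \<in> F \<Longrightarrow> d \<in> Dl l \<Longrightarrow> A \<in> As \<Longrightarrow> sd M (?im (q1 n1 d) A) (?im (p l) A) < 3 * e1"
    using eventually_happens'[OF sequentially_bot] by blast
  show ?thesis
  proof (rule nearby_extensionsI)
    show "q1 n1 \<in> hom ?L (Aut M)" by (rule q1)
    show "finite (\<Union>(Dl ` F))" "\<Union>(Dl ` F) \<subseteq> D" using F Dlfin DlD by auto
    show "finite As" "As \<subseteq> sets M" "finite F" "finite As" "e1 > 0" by (rule As F e1)+
    fix s S Bs and e' :: real
    assume s: "s \<in> hom ?L (Aut M)"
      and near: "\<And>d A. d \<in> \<Union>(Dl ` F) \<Longrightarrow> A \<in> As \<Longrightarrow> sd M (?im (s d) A) (?im (q1 n1 d) A) < e1"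
      and S: "finite S" "S \<subseteq> D" and Bs: "finite Bs" "Bs \<subseteq> sets M" and e': "e' > 0"
    have sc: "s x \<in> carrier (Aut M)" if "x \<in> D" for x using s that by (auto simp: hom_def)
    have sm: "s (x \<otimes> y) = s x \<otimes>\<^bsub>Aut M\<^esub> s y" if "x \<in> D" "y \<in> D" for x y
      using s that by (simp add: hom_def)
    have near2: "sd M (?im (s d) A) (?im (p l) A) < 4 * e1" if l: "l \<in> F" and d: "d \<in> Dl l" and A: "A \<in> As" for l d A
    proof -
      have dD: "d \<in> D" using DlD d by auto
      have q1c: "q1 n1 d \<in> carrier (Aut M)" using q1[of n1] dD by (auto simp: hom_def)
      have "sd M (?im (s d) A) (?im (p l) A) \<le> sd M (?im (s d) A) (?im (q1 n1 d) A) + sd M (?im (q1 n1 d) A) (?im (p l) A)"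
        by (intro sd_triangle[OF pM] aut_image_sets AsC[OF A] sc[OF dD] q1c pc[OF Fc[OF l]])
      moreover have "sd M (?im (s d) A) (?im (q1 n1 d) A) < e1" using near l d A by blast
      ultimately show ?thesis using n1[OF l d A] by linarith
    qed
    have e4: "e' / 4 > 0" using e' by simp
    obtain m X c where t: "tower G m X c" and cE: "\<forall>k. \<exists>d\<in>D. \<exists>x\<in>E. c k = d \<otimes> x"
      and dF: "\<forall>f\<in>F. measure torus (defect G X c f) < e1" and dS: "\<forall>s\<in>S. measure torus (defect G X c s) < e' / 4"
      using E(3)[OF S e4] by (elim exE conjE)
    have cDE: "c k \<in> DE" for k using cE[rule_format, of k] unfolding DE_def by blast
    have X: "\<And>i. hom_mod \<int> G (carrier G) (X i)" and cfin: "finite (range c)"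
      using t unfolding tower_def by blast+
    define f where "f k = s (r (c k))" for k
    have ffin: "finite (range f)"
      by (rule finite_subset[OF _ finite_imageI[OF cfin, of "\<lambda>x. s (r x)"]]) (auto simp: f_def)
    have fs: "{k. f k = a} \<in> sets torus" for a unfolding f_def by (rule tower_sets[OF t])
    have fc: "f k \<in> carrier (Aut M)" for k unfolding f_def by (rule sc[OF rD[OF cDE]])
    let ?co = "cocycle M X f (\<lambda>_. \<one>\<^bsub>Aut M\<^esub>)"
    obtain q where q: "\<And>n. q n \<in> hom G (Aut M)"
      and ev: "\<And>x A C e e'. x \<in> carrier G \<Longrightarrow> A \<in> sets (completion M) \<Longrightarrow> C \<in> sets (completion M) \<Longrightarrow> e \<ge> 0 \<Longrightarrow> e' > 0 \<Longrightarrow>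
        eventually (\<lambda>n. sd M (?im (q n x) A) C < e + measure torus {k. sd M (?im (?co x k) A) C > e} + e') sequentially"
      by (rule skew_actions[where X = X and f = f and r = "\<lambda>_. \<one>\<^bsub>Aut M\<^esub>", OF M comm_group_axioms X ffin fs fc oneG]) blast
    \<comment> \<open>The base action is trivial here, so the cocycle is a quotient of two values of
      \<open>f\<close>, and \<open>s\<close> being a homomorphism on \<open>D\<close> turns it into
      \<open>s\<close> of one step of \<open>r\<close>.\<close>
    have co: "?co l k = s (r (c k \<otimes> l) \<otimes> inv (r (c k)))" and cl: "c k \<otimes> l \<in> DE" if "k \<notin> defect G X c l" for l k
    proof -
      have ck: "c (shift X l k) = c k \<otimes> l" using that by (simp add: defect_def)
      show cl: "c k \<otimes> l \<in> DE" using cDE[of "shift X l k"] by (simp add: ck)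
      let ?a = "r (c k \<otimes> l)" and ?b = "r (c k)"
      have ab: "?a \<in> D" "?b \<in> D" "?a \<otimes> inv ?b \<in> D" using rD[OF cl] rD[OF cDE] Dm Dinv by auto
      have "?a = (?a \<otimes> inv ?b) \<otimes> ?b" using ab Dc by (simp add: m_assoc)
      then have "s ?a = s (?a \<otimes> inv ?b) \<otimes>\<^bsub>Aut M\<^esub> s ?b" using sm[OF ab(3,2)] by simp
      then show "?co l k = s (?a \<otimes> inv ?b)"
        using sc[OF ab(2)] sc[OF ab(3)] by (simp add: cocycle_def f_def ck A.m_assoc)
    qed
    show "\<exists>q. (\<forall>n. q n \<in> hom G (Aut M)) \<and>
      (\<forall>l\<in>F. \<forall>A\<in>As. eventually (\<lambda>n. sd M (?im (q n l) A) (?im (p l) A) < e) sequentially) \<and>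
      (\<forall>l\<in>S. \<forall>B\<in>Bs. eventually (\<lambda>n. sd M (?im (q n l) B) (?im (s l) B) < e') sequentially)"
    proof (intro exI[of _ q] conjI ballI allI q)
      fix l A assume l: "l \<in> F" and A: "A \<in> As"
      have "{k. sd M (?im (?co l k) A) (?im (p l) A) > 4 * e1} \<subseteq> defect G X c l"
      proof
        fix k assume k: "k \<in> {k. sd M (?im (?co l k) A) (?im (p l) A) > 4 * e1}"
        show "k \<in> defect G X c l"
        proof (rule ccontr)
          assume nd: "k \<notin> defect G X c l"
          have "sd M (?im (?co l k) A) (?im (p l) A) < 4 * e1"
            unfolding co[OF nd] by (rule near2[OF l Dl_mem[OF cDE cl[OF nd] Fc[OF l]] A])
          with k show False by simp
        qed
      qed
      then have "measure torus {k. sd M (?im (?co l k) A) (?im (p l) A) > 4 * e1} \<le> measure torus (defect G X c l)"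
        by (rule measure_subset_defect[OF t])
      then have small: "measure torus {k. sd M (?im (?co l k) A) (?im (p l) A) > 4 * e1} < e1" using dF l by fastforce
      have "eventually (\<lambda>n. sd M (?im (q n l) A) (?im (p l) A) <
          4 * e1 + measure torus {k. sd M (?im (?co l k) A) (?im (p l) A) > 4 * e1} + e1) sequentially"
        by (rule ev[OF Fc[OF l] AsC[OF A] aut_image_sets[OF pc[OF Fc[OF l]] AsC[OF A]]]) (use e1 in auto)
      then show "eventually (\<lambda>n. sd M (?im (q n l) A) (?im (p l) A) < e) sequentially"
      proof (rule eventually_mono)
        fix n assume "sd M (?im (q n l) A) (?im (p l) A) <
          4 * e1 + measure torus {k. sd M (?im (?co l k) A) (?im (p l) A) > 4 * e1} + e1"
        moreover have "8 * e1 = e" by (simp add: e1_def)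
        ultimately show "sd M (?im (q n l) A) (?im (p l) A) < e" using small e1 by linarith
      qed
    next
      fix l B assume l: "l \<in> S" and B: "B \<in> Bs"
      have lD: "l \<in> D" and BC: "B \<in> sets (completion M)" using S Bs l B by auto
      have "{k. sd M (?im (?co l k) B) (?im (s l) B) > 0} \<subseteq> defect G X c l"
      proof
        fix k assume k: "k \<in> {k. sd M (?im (?co l k) B) (?im (s l) B) > 0}"
        show "k \<in> defect G X c l"
        proof (rule ccontr)
          assume nd: "k \<notin> defect G X c l"
          \<comment> \<open>For \<open>l\<close> in \<open>D\<close> the equivariance of
            \<open>r\<close> makes the step equal to \<open>l\<close> itself, so the new action
            restricts to \<open>s\<close> off the defect.\<close>
          have "r (c k \<otimes> l) \<otimes> inv (r (c k)) = l \<otimes> (r (c k) \<otimes> inv (r (c k)))"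
            using Dc[OF rD[OF cDE[of k]]] Dc[OF lD] by (simp add: rm[OF cDE lD] m_ac)
          also have "\<dots> = l" using Dc[OF rD[OF cDE[of k]]] Dc[OF lD] by simp
          finally have "?co l k = s l" using co[OF nd] by simp
          with k show False by simp
        qed
      qed
      then have "measure torus {k. sd M (?im (?co l k) B) (?im (s l) B) > 0} \<le> measure torus (defect G X c l)"
        by (rule measure_subset_defect[OF t])
      then have small: "measure torus {k. sd M (?im (?co l k) B) (?im (s l) B) > 0} < e' / 4" using dS l by fastforce
      have "eventually (\<lambda>n. sd M (?im (q n l) B) (?im (s l) B) <
          0 + measure torus {k. sd M (?im (?co l k) B) (?im (s l) B) > 0} + e' / 4) sequentially"
        by (rule ev[OF Dc[OF lD] BC aut_image_sets[OF sc[OF lD] BC]]) (use e' in auto)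
      then show "eventually (\<lambda>n. sd M (?im (q n l) B) (?im (s l) B) < e') sequentially"
      proof (rule eventually_mono)
        fix n assume "sd M (?im (q n l) B) (?im (s l) B) <
          0 + measure torus {k. sd M (?im (?co l k) B) (?im (s l) B) > 0} + e' / 4"
        then show "sd M (?im (q n l) B) (?im (s l) B) < e'" using small e' by linarith
      qed
    qed
  qed
qed

end

theorem theorem3p7:
  fixes M :: "'a measure" and \<Gamma> :: "('g, 'm) monoid_scheme" and \<Delta> :: "'g set"
  assumes "standard_atomless_prob_space M"
    and "comm_group \<Gamma>" and "countable (carrier \<Gamma>)"
    and "subgroup \<Delta> \<Gamma>" and "\<exists>S. finite S \<and> S \<subseteq> carrier \<Gamma> \<and> \<Delta> = generate \<Gamma> S"
  shows "category_preserving_map (Hom_topology \<Gamma> M) (Hom_topology (\<Gamma>\<lparr>carrier := \<Delta>\<rparr>) M)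
           (\<lambda>\<pi>. restrict \<pi> \<Delta>)"
proof -
  interpret comm_group \<Gamma> by (rule assms(2))
  obtain S where S: "finite S" "S \<subseteq> carrier \<Gamma>" "\<Delta> = generate \<Gamma> S" using assms(5) by (elim exE conjE)
  have pM: "prob_space M" using assms(1) by (simp add: standard_atomless_prob_space_def)
  have "nearby_extensions M \<Gamma> \<Delta> p F As e"
    if p: "p \<in> hom \<Gamma> (Aut M)" and F: "finite F" "F \<subseteq> carrier \<Gamma>" and As: "finite As" "As \<subseteq> sets M" and e: "e > 0"
    for p F As e
  proof (cases "\<exists>z\<in>\<Delta>. \<forall>k::int. z [^]\<^bsub>\<Gamma>\<^esub> k = \<one>\<^bsub>\<Gamma>\<^esub> \<longrightarrow> k = 0")
    case True
    then obtain z where z: "z \<in> \<Delta>" "\<forall>k::int. z [^]\<^bsub>\<Gamma>\<^esub> k = \<one>\<^bsub>\<Gamma>\<^esub> \<longrightarrow> k = 0" by (elim bexE)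
    show ?thesis by (rule nearby_extensions_infinite[OF assms(1,3) S z p F As e])
  next
    case False
    have "\<exists>n>0. z [^]\<^bsub>\<Gamma>\<^esub> int n = \<one>\<^bsub>\<Gamma>\<^esub>" if z: "z \<in> generate \<Gamma> S" for z
    proof -
      have zc: "z \<in> carrier \<Gamma>" using subgroup.mem_carrier[OF assms(4)] z S(3) by simp
      have "\<not> (\<forall>k::int. z [^]\<^bsub>\<Gamma>\<^esub> k \<in> {\<one>\<^bsub>\<Gamma>\<^esub>} \<longrightarrow> k = 0)" using False z S(3) by simp
      then obtain n where "n > 0" "\<forall>k::int. z [^]\<^bsub>\<Gamma>\<^esub> k \<in> {\<one>\<^bsub>\<Gamma>\<^esub>} \<longleftrightarrow> int n dvd k"
        using pow_subgroup_cases[OF triv_subgroup zc] by blast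
      then show ?thesis by (intro exI[of _ n]) simp
    qed
    then have "finite \<Delta>" unfolding S(3) by (rule finite_generate_torsion[OF S(1,2)])
    show ?thesis by (rule nearby_extensions_finite[OF assms(1,3) S \<open>finite \<Delta>\<close> p F As e])
  qed
  then show ?thesis
    by (intro category_preserving_restrictI[OF pM is_group assms(4)]) (simp only: nearby_extensions_def)
qed

end
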